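(* Let $S$ be a closed surface of genus $\geq 2$ equipped with a Euclidean metric with finitely many conical singularities $s_1,\dots,s_n$, each of cone angle $\theta(s_i)\in(2\pi,+\infty)$. Let $g$ be a geodesic (a local isometric map $\mathbb{R}\to S$) which is not closed, or a geodesic ray (a local isometric map $[0,\infty)\to S$) which is not closed. Then \[ d\big(\operatorname{Im} g,\{s_1,\dots,s_n\}\big)=0, \] where $d(A,B)=\inf\{d(a,b): a\in A, b\in B\}$.
   Context: A Euclidean surface with conical singularities $s_1,\dots,s_n$: every point other than the $s_i$ has a neighbourhood isometric to a Euclidean disk, and each $s_i$ has a neighbourhood isometric to a neighbourhood of the vertex of the standard cone $C(v,\theta)=\{(r,t): r\geq0,\ t\in\mathbb{R}/\theta\mathbb{Z}\}$ with metric $ds^2=dr^2+r^2dt^2$, $\theta=\theta(s_i)$. A geodesic is closed if it is a periodic map. *)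

theory Defs
  imports "HOL-Analysis.Analysis" "HOL-Homology.Homology"
begin

text \<open>Metric of the standard cone C(v,theta), points written (r,t) with r \<ge> 0 and
  t in [0,theta). The angular separation is measured on the circle of length theta;
  if it is at least pi, the shortest path passes through the vertex.\<close>
definition cone_dist :: "real \<Rightarrow> real \<times> real \<Rightarrow> real \<times> real \<Rightarrow> real" where
  "cone_dist \<theta> p q =
     (let r1 = fst p; r2 = fst q; d = \<bar>snd p - snd q\<bar>; a = min d (\<theta> - d) in
      if a \<ge> pi then r1 + r2 else sqrt (r1\<^sup>2 + r2\<^sup>2 - 2 * r1 * r2 * cos a))"

text \<open>Open ball of radius rho about the vertex of C(v,theta); the vertex is represented
  by the single point (0,0).\<close>
definition cone_ball :: "real \<Rightarrow> real \<Rightarrow> (real \<times> real) set" where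
  "cone_ball \<theta> \<rho> = insert (0,0) {(r,t). 0 < r \<and> r < \<rho> \<and> 0 \<le> t \<and> t < \<theta>}"

definition flat_point :: "'a::metric_space \<Rightarrow> bool" where
  "flat_point x \<longleftrightarrow> (\<exists>U f (c::complex) \<rho>. open U \<and> x \<in> U \<and> \<rho> > 0 \<and> f ` U = ball c \<rho> \<and>
      (\<forall>y\<in>U. \<forall>z\<in>U. dist (f y) (f z) = dist y z))"

definition cone_point :: "real \<Rightarrow> 'a::metric_space \<Rightarrow> bool" where
  "cone_point \<theta> s \<longleftrightarrow> (\<exists>U f \<rho>. open U \<and> s \<in> U \<and> \<rho> > 0 \<and> f ` U = cone_ball \<theta> \<rho> \<and>
      f s = (0,0) \<and> (\<forall>y\<in>U. \<forall>z\<in>U. cone_dist \<theta> (f y) (f z) = dist y z))"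

text \<open>Euclidean surface with conical singularities Sing and cone angles theta, whose
  metric is the (intrinsic) length metric; for a compact space this is equivalent to the
  existence of midpoints.\<close>
definition euclidean_cone_surface :: "'a::metric_space set \<Rightarrow> ('a \<Rightarrow> real) \<Rightarrow> bool" where
  "euclidean_cone_surface Sing \<theta> \<longleftrightarrow> finite Sing \<and>
     (\<forall>x. x \<notin> Sing \<longrightarrow> flat_point x) \<and> (\<forall>s\<in>Sing. cone_point (\<theta> s) s) \<and>
     (\<forall>x y::'a. \<exists>z. dist x z = dist x y / 2 \<and> dist z y = dist x y / 2)"

text \<open>Closed (compact, connected) orientable surface of genus at least 2, via singular
  homology: orientable means H_2 is nontrivial, and H_1 = Z^(2g) contains 4
  Z-linearly independent elements iff g \<ge> 2.\<close>
definition closed_orientable_genus_ge2 :: "'a topology \<Rightarrow> bool" where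
  "closed_orientable_genus_ge2 X \<longleftrightarrow> compact_space X \<and> connected_space X \<and>
     carrier (homology_group 2 X) \<noteq> {\<one>\<^bsub>homology_group 2 X\<^esub>} \<and>
     (\<exists>a::nat \<Rightarrow> _. (\<forall>i<4. a i \<in> carrier (homology_group 1 X)) \<and>
        (\<forall>k::nat \<Rightarrow> int.
           (a 0 [^]\<^bsub>homology_group 1 X\<^esub> k 0) \<otimes>\<^bsub>homology_group 1 X\<^esub>
           (a 1 [^]\<^bsub>homology_group 1 X\<^esub> k 1) \<otimes>\<^bsub>homology_group 1 X\<^esub>
           (a 2 [^]\<^bsub>homology_group 1 X\<^esub> k 2) \<otimes>\<^bsub>homology_group 1 X\<^esub>
           (a 3 [^]\<^bsub>homology_group 1 X\<^esub> k 3) = \<one>\<^bsub>homology_group 1 X\<^esub>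
           \<longrightarrow> (\<forall>i<4. k i = 0)))"

definition local_isometry_on :: "real set \<Rightarrow> (real \<Rightarrow> 'a::metric_space) \<Rightarrow> bool" where
  "local_isometry_on D g \<longleftrightarrow> (\<forall>t\<in>D. \<exists>\<epsilon>>0. \<forall>u\<in>D. \<forall>v\<in>D.
      \<bar>u - t\<bar> < \<epsilon> \<longrightarrow> \<bar>v - t\<bar> < \<epsilon> \<longrightarrow> dist (g u) (g v) = \<bar>u - v\<bar>)"

definition periodic_on :: "real set \<Rightarrow> (real \<Rightarrow> 'a) \<Rightarrow> bool" where
  "periodic_on D g \<longleftrightarrow> (\<exists>T>0. \<forall>t\<in>D. g (t + T) = g t)"

end

theory Submission
  imports Defs
begin

text \<open>Suppose the geodesic keeps distance at least \<open>\<epsilon>\<close> from the singularities, and that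
  there are singularities. It is then the axis of a half-infinite flat strip immersed in the regular
  part. An immersed disk that avoids the singularities has radius at most the diameter, so strips
  occurring along arbitrarily long late pieces of the geodesic have bounded width; take one of almost
  maximal width, and a limit \<open>\<phi>\<close> of its germs, which extends to a bi-infinite strip.
  Late pieces of the geodesic differ from the axis of \<open>\<phi>\<close> by plane motions tending to the
  identity. A small non-zero rotation angle would make the geodesic's own strip cross the border of
  the maximal strip along an arbitrarily long rectangle, contradicting maximality. So late returns are
  parallel, and two of them give a translation symmetry of the limit strip. Its transverse part
  vanishes, since otherwise the strip could be widened; hence it is a translation along the axis and
  the geodesic is periodic.

  The genus serves to exclude a surface without singularities. Such a surface is covered by the plane,
  the square of every deck transformation is a translation, and the translations form a discrete
  subgroup of the plane; so four classes in the first homology group are always dependent.\<close>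

section \<open>Isometries of the plane\<close>

text \<open>The regular part is incomplete, so a strip can be continued only as far as the
  singularities permit. Instead of a developing map, the proof works with germs at 0 and asks over
  which plane regions a germ continues as a local isometry. The regions are kept convex, so two
  continuations of one germ agree on their connected overlap and can be glued. Charts have a uniform
  radius on the compact set of points at distance at least \<epsilon> from the singularities; a
  quarter of it is the half-width \<open>w\<close> of the strip that the geodesic carries. The
  supremum of widths of late strips need not be attained, so a pair within \<open>w/4\<close> of it
  is fixed. A tilted return would gain \<open>w/2\<close>, and transferring the gain from the limit
  germ back to the ray costs at most \<open>w/4\<close>, which leaves exactly the forbidden excess.
  A transverse drift between parallel returns can be arbitrarily small, so no fixed slack excludes
  it; a second supremum does, taken over the strips to which the one limit germ extends.\<close>

definition iso_on :: "'a::metric_space set \<Rightarrow> ('a \<Rightarrow> 'b::metric_space) \<Rightarrow> bool" where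
  "iso_on B f \<longleftrightarrow> (\<forall>x\<in>B. \<forall>y\<in>B. dist (f x) (f y) = dist x y)"

lemma iso_onD: "iso_on B f \<Longrightarrow> x \<in> B \<Longrightarrow> y \<in> B \<Longrightarrow> dist (f x) (f y) = dist x y"
  by (simp add: iso_on_def)

lemma iso_on_subset: "iso_on B f \<Longrightarrow> A \<subseteq> B \<Longrightarrow> iso_on A f"
  by (auto simp: iso_on_def)

lemma iso_on_cong: "(\<And>x. x \<in> B \<Longrightarrow> f x = g x) \<Longrightarrow> iso_on B f \<longleftrightarrow> iso_on B g"
  by (simp add: iso_on_def)

lemma iso_on_inj: "iso_on B f \<Longrightarrow> inj_on f B"
  unfolding inj_on_def iso_on_def by force

lemma iso_on_inv_into:
  assumes "iso_on B f" "A \<subseteq> f ` B"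
  shows "iso_on A (inv_into B f)"
  unfolding iso_on_def
proof (intro ballI)
  fix x y assume "x \<in> A" "y \<in> A"
  with assms(2) have "x \<in> f ` B" "y \<in> f ` B" by auto
  then show "dist (inv_into B f x) (inv_into B f y) = dist x y"
    using iso_onD[OF assms(1) inv_into_into inv_into_into] by (metis f_inv_into_f)
qed

lemma iso_on_compose: "iso_on A f \<Longrightarrow> f ` A \<subseteq> B \<Longrightarrow> iso_on B g \<Longrightarrow> iso_on A (\<lambda>x. g (f x))"
  unfolding iso_on_def by (simp add: image_subset_iff)

text \<open>For \<open>cmod u = 1\<close> these are all isometries of the plane; the flag marks the
  orientation-reversing ones.\<close>

definition mot :: "bool \<Rightarrow> complex \<Rightarrow> complex \<Rightarrow> complex \<Rightarrow> complex" where
  "mot k u c z = u * (if k then cnj z else z) + c"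

lemma dist_mot [simp]: "cmod u = 1 \<Longrightarrow> dist (mot k u c z) (mot k u c w) = dist z w"
proof -
  assume "cmod u = 1"
  have "mot k u c z - mot k u c w = u * (if k then cnj (z-w) else z-w)"
    by (simp add: mot_def algebra_simps)
  then show ?thesis
    using \<open>cmod u = 1\<close> by (simp add: dist_norm norm_mult) (metis complex_cnj_diff complex_mod_cnj)
qed

lemma iso_on_mot: "cmod u = 1 \<Longrightarrow> iso_on B (mot k u c)"
  by (simp add: iso_on_def)

lemma mot_inverse:
  assumes "cmod u = 1"
  obtains v d where "cmod v = 1" "\<And>z. mot k v d (mot k u c z) = z" "\<And>z. mot k u c (mot k v d z) = z"
proof -
  have u: "u * cnj u = 1" using assms by (metis complex_norm_square of_real_1 power_one)
  have 1: "u * (cnj u * z) = z" "cnj u * (u * z) = z" for z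
    using u by (simp_all flip: mult.assoc) (simp add: mult.commute)
  show ?thesis
  proof (cases k)
    case True
    \<comment> \<open>Solving \<open>w = u * cnj z + c\<close> for \<open>z\<close> conjugates
      \<open>cnj u\<close> back to \<open>u\<close>, so the inverse of a reversing motion has the
      same factor.\<close>
    show ?thesis
      by (rule that[of u "- u * cnj c"]) (use True assms in \<open>auto simp: mot_def distrib_left right_diff_distrib 1\<close>)
  next
    case False
    show ?thesis
      by (rule that[of "cnj u" "- cnj u * c"]) (use False assms in \<open>auto simp: mot_def distrib_left right_diff_distrib 1\<close>)
  qed
qed

lemma mot_image_ball: 
  assumes "cmod u = 1" shows "mot k u c ` ball z r = ball (mot k u c z) r"
proof -
  obtain v d where v: "cmod v = 1" "\<And>z. mot k v d (mot k u c z) = z" "\<And>z. mot k u c (mot k v d z) = z"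
    using mot_inverse[OF assms] by blast
  show ?thesis
  proof (intro equalityI subsetI)
    fix y assume "y \<in> ball (mot k u c z) r"
    then have "mot k v d y \<in> ball z r" using v(1,3) assms
      by (metis dist_mot mem_ball)
    then show "y \<in> mot k u c ` ball z r" using v(3) by (metis image_eqI)
  qed (use assms in auto)
qed

text \<open>After normalising to fix 0 and the real point \<open>t\<close>, the distances to these
  two points determine \<open>Re\<close> and the square of \<open>Im\<close>. The distance to the
  third test point \<open>p\<close> then fixes one sign of \<open>Im\<close> for all points at once.
  The test points lie at distance \<open>r/2\<close> because \<open>f\<close> is controlled only on
  a disk.\<close>

lemma plane_isometry_eq_mot:
  fixes f :: "complex \<Rightarrow> complex"
  assumes "iso_on (ball z0 r) f" "r > 0"
  obtains k u c where "cmod u = 1" "\<And>z. z \<in> ball z0 r \<Longrightarrow> f z = mot k u c z"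
proof -
  define t where "t = r/2"
  have t: "t > 0" "t < r" using assms by (auto simp: t_def)
  define u where "u = (f (z0 + of_real t) - f z0) / of_real t"
  have d: "dist (f z) (f w) = dist z w" if "cmod (z - z0) < r" "cmod (w - z0) < r" for z w
    using assms that by (auto simp: iso_on_def dist_norm norm_minus_commute)
  have "cmod (f (z0 + of_real t) - f z0) = t"
    using d[of "z0 + of_real t" z0] t by (simp add: dist_norm)
  then have u: "cmod u = 1" using t by (simp add: u_def norm_divide)
  then have u0: "u \<noteq> 0" by auto
  define h where "h z = (f (z0 + z) - f z0) / u" for z
  have hd: "cmod (h z - h w) = cmod (z - w)" if "cmod z < r" "cmod w < r" for z w
    using d[of "z0 + z" "z0 + w"] that u
    by (simp add: h_def dist_norm norm_divide flip: diff_divide_distrib)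
  have h0: "h 0 = 0" by (simp add: h_def)
  have ht: "h (of_real t) = of_real t" using t u0 by (simp add: h_def u_def)
  have re: "Re (h z) = Re z" "(Im (h z))\<^sup>2 = (Im z)\<^sup>2" if z: "cmod z < r" for z
  proof -
    have 1: "(cmod (h z))\<^sup>2 = (cmod z)\<^sup>2" using hd[of z 0] z assms h0 by simp
    have 2: "(cmod (h z - of_real t))\<^sup>2 = (cmod (z - of_real t))\<^sup>2" using hd[of z "of_real t"] z t ht by simp
    have "(Re (h z))\<^sup>2 + (Im (h z))\<^sup>2 = (Re z)\<^sup>2 + (Im z)\<^sup>2"
      using 1 by (simp add: cmod_power2)
    moreover have "(Re (h z) - t)\<^sup>2 + (Im (h z))\<^sup>2 = (Re z - t)\<^sup>2 + (Im z)\<^sup>2"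
      using 2 by (simp add: cmod_power2)
    ultimately have "2 * Re (h z) * t = 2 * Re z * t"
      unfolding power2_diff by linarith
    then show "Re (h z) = Re z" using t by simp
    then show "(Im (h z))\<^sup>2 = (Im z)\<^sup>2" using \<open>_ = (Re z)\<^sup>2 + (Im z)\<^sup>2\<close> by simp
  qed
  define p where "p = Complex 0 t"
  have p: "cmod p < r" using t by (simp add: p_def cmod_def)
  have im: "Im (h p) * Im (h z) = t * Im z" if z: "cmod z < r" for z
  proof -
    have "(cmod (h z - h p))\<^sup>2 = (cmod (z - p))\<^sup>2" using hd z p by simp
    then have "(Im (h z) - Im (h p))\<^sup>2 = (Im z - Im p)\<^sup>2"
      using re[OF z] re[OF p] by (simp add: cmod_power2)
    then show ?thesis using re[OF z] re[OF p] by (simp add: power2_eq_square algebra_simps p_def)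
  qed
  have f: "f z = u * h (z - z0) + f z0" for z using u0 by (simp add: h_def)
  have "Im (h p) = t \<or> Im (h p) = -t" using re(2)[OF p] by (simp add: p_def power2_eq_iff)
  then show ?thesis
  proof
    assume "Im (h p) = t"
    then have "h z = z" if "cmod z < r" for z using im[OF that] re[OF that] t by (simp add: complex_eq_iff)
    then have "f z = mot False u (f z0 - u * z0) z" if "z \<in> ball z0 r" for z
      using f[of z] that by (simp add: mot_def dist_norm norm_minus_commute algebra_simps)
    then show thesis using u that by blast
  next
    assume "Im (h p) = -t"
    then have "t * (Im (h z) + Im z) = 0" if "cmod z < r" for z using im[OF that] by (simp add: distrib_left)
    then have "Im (h z) + Im z = 0" if "cmod z < r" for z using t that by (metis mult_eq_0_iff less_irrefl)
    then have "h z = cnj z" if "cmod z < r" for z using that re[OF that] by (simp add: complex_eq_iff eq_neg_iff_add_eq_0)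
    then have "f z = mot True u (f z0 - u * cnj z0) z" if "z \<in> ball z0 r" for z
      using f[of z] that by (simp add: mot_def dist_norm norm_minus_commute algebra_simps)
    then show thesis using u that by blast
  qed
qed

text \<open>Three non-collinear points determine a motion: a real step from \<open>z0\<close>
  reveals \<open>u\<close>, an imaginary step then separates the two orientations.\<close>

lemma mot_eqI:
  assumes "e > 0" "\<And>z. z \<in> ball z0 e \<Longrightarrow> mot k u c z = mot k' u' c' z" "cmod u = 1"
  shows "k = k'" "u = u'" "c = c'"
proof -
  define t where "t = e/2"
  have t: "t > 0" "t < e" using assms(1) by (auto simp: t_def)
  have e: "mot k u c z0 = mot k' u' c' z0"
    "mot k u c (z0 + of_real t) = mot k' u' c' (z0 + of_real t)"
    "mot k u c (z0 + of_real t * \<i>) = mot k' u' c' (z0 + of_real t * \<i>)"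
    using assms(2)[of z0] assms(2)[of "z0 + of_real t"] assms(2)[of "z0 + of_real t * \<i>"] t
    by (auto simp: dist_norm norm_mult)
  have "mot k u c (z0 + of_real t) = mot k u c z0 + u * of_real t" for k u c
    by (simp add: mot_def algebra_simps)
  with e(1,2) have "u * of_real t = u' * of_real t"
    by (metis add_left_cancel)
  then show uu: "u = u'" using t by simp
  have "u \<noteq> 0" using assms(3) by auto
  have "mot k u c (z0 + of_real t * \<i>) = mot k u c z0 + u * (if k then - \<i> else \<i>) * of_real t" for k u c
    by (simp add: mot_def algebra_simps)
  with e(1,3) have "u * (if k then - \<i> else \<i>) * of_real t = u * (if k' then - \<i> else \<i>) * of_real t"
    unfolding uu[symmetric] by (metis add_left_cancel)
  then show kk: "k = k'" using t \<open>u \<noteq> 0\<close> by (auto split: if_splits)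
  show "c = c'" using e(1) uu kk by (simp add: mot_def)
qed

section \<open>Locally isometric immersions of plane regions\<close>

text \<open>The inverse of a flat chart, centred at \<open>p\<close>. The image must be the whole
  metric ball, so that every surface point near \<open>p\<close> has plane coordinates.\<close>

definition isochart :: "'a::metric_space set \<Rightarrow> real \<Rightarrow> 'a \<Rightarrow> (complex \<Rightarrow> 'a) \<Rightarrow> bool" where
  "isochart U r p \<psi> \<longleftrightarrow> iso_on (ball 0 r) \<psi> \<and> \<psi> 0 = p \<and> \<psi> ` ball 0 r = ball p r \<and> ball p r \<subseteq> U"

text \<open>Distances are preserved only on small disks, with radius depending on the point: a long
  strip may wrap around the surface and overlap itself.\<close>

definition imm :: "'a::metric_space set \<Rightarrow> complex set \<Rightarrow> (complex \<Rightarrow> 'a) \<Rightarrow> bool" where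
  "imm U W F \<longleftrightarrow> open W \<and> (\<forall>z\<in>W. F z \<in> U \<and> (\<exists>e>0. iso_on (ball z e) F))"

lemma isochartI_iso:
  assumes "iso_on (ball w r) \<psi>" "\<psi> ` ball w r = ball (\<psi> w) r" "ball (\<psi> w) r \<subseteq> U"
  shows "isochart U r (\<psi> w) (\<lambda>z. \<psi> (w + z))"
proof -
  have im: "(+) w ` ball 0 r = ball w r" by (simp add: ball_translation)
  have "(\<lambda>z. \<psi> (w + z)) ` ball 0 r = \<psi> ` ((+) w ` ball 0 r)" unfolding image_image ..
  moreover have "iso_on (ball 0 r) (\<lambda>z. \<psi> (w + z))"
    by (rule iso_on_compose[where B = "ball w r"]) (use assms in \<open>auto simp: iso_on_def dist_norm\<close>)
  ultimately show ?thesis using assms unfolding isochart_def im by simp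
qed

lemma isochart_shift:
  assumes "isochart U r p \<psi>" "w \<in> ball 0 r" "cmod w + s \<le> r"
  shows "isochart U s (\<psi> w) (\<lambda>z. \<psi> (w + z))"
proof (rule isochartI_iso)
  have sub: "ball w s \<subseteq> ball 0 r"
    using assms(3) by (auto simp: dist_norm) (metis add.commute add_le_cancel_left diff_le_eq le_less_trans
        less_le_trans norm_minus_commute norm_triangle_sub not_le)
  have iso: "iso_on (ball 0 r) \<psi>" and im: "\<psi> ` ball 0 r = ball p r" and p: "\<psi> 0 = p" and U: "ball p r \<subseteq> U"
    using assms(1) by (auto simp: isochart_def)
  show "iso_on (ball w s) \<psi>" using iso sub by (rule iso_on_subset)
  have sub2: "ball (\<psi> w) s \<subseteq> ball p r"
  proof
    fix y assume y: "y \<in> ball (\<psi> w) s"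
    then have "r > 0" using assms by (metis mem_ball_0 norm_ge_zero le_less_trans)
    then have "dist p (\<psi> w) = cmod w" using iso_onD[OF iso, of 0 w] p assms(2) by simp
    then show "y \<in> ball p r" using y assms(3) dist_triangle[of p y "\<psi> w"] by simp
  qed
  then show "ball (\<psi> w) s \<subseteq> U" using U by auto
  show "\<psi> ` ball w s = ball (\<psi> w) s"
  proof (intro equalityI subsetI)
    fix y assume "y \<in> \<psi> ` ball w s"
    then show "y \<in> ball (\<psi> w) s"
      using iso_onD[OF iso assms(2)] sub by auto
  next
    fix y assume y: "y \<in> ball (\<psi> w) s"
    then obtain z where z: "z \<in> ball 0 r" "y = \<psi> z" using sub2 im by blast
    then show "y \<in> \<psi> ` ball w s" using y iso_onD[OF iso assms(2) z(1)] by auto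
  qed
qed

lemma isochart_mono: "isochart U r p \<psi> \<Longrightarrow> 0 < s \<Longrightarrow> s \<le> r \<Longrightarrow> isochart U s p \<psi>"
  using isochart_shift[of U r p \<psi> 0 s] by (auto simp: isochart_def)

lemma flat_point_isochart:
  fixes x :: "'a::metric_space"
  assumes "flat_point x" "open U" "x \<in> U"
  obtains r \<psi> where "r > 0" "isochart U r x \<psi>"
proof -
  obtain V f and c::complex and \<rho> where V: "open V" "x \<in> V" "\<rho> > 0" "f ` V = ball c \<rho>"
    "\<forall>y\<in>V. \<forall>z\<in>V. dist (f y) (f z) = dist y z"
    using assms(1) unfolding flat_point_def by blast
  have iso: "iso_on V f" using V by (simp add: iso_on_def)
  have "open (U \<inter> V)" "x \<in> U \<inter> V" using assms V by auto
  then obtain e where e: "e > 0" "ball x e \<subseteq> U \<inter> V" by (meson open_contains_ball)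
  have "f x \<in> ball c \<rho>" using V by auto
  then obtain e' where e': "e' > 0" "ball (f x) e' \<subseteq> ball c \<rho>" by (meson open_ball open_contains_ball)
  \<comment> \<open>The surface ball must fit into the chart domain to be hit entirely, and the
    plane ball into its image for the inverse to be defined there.\<close>
  define r where "r = min e e'"
  have r: "r > 0" "ball x r \<subseteq> U" "ball x r \<subseteq> V" "ball (f x) r \<subseteq> f ` V" using e e' V by (auto simp: r_def)
  have inj: "inv_into V f (f y) = y" if "y \<in> V" for y
    using iso_on_inj[OF iso] that by (rule inv_into_f_f)
  have "isochart U r (inv_into V f (f x)) (\<lambda>z. inv_into V f (f x + z))"
  proof (rule isochartI_iso)
    show i2: "iso_on (ball (f x) r) (inv_into V f)" using iso_on_inv_into[OF iso] r by blast
    show "ball (inv_into V f (f x)) r \<subseteq> U" using inj V r by auto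
    show "inv_into V f ` ball (f x) r = ball (inv_into V f (f x)) r"
    proof (intro equalityI subsetI)
      fix y assume "y \<in> inv_into V f ` ball (f x) r"
      then show "y \<in> ball (inv_into V f (f x)) r" using iso_onD[OF i2, of "f x"] r(1) by auto
    next
      fix y assume "y \<in> ball (inv_into V f (f x)) r"
      then have y: "y \<in> ball x r" "y \<in> V" using inj V r by auto
      then have "f y \<in> ball (f x) r" using iso_onD[OF iso V(2)] by simp
      then show "y \<in> inv_into V f ` ball (f x) r" using inj[OF y(2)] by (metis image_eqI)
    qed
  qed
  then show thesis using inj V r that by auto
qed

text \<open>A Lebesgue number argument: balls of half the chart radius cover \<open>K\<close>, and
  the other half is the room needed to recentre the chart at any point of the smaller ball.\<close>

lemma uniform_isochart:
  fixes U :: "'a::metric_space set"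
  assumes "open U" "\<forall>x\<in>U. flat_point x" "compact K" "K \<subseteq> U"
  obtains r where "r > 0" "\<And>p. p \<in> K \<Longrightarrow> \<exists>\<psi>. isochart U r p \<psi>"
proof -
  have "\<exists>r>0. \<exists>\<psi>. isochart U r x \<psi>" if "x \<in> K" for x
    using flat_point_isochart[of x U] assms that by (metis subsetD)
  then obtain R where R: "\<And>x. x \<in> K \<Longrightarrow> R x > 0" "\<And>x. x \<in> K \<Longrightarrow> \<exists>\<psi>. isochart U (R x) x \<psi>" by metis
  have "K \<subseteq> (\<Union>x\<in>K. ball x (R x / 2))" using R(1) by force
  then obtain C where C: "C \<subseteq> K" "finite C" "K \<subseteq> (\<Union>x\<in>C. ball x (R x / 2))"
    using compactE_image[OF assms(3), of K "\<lambda>x. ball x (R x / 2)"] by auto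
  \<comment> \<open>The inserted 1 gives a value when \<open>K\<close>, and with it
    \<open>C\<close>, is empty.\<close>
  define r where "r = Min (insert 1 ((\<lambda>x. R x / 2) ` C))"
  have rpos: "r > 0" unfolding r_def using C R by (subst Min_gr_iff) auto
  have "\<exists>\<psi>. isochart U r p \<psi>" if pK: "p \<in> K" for p
  proof -
    obtain x where x: "x \<in> C" "p \<in> ball x (R x / 2)" using subsetD[OF C(3) pK] by blast
    have "r \<le> R x / 2" unfolding r_def using C x by (intro Min_le) auto
    obtain \<psi> where \<psi>: "isochart U (R x) x \<psi>" using R x C by blast
    have "p \<in> ball x (R x)" using x R(1)[of x] C by auto
    then obtain w where w: "w \<in> ball 0 (R x)" "p = \<psi> w" using \<psi> unfolding isochart_def by blast
    have "dist (\<psi> 0) (\<psi> w) = dist 0 w"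
      using \<psi> w R(1)[of x] x C unfolding isochart_def by (intro iso_onD) auto
    then have "cmod w < R x / 2" using x w \<psi> unfolding isochart_def by simp
    then have "cmod w + r \<le> R x" using \<open>r \<le> R x / 2\<close> by simp
    then show ?thesis using isochart_shift[OF \<psi> w(1)] w by blast
  qed
  then show thesis using rpos that by blast
qed

text \<open>The source of all rigidity below: a small disk lands inside one chart, and pulled back
  through it the map becomes an isometry between plane regions, hence a motion.\<close>

lemma iso_on_chart_eq_mot:
  fixes z :: complex
  assumes ch: "isochart U r p \<psi>" and F: "iso_on (ball z e) F" "e > 0" and s: "dist p (F z) + e \<le> r"
  obtains k u c where "cmod u = 1"
    "\<And>w. w \<in> ball z e \<Longrightarrow> F w = \<psi> (mot k u c w) \<and> mot k u c w \<in> ball 0 r"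
proof -
  have im: "\<psi> ` ball 0 r = ball p r" and iso: "iso_on (ball 0 r) \<psi>" using ch by (auto simp: isochart_def)
  have sub: "F ` ball z e \<subseteq> ball p r"
  proof clarify
    fix w assume "w \<in> ball z e"
    then have "dist (F z) (F w) < e" using iso_onD[OF F(1), of z w] F(2) by simp
    then show "F w \<in> ball p r" using s dist_triangle[of p "F w" "F z"] by simp
  qed
  define h where "h w = inv_into (ball 0 r) \<psi> (F w)" for w
  have "iso_on (ball z e) h"
    unfolding h_def by (rule iso_on_compose[OF F(1) sub iso_on_inv_into[OF iso]]) (use im in auto)
  then obtain k u c where m: "cmod u = 1" "\<And>w. w \<in> ball z e \<Longrightarrow> h w = mot k u c w"
    using F(2) by (rule plane_isometry_eq_mot) blast
  have "F w = \<psi> (mot k u c w) \<and> mot k u c w \<in> ball 0 r" if "w \<in> ball z e" for w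
  proof -
    have "F w \<in> \<psi> ` ball 0 r" using sub that im by blast
    then show ?thesis using m(2)[OF that] unfolding h_def by (metis f_inv_into_f inv_into_into)
  qed
  then show thesis using m that by blast
qed

text \<open>One step of continuation. On a small disk \<open>F\<close> is the chart after a motion,
  and that formula makes sense on the full disk of radius \<open>r\<close>, since the motion sends
  \<open>z\<close> to the centre of the chart.\<close>

lemma chart_extend:
  fixes z :: complex
  assumes ch: "isochart U r (F z) \<psi>" and F: "iso_on (ball z e) F" "e > 0" and r: "r > 0"
  obtains F' where "iso_on (ball z r) F'" "F' ` ball z r = ball (F z) r"
    "\<And>w. w \<in> ball z e \<Longrightarrow> w \<in> ball z r \<Longrightarrow> F' w = F w"
proof -
  define e' where "e' = min e r"
  have e': "e' > 0" "e' \<le> e" "e' \<le> r" using F r by (auto simp: e'_def)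
  obtain k u c where m: "cmod u = 1"
    "\<And>w. w \<in> ball z e' \<Longrightarrow> F w = \<psi> (mot k u c w) \<and> mot k u c w \<in> ball 0 r"
  proof (rule iso_on_chart_eq_mot[OF ch _ e'(1)])
    show "iso_on (ball z e') F" by (rule iso_on_subset[OF F(1)]) (use e' in auto)
  qed (use e' in auto)
  have "\<psi> (mot k u c z) = \<psi> 0" using m(2)[of z] e' ch by (simp add: isochart_def)
  then have z: "mot k u c z = 0"
    using ch m(2)[of z] e' r iso_onD[of "ball 0 r" \<psi> 0 "mot k u c z"] unfolding isochart_def by simp
  have im: "mot k u c ` ball z r = ball 0 r" using mot_image_ball[OF m(1), of k c z r] z by simp
  show thesis
  proof (rule that[of "\<lambda>w. \<psi> (mot k u c w)"])
    show "iso_on (ball z r) (\<lambda>w. \<psi> (mot k u c w))"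
      using iso_on_compose[OF iso_on_mot[OF m(1)]] im ch by (metis isochart_def order_refl)
    show "(\<lambda>w. \<psi> (mot k u c w)) ` ball z r = ball (F z) r"
      using im ch by (metis image_image isochart_def)
  qed (use m in \<open>auto simp: e'_def\<close>)
qed

lemma immD: 
  assumes "imm U W F" "z \<in> W"
  shows "F z \<in> U" "\<exists>e>0. ball z e \<subseteq> W \<and> iso_on (ball z e) F"
proof -
  show "F z \<in> U" using assms by (simp add: imm_def)
  obtain e1 where e1: "e1 > 0" "ball z e1 \<subseteq> W" using assms by (metis imm_def open_contains_ball)
  obtain e2 where e2: "e2 > 0" "iso_on (ball z e2) F" using assms by (metis imm_def)
  have "iso_on (ball z (min e1 e2)) F" by (rule iso_on_subset[OF e2(2)]) auto
  moreover have "ball z (min e1 e2) \<subseteq> W" using e1 by auto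
  ultimately show "\<exists>e>0. ball z e \<subseteq> W \<and> iso_on (ball z e) F" using e1 e2 by (metis min_less_iff_conj)
qed

lemma imm_cong:
  assumes "imm U W F" "\<And>z. z \<in> W \<Longrightarrow> F z = G z"
  shows "imm U W G"
  unfolding imm_def
proof (intro conjI ballI)
  show "open W" using assms by (simp add: imm_def)
  fix z assume z: "z \<in> W"
  then show "G z \<in> U" using immD assms by metis
  obtain e where "e>0" "ball z e \<subseteq> W" "iso_on (ball z e) F" using immD(2)[OF assms(1) z] by blast
  then show "\<exists>e>0. iso_on (ball z e) G" using iso_on_cong[of "ball z e" F G] assms(2) by blast
qed

lemma imm_subset: "imm U W F \<Longrightarrow> open V \<Longrightarrow> V \<subseteq> W \<Longrightarrow> imm U V F"
  by (auto simp: imm_def)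

lemma imm_UN:
  assumes F: "\<And>i. i \<in> I \<Longrightarrow> imm U (W i) (F i)"
    and agree: "\<And>i j z. i \<in> I \<Longrightarrow> j \<in> I \<Longrightarrow> z \<in> W i \<Longrightarrow> z \<in> W j \<Longrightarrow> F i z = F j z"
  obtains G where "imm U (\<Union>i\<in>I. W i) G" "\<And>i z. i \<in> I \<Longrightarrow> z \<in> W i \<Longrightarrow> G z = F i z"
proof -
  define G where "G z = F (SOME i. i \<in> I \<and> z \<in> W i) z" for z
  have G: "G z = F i z" if "i \<in> I" "z \<in> W i" for i z
    using someI[of "\<lambda>i. i \<in> I \<and> z \<in> W i" i] that agree unfolding G_def by blast
  have "imm U (W i) G" if "i \<in> I" for i
    by (rule imm_cong[OF F[OF that]]) (metis G that)
  then have "imm U (\<Union>i\<in>I. W i) G" unfolding imm_def by blast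
  then show thesis using G that by blast
qed

lemma imm_Un:
  assumes "imm U V F" "imm U W G" "\<And>z. z \<in> V \<Longrightarrow> z \<in> W \<Longrightarrow> F z = G z"
  obtains H where "imm U (V \<union> W) H" "\<And>z. z \<in> V \<Longrightarrow> H z = F z" "\<And>z. z \<in> W \<Longrightarrow> H z = G z"
proof (rule imm_UN[of UNIV U "\<lambda>b. if b then V else W" "\<lambda>b. if b then F else G"])
  fix H assume *: "imm U (\<Union>b. if b then V else W) H"
    "\<And>i z. i \<in> UNIV \<Longrightarrow> z \<in> (if i then V else W) \<Longrightarrow> H z = (if i then F else G) z"
  have "(\<Union>b. if b then V else W) = V \<union> W" by (auto split: if_splits)
  then show thesis using *(1) *(2)[of True] *(2)[of False] that by simp
qed (use assms in \<open>auto split: if_splits\<close>)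

lemma continuous_on_mot: "cmod u = 1 \<Longrightarrow> continuous_on A (mot k u c)"
  unfolding mot_def by (cases k) (auto intro!: continuous_intros)

lemma imm_compose_mot:
  assumes "imm U W F" "cmod u = 1"
  shows "imm U (mot k u c -` W) (\<lambda>z. F (mot k u c z))"
  unfolding imm_def
proof (intro conjI ballI)
  show "open (mot k u c -` W)"
    using assms continuous_on_mot[of u UNIV] by (simp add: imm_def open_vimage)
  fix z assume "z \<in> mot k u c -` W"
  then have z: "mot k u c z \<in> W" by simp
  then show "F (mot k u c z) \<in> U" using immD assms by blast
  obtain e where e: "e > 0" "iso_on (ball (mot k u c z) e) F" using assms z by (meson imm_def)
  have "iso_on (ball z e) (\<lambda>z. F (mot k u c z))"
    by (rule iso_on_compose[OF iso_on_mot[OF assms(2)] _ e(2)]) (simp add: mot_image_ball assms)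
  then show "\<exists>e>0. iso_on (ball z e) (\<lambda>z. F (mot k u c z))" using e by blast
qed

lemma imm_translate: "imm U W F \<Longrightarrow> imm U {z. c + z \<in> W} (\<lambda>z. F (c + z))"
  using imm_compose_mot[of U W F 1 False c] by (simp add: mot_def vimage_def add.commute)

lemma imm_continuous_on:
  assumes "imm U W F" shows "continuous_on W F"
proof (rule continuous_at_imp_continuous_on, intro ballI)
  fix z assume "z \<in> W"
  then obtain e where e: "e > 0" "iso_on (ball z e) F" using assms by (meson imm_def)
  show "isCont F z"
    unfolding continuous_at_eps_delta
  proof (intro allI impI)
    fix \<epsilon>::real assume "\<epsilon> > 0"
    then show "\<exists>d>0. \<forall>x'. dist x' z < d \<longrightarrow> dist (F x') (F z) < \<epsilon>"
      using e by (intro exI[of _ "min e \<epsilon>"]) (auto simp: iso_on_def dist_commute)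
  qed
qed

lemma imm_isochart_ball:
  "iso_on (ball z r) F \<Longrightarrow> F ` ball z r \<subseteq> U \<Longrightarrow> imm U (ball z r) F"
  unfolding imm_def
  by (auto simp: image_subset_iff) (metis centre_in_ball iso_on_subset mem_ball open_ball open_contains_ball)

locale flat_region =
  fixes U :: "'a::metric_space set"
  assumes open_U: "open U" and flat_U: "x \<in> U \<Longrightarrow> flat_point x"
begin

lemma chart_at: 
  assumes "p \<in> U" obtains r \<psi> where "r > 0" "isochart U r p \<psi>"
  using flat_point_isochart[OF flat_U[OF assms] open_U assms] by blast

text \<open>Local isometries into a flat surface are open: near \<open>z\<close> the map coincides
  with the extension of its germ by a chart, whose image is a full ball.\<close>

lemma imm_nice_ball:
  assumes "imm U W F" "z \<in> W"
  obtains s where "s > 0" "ball z s \<subseteq> W" "iso_on (ball z s) F" "F ` ball z s = ball (F z) s"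
proof -
  obtain r \<psi> where r: "r > 0" "isochart U r (F z) \<psi>" using chart_at immD(1)[OF assms] by blast
  obtain e where e: "e > 0" "ball z e \<subseteq> W" "iso_on (ball z e) F" using immD(2)[OF assms] by blast
  define s where "s = min r e"
  have s: "s > 0" "s \<le> r" "ball z s \<subseteq> ball z e" using r e by (auto simp: s_def)
  obtain F' where F': "iso_on (ball z s) F'" "F' ` ball z s = ball (F z) s"
      "\<And>w. w \<in> ball z e \<Longrightarrow> w \<in> ball z s \<Longrightarrow> F' w = F w"
    using chart_extend[OF isochart_mono[OF r(2) s(1,2)] e(3,1) s(1)] by blast
  have "F' w = F w" if "w \<in> ball z s" for w using F'(3) that s(3) by blast
  then have "iso_on (ball z s) F" "F ` ball z s = ball (F z) s"
    using F' iso_on_cong[of "ball z s" F' F] by (auto simp: image_iff)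
  then show thesis using that s e by blast
qed

text \<open>Having equal germs is a locally constant property. Where the values differ, continuity
  keeps them apart nearby. Where they agree, both maps are motions followed by the same chart on a
  common disk, and two motions that agree on a smaller disk are equal.\<close>

lemma imm_unique:
  assumes F: "imm U W F" and G: "imm U W G" and W: "connected W"
    and z0: "z0 \<in> W" "e > 0" "\<And>z. z \<in> ball z0 e \<Longrightarrow> F z = G z" and z: "z \<in> W"
  shows "F z = G z"
proof -
  define P where "P x \<longleftrightarrow> (\<exists>e>0. \<forall>w\<in>ball x e. F w = G w)" for x
  have "P z"
  proof (rule connected_induction_simple[OF W z0(1) z, of P])
    show "P z0" using z0 by (auto simp: P_def)
    fix a assume a: "a \<in> W"
    have oW: "open W" using F by (simp add: imm_def)
    show "\<exists>T. openin (top_of_set W) T \<and> a \<in> T \<and> (\<forall>x\<in>T. \<forall>y\<in>T. P x \<longrightarrow> P y)"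
    proof (cases "F a = G a")
      case False
      have "continuous_on W (\<lambda>z. dist (F z) (G z))"
        using imm_continuous_on[OF F] imm_continuous_on[OF G] by (intro continuous_intros)
      then have "open (W \<inter> (\<lambda>z. dist (F z) (G z)) -` {0<..})"
        using oW by (intro continuous_open_preimage) auto
      moreover have "W \<inter> (\<lambda>z. dist (F z) (G z)) -` {0<..} = {z\<in>W. F z \<noteq> G z}" by auto
      ultimately have "openin (top_of_set W) {z\<in>W. F z \<noteq> G z}" using oW by (simp add: openin_open_eq)
      moreover have "\<not> P x" if "F x \<noteq> G x" for x using that by (auto simp: P_def)
      ultimately show ?thesis using False a by (intro exI[of _ "{z\<in>W. F z \<noteq> G z}"]) auto
    next
      case True
      obtain r \<psi> where r: "r > 0" "isochart U r (F a) \<psi>" using chart_at immD(1)[OF F a] by blast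
      obtain e1 where e1: "e1 > 0" "ball a e1 \<subseteq> W" "iso_on (ball a e1) F" using immD(2)[OF F a] by blast
      obtain e2 where e2: "e2 > 0" "ball a e2 \<subseteq> W" "iso_on (ball a e2) G" using immD(2)[OF G a] by blast
      define s where "s = min r (min e1 e2)"
      have s: "s > 0" "s \<le> r" "s \<le> e1" "s \<le> e2" using r e1 e2 by (auto simp: s_def)
      have Fs: "iso_on (ball a s) F" by (rule iso_on_subset[OF e1(3)]) (use s in auto)
      have Gs: "iso_on (ball a s) G" by (rule iso_on_subset[OF e2(3)]) (use s in auto)
      obtain k u c where 1: "cmod u = 1" "\<And>w. w \<in> ball a s \<Longrightarrow> F w = \<psi> (mot k u c w) \<and> mot k u c w \<in> ball 0 r"
        by (rule iso_on_chart_eq_mot[OF r(2) Fs s(1)]) (use s in auto)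
      obtain k' u' c' where 2: "cmod u' = 1" "\<And>w. w \<in> ball a s \<Longrightarrow> G w = \<psi> (mot k' u' c' w) \<and> mot k' u' c' w \<in> ball 0 r"
        by (rule iso_on_chart_eq_mot[OF r(2) Gs s(1)]) (use s True in auto)
      have inj: "inj_on \<psi> (ball 0 r)" using r(2) iso_on_inj by (auto simp: isochart_def)
      have "P y" if x: "x \<in> ball a s" "P x" and y: "y \<in> ball a s" for x y
      proof -
        obtain d where d: "d > 0" "\<forall>w\<in>ball x d. F w = G w" using x by (auto simp: P_def)
        obtain d' where d': "d' > 0" "ball x d' \<subseteq> ball a s" using x open_ball open_contains_ball by meson
        have "mot k u c w = mot k' u' c' w" if "w \<in> ball x (min d d')" for w
        proof -
          have "w \<in> ball a s" "F w = G w" using that d d' by auto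
          then show ?thesis using 1(2) 2(2) inj by (metis inj_onD)
        qed
        from mot_eqI[of "min d d'" x, OF _ this 1(1)] d(1) d'(1) have "k = k'" "u = u'" "c = c'" by auto
        then have "\<forall>w\<in>ball a s. F w = G w" using 1(2) 2(2) by simp
        moreover obtain d'' where "d'' > 0" "ball y d'' \<subseteq> ball a s" using y open_ball open_contains_ball by meson
        ultimately show ?thesis unfolding P_def by blast
      qed
      moreover have "ball a s \<subseteq> W" using e1(2) s(3) by (meson subset_ball subset_trans)
      then have "openin (top_of_set W) (ball a s)" using oW by (simp add: openin_open_eq)
      moreover have "a \<in> ball a s" using s by simp
      ultimately show ?thesis by blast
    qed
  qed
  then show ?thesis unfolding P_def by (metis centre_in_ball)
qed

text \<open>Minimising \<^term>\<open>dist (F w) q\<close> over the points \<^term>\<open>w\<close> with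
  \<^prop>\<open>dist z w + dist (F w) q \<le> dist (F z) q\<close> replaces lifting a minimal geodesic
  from \<^term>\<open>F z\<close> to \<^term>\<open>q\<close>.\<close>

lemma imm_ball_covers:
  fixes F :: "complex \<Rightarrow> 'a"
  assumes F: "imm U (ball z R) F" and mid: "\<And>x y::'a. \<exists>m. dist x m = dist x y / 2 \<and> dist m y = dist x y / 2"
    and q: "dist (F z) q < R"
  shows "q \<in> F ` ball z R"
proof -
  define d where "d = dist (F z) q"
  define A where "A = {w \<in> cball z d. dist z w + dist (F w) q \<le> d}"
  have dR: "0 \<le> d" "d < R" using q by (auto simp: d_def)
  have sub: "cball z d \<subseteq> ball z R" using dR by auto
  have cont: "continuous_on (cball z d) F" using imm_continuous_on[OF F] sub continuous_on_subset by blast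
  have "continuous_on (cball z d) (\<lambda>w. dist z w + dist (F w) q)"
    using cont by (intro continuous_intros)
  then have "closed (cball z d \<inter> (\<lambda>w. dist z w + dist (F w) q) -` {..d})"
    by (intro continuous_closed_preimage) auto
  moreover have "cball z d \<inter> (\<lambda>w. dist z w + dist (F w) q) -` {..d} = A" by (auto simp: A_def)
  ultimately have "closed A" by simp
  moreover have "A \<subseteq> cball z d" by (auto simp: A_def)
  ultimately have "compact A" by (meson bounded_cball bounded_subset compact_eq_bounded_closed)
  moreover have "z \<in> A" using dR by (auto simp: A_def d_def)
  moreover have "continuous_on A (\<lambda>w. dist (F w) q)"
    using cont \<open>A \<subseteq> cball z d\<close> continuous_on_subset by (intro continuous_intros) blast
  ultimately obtain w where w: "w \<in> A" "\<And>v. v \<in> A \<Longrightarrow> dist (F w) q \<le> dist (F v) q"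
    using continuous_attains_inf[of A "\<lambda>w. dist (F w) q"] by blast
  have wb: "w \<in> ball z R" using w sub by (auto simp: A_def)
  have "F w = q"
  proof (rule ccontr)
    assume ne: "F w \<noteq> q"
    obtain s where s: "s > 0" "ball w s \<subseteq> ball z R" "iso_on (ball w s) F" "F ` ball w s = ball (F w) s"
      using imm_nice_ball[OF F wb] by blast
    \<comment> \<open>Taking midpoints repeatedly on the side of \<open>F w\<close> gives points on
      a shortest connection to \<open>q\<close> that come arbitrarily close to \<open>F w\<close>,
      hence into the ball over which \<open>F\<close> can be inverted.\<close>
    have "\<exists>m. dist (F w) m = dist (F w) q / 2^n \<and> dist (F w) m + dist m q = dist (F w) q" for n
    proof (induction n)
      case 0 then show ?case by (intro exI[of _ q]) auto
    next
      case (Suc n)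
      then obtain m where m: "dist (F w) m = dist (F w) q / 2^n" "dist (F w) m + dist m q = dist (F w) q" by blast
      obtain m' where m': "dist (F w) m' = dist (F w) m / 2" "dist m' m = dist (F w) m / 2" using mid by blast
      have "dist (F w) m' + dist m' q = dist (F w) q"
        using dist_triangle[of m' q m] dist_triangle[of "F w" q m'] m m' by linarith
      then show ?case using m m' by (intro exI[of _ m']) auto
    qed
    moreover have "\<exists>n. dist (F w) q / 2^n < s"
    proof -
      have "(\<lambda>n. dist (F w) q * (1/2)^n) \<longlonglongrightarrow> dist (F w) q * 0"
        by (intro tendsto_intros LIMSEQ_power_zero) auto
      then have "eventually (\<lambda>n. dist (F w) q * (1/2)^n < s) sequentially"
        using s(1) by (intro order_tendstoD) auto
      then show ?thesis by (auto simp: eventually_sequentially power_divide)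
    qed
    ultimately obtain m n where m: "dist (F w) m = dist (F w) q / 2^n" "dist (F w) m + dist m q = dist (F w) q"
      "dist (F w) m < s" by metis
    then obtain v where v: "v \<in> ball w s" "m = F v" using s(4) by (metis image_iff mem_ball)
    have wv: "dist w v = dist (F w) m" using iso_onD[OF s(3) _ v(1), of w] s(1) v(2) by simp
    have pos: "dist (F w) m > 0" using m(1) ne by simp
    have le: "dist z v + dist (F v) q \<le> d"
      using dist_triangle[of z v w] w(1) wv m(2) v(2) unfolding A_def by simp
    have "dist z v \<le> d" using le zero_le_dist[of "F v" q] by linarith
    with le have "v \<in> A" by (simp add: A_def)
    then have "dist (F w) q \<le> dist (F v) q" using w(2) by blast
    then show False using m(2) pos unfolding v(2) by linarith
  qed
  then show ?thesis using wb by blast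
qed


section \<open>Uniqueness of local isometries defined on intervals\<close>

lemma collinear_circle_point:
  fixes w v :: complex and a b :: real
  assumes "a \<noteq> 0" "cmod v = \<bar>a\<bar>" "cmod w = \<bar>b\<bar>" "cmod (w - v) = \<bar>b - a\<bar>"
  shows "w = of_real (b / a) * v"
proof -
  have v: "(Re v)\<^sup>2 + (Im v)\<^sup>2 = a\<^sup>2" and w: "(Re w)\<^sup>2 + (Im w)\<^sup>2 = b\<^sup>2"
    and wv: "(Re w - Re v)\<^sup>2 + (Im w - Im v)\<^sup>2 = (b - a)\<^sup>2"
    using assms(2-4) by (metis cmod_power2 power2_abs, metis cmod_power2 power2_abs,
        metis cmod_power2 power2_abs minus_complex.sel)
  \<comment> \<open>Polarisation: the three distances are those of the points 0, \<open>a\<close>,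
    \<open>b\<close> on a line, so the inner product has the value that makes
    \<open>a * w - b * v\<close> vanish.\<close>
  have ip: "Re w * Re v + Im w * Im v = a * b"
    using v w wv unfolding power2_eq_square left_diff_distrib right_diff_distrib
      mult.commute[of "Re v" "Re w"] mult.commute[of "Im v" "Im w"] mult.commute[of b a] by linarith
  have "(a * Re w - b * Re v)\<^sup>2 + (a * Im w - b * Im v)\<^sup>2
      = a\<^sup>2 * ((Re w)\<^sup>2 + (Im w)\<^sup>2) + b\<^sup>2 * ((Re v)\<^sup>2 + (Im v)\<^sup>2) - 2 * a * b * (Re w * Re v + Im w * Im v)"
    by (simp add: power2_eq_square algebra_simps)
  also have "\<dots> = 0" unfolding v w ip by (simp add: power2_eq_square)
  finally have "a * Re w = b * Re v" "a * Im w = b * Im v" by (simp_all add: sum_power2_eq_zero_iff)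
  then show ?thesis using assms(1) by (simp add: complex_eq_iff field_simps)
qed

text \<open>In a chart both curves are straight lines run through at unit speed, and such a line is
  fixed by its values at two parameters. No point of \<open>D\<close> on both sides of
  \<open>x0\<close> is required, so \<open>x0\<close> may be an end point.\<close>

lemma local_isometry_local_unique:
  assumes gh: "\<And>x y. x \<in> D \<Longrightarrow> y \<in> D \<Longrightarrow> \<bar>x - x0\<bar> < e \<Longrightarrow> \<bar>y - x0\<bar> < e \<Longrightarrow>
      dist (g x) (g y) = \<bar>x - y\<bar> \<and> dist (h x) (h y) = \<bar>x - y\<bar>"
    and ch: "isochart U r (g x0) \<psi>" "r > 0" and e: "e > 0" "e \<le> r" and x0: "x0 \<in> D" "g x0 = h x0"
    and x1: "x1 \<in> D" "\<bar>x1 - x0\<bar> < e" "x1 \<noteq> x0" "g x1 = h x1" and y: "y \<in> D" "\<bar>y - x0\<bar> < e"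
  shows "g y = h y"
proof -
  have im: "\<psi> ` ball 0 r = ball (g x0) r" and iso: "iso_on (ball 0 r) \<psi>" and \<psi>0: "\<psi> 0 = g x0"
    using ch by (auto simp: isochart_def)
  have d: "dist (g x0) (g x) = \<bar>x - x0\<bar>" "dist (h x0) (h x) = \<bar>x - x0\<bar>" if "x \<in> D" "\<bar>x - x0\<bar> < e" for x
    using gh[of x0 x] that x0 e by auto
  have "g x1 \<in> \<psi> ` ball 0 r" "g y \<in> \<psi> ` ball 0 r" "h y \<in> \<psi> ` ball 0 r"
    using d[OF x1(1,2)] d[OF y] x1(2) y(2) x0(2) e(2) unfolding im by simp_all
  then obtain v w w' where v: "v \<in> ball 0 r" "g x1 = \<psi> v" and w: "w \<in> ball 0 r" "g y = \<psi> w"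
    and w': "w' \<in> ball 0 r" "h y = \<psi> w'" by (elim imageE) blast
  have n: "cmod z = dist (g x0) (\<psi> z)" if "z \<in> ball 0 r" for z
    using iso_onD[OF iso _ that, of 0] ch(2) \<psi>0 by simp
  have "w = of_real ((y - x0) / (x1 - x0)) * v" 
  proof (rule collinear_circle_point)
    show "cmod (w - v) = \<bar>y - x0 - (x1 - x0)\<bar>"
      using iso_onD[OF iso w(1) v(1)] gh[of y x1] x1 y w v by (simp add: dist_norm)
  qed (use n[OF v(1)] n[OF w(1)] v(2) w(2) d(1)[OF x1(1,2)] d(1)[OF y] x1(3) in simp_all)
  moreover have "w' = of_real ((y - x0) / (x1 - x0)) * v" 
  proof (rule collinear_circle_point)
    show "cmod (w' - v) = \<bar>y - x0 - (x1 - x0)\<bar>"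
      using iso_onD[OF iso w'(1) v(1)] gh[of y x1] x1 y w' v by (simp add: dist_norm)
  qed (use n[OF v(1)] n[OF w'(1)] v(2) w'(2) d(1)[OF x1(1,2)] d(2)[OF y] x0(2) x1(3) in simp_all)
  ultimately show ?thesis using w w' by simp
qed

text \<open>The condition on right neighbours supplies a second parameter of agreement when only the
  point itself is known; it holds for the line, for \<open>{0..}\<close> and for
  \<open>{0..<L}\<close>.\<close>

lemma local_isometry_unique:
  assumes g: "local_isometry_on D g" and h: "local_isometry_on D h" and U: "\<And>t. t \<in> D \<Longrightarrow> g t \<in> U"
    and D: "convex D" "\<And>x \<delta>. x \<in> D \<Longrightarrow> \<delta> > 0 \<Longrightarrow> \<exists>y\<in>D. x < y \<and> y < x + \<delta>"
    and x0: "x0 \<in> D" "d > 0" "\<And>x. x \<in> D \<Longrightarrow> \<bar>x - x0\<bar> < d \<Longrightarrow> g x = h x" and x: "x \<in> D"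
  shows "g x = h x"
proof -
  define P where "P x \<longleftrightarrow> (\<exists>e>0. \<forall>y\<in>D. \<bar>y - x\<bar> < e \<longrightarrow> g y = h y)" for x
  have Peq: "g x = h x" if "P x" "x \<in> D" for x using that by (auto simp: P_def)
  have "P x"
  proof (rule connected_induction_simple[of D x0 x P])
    show "connected D" using D(1) by (rule convex_connected)
    show "P x0" using x0 by (auto simp: P_def)
    fix a assume a: "a \<in> D"
    obtain e1 where e1: "e1 > 0" "\<forall>u\<in>D. \<forall>v\<in>D. \<bar>u - a\<bar> < e1 \<longrightarrow> \<bar>v - a\<bar> < e1 \<longrightarrow> dist (g u) (g v) = \<bar>u - v\<bar>"
      using g a unfolding local_isometry_on_def by blast
    obtain e2 where e2: "e2 > 0" "\<forall>u\<in>D. \<forall>v\<in>D. \<bar>u - a\<bar> < e2 \<longrightarrow> \<bar>v - a\<bar> < e2 \<longrightarrow> dist (h u) (h v) = \<bar>u - v\<bar>"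
      using h a unfolding local_isometry_on_def by blast
    obtain r \<psi> where r: "r > 0" "isochart U r (g a) \<psi>" using chart_at U[OF a] by blast
    define e where "e = min r (min e1 e2)"
    have e: "e > 0" "e \<le> r" using r e1 e2 by (auto simp: e_def)
    have gh: "dist (g x) (g y) = \<bar>x - y\<bar> \<and> dist (h x) (h y) = \<bar>x - y\<bar>"
      if "x \<in> D" "y \<in> D" "\<bar>x - a\<bar> < e" "\<bar>y - a\<bar> < e" for x y using e1(2) e2(2) that by (simp add: e_def)
    show "\<exists>T. openin (top_of_set D) T \<and> a \<in> T \<and> (\<forall>x\<in>T. \<forall>y\<in>T. P x \<longrightarrow> P y)"
    proof (cases "g a = h a")
      case True
      have "P y" if x: "x \<in> D \<inter> ball a e" "P x" and y: "y \<in> D \<inter> ball a e" for x y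
      proof -
        obtain \<rho> where \<rho>: "\<rho> > 0" "\<forall>y\<in>D. \<bar>y - x\<bar> < \<rho> \<longrightarrow> g y = h y" using x by (auto simp: P_def)
        obtain x1 where x1: "x1 \<in> D" "\<bar>x1 - a\<bar> < e" "x1 \<noteq> a" "g x1 = h x1"
        proof (cases "x = a")
          case False
          then show thesis using that[of x] x \<rho> by (auto simp: dist_real_def abs_minus_commute)
        next
          case True
          obtain b where "b \<in> D" "a < b" "b < a + min e \<rho>" using D(2)[OF a, of "min e \<rho>"] \<rho> e by auto
          then show thesis using that[of b] \<rho> True by auto
        qed
        have "g w = h w" if "w \<in> D" "\<bar>w - a\<bar> < e" for w
          using local_isometry_local_unique[OF gh r(2,1) e a True x1 that] by blast
        moreover have "\<bar>w - a\<bar> < e" if "\<bar>w - y\<bar> < e - \<bar>y - a\<bar>" for w using that by linarith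
        ultimately show ?thesis using y unfolding P_def
          by (intro exI[of _ "e - \<bar>y - a\<bar>"]) (auto simp: dist_real_def abs_minus_commute)
      qed
      moreover have "openin (top_of_set D) (D \<inter> ball a e)" by (simp add: openin_open_Int)
      moreover have "a \<in> D \<inter> ball a e" using a e by simp
      ultimately show ?thesis by blast
    next
      case False
      define s where "s = min e (dist (g a) (h a) / 2)"
      have s: "s > 0" "s \<le> e" "s \<le> dist (g a) (h a) / 2" using False e by (auto simp: s_def)
      have "\<not> P x" if x: "x \<in> D \<inter> ball a s" for x
      proof
        assume "P x"
        then have "g x = h x" using Peq x by auto
        moreover have "dist (g a) (g x) < s" "dist (h a) (h x) < s"
          using gh[of a x] a x s by (auto simp: dist_real_def abs_minus_commute)
        ultimately show False using dist_triangle[of "g a" "h a" "g x"] s(3) by (simp add: dist_commute)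
      qed
      moreover have "openin (top_of_set D) (D \<inter> ball a s)" by (simp add: openin_open_Int)
      moreover have "a \<in> D \<inter> ball a s" using a s by simp
      ultimately show ?thesis by blast
    qed
  qed (use x0 x in auto)
  then show ?thesis using Peq x by blast
qed

text \<open>Convexity keeps the intersection of the two domains connected, so no monodromy can
  appear when continuations of one germ are compared.\<close>

lemma imm_agree:
  assumes "imm U V F" "imm U W G" "convex V" "convex W" "z0 \<in> V" "z0 \<in> W" "e > 0" 
    "\<And>z. z \<in> ball z0 e \<Longrightarrow> F z = G z" "z \<in> V" "z \<in> W"
  shows "F z = G z"
proof (rule imm_unique[of "V \<inter> W"])
  have o: "open (V \<inter> W)" using assms by (auto simp: imm_def)
  show "imm U (V \<inter> W) F" "imm U (V \<inter> W) G" 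
    using imm_subset[OF assms(1) o] imm_subset[OF assms(2) o] by auto
  show "connected (V \<inter> W)" using assms convex_Int convex_connected by blast
qed (use assms in auto)

end

section \<open>Strips along a geodesic\<close>

definition rect :: "real \<Rightarrow> real \<Rightarrow> real \<Rightarrow> real \<Rightarrow> complex set" where
  "rect a b c d = {z. a < Re z \<and> Re z < b \<and> c < Im z \<and> Im z < d}"

definition half_strip :: "real \<Rightarrow> real \<Rightarrow> real \<Rightarrow> complex set" where
  "half_strip a c d = {z. a < Re z \<and> c < Im z \<and> Im z < d}"

definition strip :: "real \<Rightarrow> real \<Rightarrow> complex set" where
  "strip c d = {z. c < Im z \<and> Im z < d}"

lemma open_strips [simp, intro]: "open (rect a b c d)" "open (half_strip a c d)" "open (strip c d)"
  unfolding rect_def half_strip_def strip_def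
  by (intro open_Collect_conj open_halfspace_Re_gt open_halfspace_Re_lt open_halfspace_Im_gt open_halfspace_Im_lt)+

lemma convex_strips [simp, intro]: "convex (rect a b c d)" "convex (half_strip a c d)" "convex (strip c d)"
  unfolding rect_def half_strip_def strip_def Collect_conj_eq
  by (intro convex_Int convex_halfspace_Re_gt convex_halfspace_Re_lt convex_halfspace_Im_gt convex_halfspace_Im_lt)+

lemma mem_ball_complexI: "\<bar>Re z - Re w\<bar> + \<bar>Im z - Im w\<bar> < r \<Longrightarrow> z \<in> ball w r"
  using cmod_le[of "z - w"] by (simp add: dist_norm norm_minus_commute)

lemma mem_ball_complexD: "z \<in> ball w r \<Longrightarrow> \<bar>Re z - Re w\<bar> < r \<and> \<bar>Im z - Im w\<bar> < r"
  using abs_Re_le_cmod[of "z - w"] abs_Im_le_cmod[of "z - w"] by (simp add: dist_norm norm_minus_commute)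

context flat_region
begin

text \<open>Disks of radius \<open>r\<close> are attached at axis points spaced \<open>r/2\<close>
  apart. The hypothesis \<open>step\<close> speaks of the map built so far, because whether the next
  centre has a chart depends on where that map has led. For a ray this is known only after the axis
  has been identified with the geodesic.\<close>

lemma imm_extend_along_axis:
  fixes F0 :: "complex \<Rightarrow> 'a"
  assumes r: "r > 0" and F0: "iso_on (ball 0 r) F0" "F0 ` ball 0 r \<subseteq> U"
    and step: "\<And>F n. imm U (rect (-r/4) (of_nat n * (r/2) + r/4) (-r/4) (r/4)) F \<Longrightarrow>
      (\<And>z. z \<in> ball 0 (r/4) \<Longrightarrow> F z = F0 z) \<Longrightarrow> \<exists>\<psi>. isochart U r (F (of_real (of_nat n * (r/2)))) \<psi>"
  obtains F where "imm U (half_strip (-r/4) (-r/4) (r/4)) F" "\<And>z. z \<in> ball 0 (r/4) \<Longrightarrow> F z = F0 z"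
proof -
  define W where "W n = rect (-r/4) (of_nat n * (r/2) + r/4) (-r/4) (r/4)" for n
  have bW: "ball 0 (r/4) \<subseteq> W n" for n
  proof
    fix z :: complex assume "z \<in> ball 0 (r/4)"
    then have "\<bar>Re z\<bar> < r/4" "\<bar>Im z\<bar> < r/4" using mem_ball_complexD[of z 0 "r/4"] by auto
    moreover have "0 \<le> of_nat n * (r/2)" using r by simp
    ultimately have "-r/4 < Re z" "Re z < of_nat n * (r/2) + r/4" "-r/4 < Im z" "Im z < r/4" by linarith+
    then show "z \<in> W n" by (simp add: W_def rect_def)
  qed
  have ex: "\<exists>F. imm U (W n) F \<and> (\<forall>z\<in>ball 0 (r/4). F z = F0 z)" for n
  proof (induction n)
    case 0
    have sub: "W 0 \<subseteq> ball 0 r" using r by (auto simp: W_def rect_def simp del: mem_ball intro!: mem_ball_complexI)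
    have "imm U (W 0) F0"
      by (rule imm_subset[OF imm_isochart_ball[OF F0] _ sub]) (simp add: W_def)
    then show ?case by blast
  next
    case (Suc n)
    then obtain F where F: "imm U (W n) F" "\<And>z. z \<in> ball 0 (r/4) \<Longrightarrow> F z = F0 z" by blast
    define x where "x = of_nat n * (r/2)"
    have x: "x \<ge> 0" using r by (simp add: x_def)
    obtain \<psi> where \<psi>: "isochart U r (F (of_real x)) \<psi>"
      using step[OF F(1)[unfolded W_def] F(2)] by (auto simp: x_def)
    have "-r/4 < x" "x < of_nat n * (r/2) + r/4" using x r unfolding x_def by linarith+
    then have xW: "of_real x \<in> W n" using r by (simp add: W_def rect_def)
    obtain e where e: "e > 0" "ball (of_real x) e \<subseteq> W n" "iso_on (ball (of_real x) e) F"
      using immD(2)[OF F(1) xW] by blast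
    obtain F' where F': "iso_on (ball (of_real x) r) F'" "F' ` ball (of_real x) r = ball (F (of_real x)) r"
      "\<And>w. w \<in> ball (of_real x) e \<Longrightarrow> w \<in> ball (of_real x) r \<Longrightarrow> F' w = F w"
      using chart_extend[OF \<psi> e(3,1) r] by blast
    have immF': "imm U (ball (of_real x) r) F'"
      using imm_isochart_ball[OF F'(1)] F'(2) \<psi> by (simp add: isochart_def)
    have agree: "F z = F' z" if "z \<in> W n" "z \<in> ball (of_real x) r" for z
      by (rule imm_agree[OF F(1) immF' _ _ xW _ _ _ that, of "min e r"]) (use e r F'(3) in \<open>auto simp: W_def\<close>)
    obtain H where H: "imm U (W n \<union> ball (of_real x) r) H" "\<And>z. z \<in> W n \<Longrightarrow> H z = F z"
      by (rule imm_Un[OF F(1) immF']) (assumption | erule (1) agree | blast)+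
    have sub: "W (Suc n) \<subseteq> W n \<union> ball (of_real x) r"
    proof
      fix z assume z: "z \<in> W (Suc n)"
      then have z': "-r/4 < Re z" "Re z < x + r/2 + r/4" "\<bar>Im z\<bar> < r/4"
      proof -
        have "of_nat (Suc n) * (r/2) = x + r/2" by (simp add: x_def field_simps)
        then show "-r/4 < Re z" "Re z < x + r/2 + r/4" "\<bar>Im z\<bar> < r/4"
          using z unfolding W_def rect_def mem_Collect_eq abs_less_iff by linarith+
      qed
      show "z \<in> W n \<union> ball (of_real x) r"
      proof (cases "Re z < x + r/4")
        case True
        then show ?thesis using z' by (auto simp: W_def rect_def x_def)
      next
        case False
        \<comment> \<open>The new piece lies less than \<open>3*r/4\<close> to the right of the
          centre and less than \<open>r/4\<close> above or below it; the sum being \<open>r\<close>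
          is what dictates the height \<open>r/4\<close>.\<close>
        have "z \<in> ball (of_real x) r" by (rule mem_ball_complexI) (use False z' in simp)
        then show ?thesis by blast
      qed
    qed
    have "imm U (W (Suc n)) H" by (rule imm_subset[OF H(1) _ sub]) (simp add: W_def)
    moreover have "H z = F0 z" if "z \<in> ball 0 (r/4)" for z using H(2) F(2) bW that by (metis subsetD)
    ultimately show ?case by blast
  qed
  have cW: "convex (W n)" for n by (simp add: W_def)
  from ex obtain F where F: "\<And>n. imm U (W n) (F n)" "\<And>n z. z \<in> ball 0 (r/4) \<Longrightarrow> F n z = F0 z" by metis
  have agree: "F n z = F m z" if "z \<in> W n" "z \<in> W m" for n m z
    by (rule imm_agree[OF F(1) F(1) _ _ _ _ _ _ that, of 0 "r/4"]) 
      (use F(2) r bW[THEN subsetD, of 0] in \<open>simp_all add: cW\<close>)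
  obtain G where G: "imm U (\<Union>n. W n) G" "\<And>n z. z \<in> W n \<Longrightarrow> G z = F n z"
    by (rule imm_UN[of UNIV U W F, OF F(1)]) (assumption | erule (1) agree | blast)+
  have "half_strip (-r/4) (-r/4) (r/4) \<subseteq> (\<Union>n. W n)"
  proof
    fix z assume z: "z \<in> half_strip (-r/4) (-r/4) (r/4)"
    obtain n where "Re z < of_nat n * (r/2)" using reals_Archimedean3[of "r/2"] r by auto
    then show "z \<in> (\<Union>n. W n)" using z r by (auto simp: half_strip_def W_def rect_def intro!: exI[of _ n])
  qed
  then have "imm U (half_strip (-r/4) (-r/4) (r/4)) G" using imm_subset[OF G(1)] by blast
  moreover have "G z = F0 z" if "z \<in> ball 0 (r/4)" for z using G(2)[of z 0] F(2) bW that by (metis subsetD)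
  ultimately show thesis using that by blast
qed

lemma local_isometry_on_imm_axis:
  assumes "imm U W F" "\<And>x. x \<in> D \<Longrightarrow> of_real x \<in> W"
  shows "local_isometry_on D (\<lambda>x. F (of_real x))"
  unfolding local_isometry_on_def
proof
  fix t assume "t \<in> D"
  then obtain e where e: "e > 0" "iso_on (ball (of_real t) e) F" using assms immD(2) by blast
  show "\<exists>\<epsilon>>0. \<forall>u\<in>D. \<forall>v\<in>D. \<bar>u - t\<bar> < \<epsilon> \<longrightarrow> \<bar>v - t\<bar> < \<epsilon> \<longrightarrow>
      dist (F (of_real u)) (F (of_real v)) = \<bar>u - v\<bar>"
  proof (intro exI conjI ballI impI)
    fix u v assume "\<bar>u - t\<bar> < e" "\<bar>v - t\<bar> < e"
    then show "dist (F (of_real u)) (F (of_real v)) = \<bar>u - v\<bar>"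
      using iso_onD[OF e(2), of "of_real u" "of_real v"] 
      by (simp add: dist_norm abs_minus_commute flip: of_real_diff)
  qed (use e in auto)
qed

lemma local_isometry_on_subset: "local_isometry_on D g \<Longrightarrow> E \<subseteq> D \<Longrightarrow> local_isometry_on E g"
  unfolding local_isometry_on_def by (meson subsetD)

text \<open>The continuation along the axis and the ray are local isometries with the same
  beginning, so they coincide. Thus the axis stays at points where a chart of radius
  \<open>r\<close> exists, and the continuation never stops.\<close>

lemma ray_strip:
  assumes g: "local_isometry_on {0..} g" and r: "r > 0" and ch: "\<And>t. t \<ge> 0 \<Longrightarrow> \<exists>\<psi>. isochart U r (g t) \<psi>"
  obtains F where "imm U (half_strip (-r/4) (-r/4) (r/4)) F" "\<And>t. t \<ge> 0 \<Longrightarrow> F (of_real t) = g t"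
proof -
  have gU: "g t \<in> U" if "t \<ge> 0" for t using ch[OF that] r by (force simp: isochart_def)
  obtain \<psi> where \<psi>: "isochart U r (g 0) \<psi>" using ch[of 0] by auto
  have iso: "iso_on (ball 0 r) \<psi>" and im: "\<psi> ` ball 0 r = ball (g 0) r" and bU: "ball (g 0) r \<subseteq> U"
    using \<psi> by (auto simp: isochart_def)
  obtain e where e: "e > 0" "\<forall>u\<in>{0..}. \<forall>v\<in>{0..}. \<bar>u - 0\<bar> < e \<longrightarrow> \<bar>v - 0\<bar> < e \<longrightarrow> dist (g u) (g v) = \<bar>u - v\<bar>"
    using g unfolding local_isometry_on_def by (meson atLeast_iff order_refl)
  define d where "d = min e r"
  have d: "d > 0" "d \<le> e" "d \<le> r" using e r by (auto simp: d_def)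
  define x1 where "x1 = d/2"
  have x1: "0 < x1" "x1 < d" using d by (auto simp: x1_def)
  have gx1: "dist (g 0) (g x1) = x1" using e(2) x1 d by auto
  then have "g x1 \<in> \<psi> ` ball 0 r" using x1 d im by auto
  then obtain v where v: "v \<in> ball 0 r" "g x1 = \<psi> v" by blast
  have nv: "cmod v = x1" using iso_onD[OF iso _ v(1), of 0] r \<psi> gx1 v by (simp add: isochart_def)
  \<comment> \<open>Turning the chart by \<open>u\<close> makes the ray leave along the positive
    real axis.\<close>
  define u where "u = v / of_real x1"
  have u: "cmod u = 1" using nv x1 by (simp add: u_def norm_divide)
  have imu: "mot False u 0 ` ball 0 r = ball 0 r" using mot_image_ball[OF u, of False 0 0 r] by (simp add: mot_def)
  define F0 where "F0 z = \<psi> (mot False u 0 z)" for z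
  have F0: "iso_on (ball 0 r) F0"
    unfolding F0_def by (rule iso_on_compose[OF iso_on_mot[OF u] _ iso]) (simp add: imu)
  have F0im: "F0 ` ball 0 r = ball (g 0) r" using imu im unfolding F0_def by (metis image_image)
  have F0g: "g y = F0 (of_real y)" if y: "y \<in> {0..}" "\<bar>y - 0\<bar> < d" for y
  proof (rule local_isometry_local_unique[of "{0..}" 0 d g "\<lambda>x. F0 (of_real x)" r \<psi> x1])
    show "dist (g x) (g y) = \<bar>x - y\<bar> \<and> dist (F0 (of_real x)) (F0 (of_real y)) = \<bar>x - y\<bar>"
      if "x \<in> {0..}" "y \<in> {0..}" "\<bar>x - 0\<bar> < d" "\<bar>y - 0\<bar> < d" for x y
      using that e(2) d iso_onD[OF F0, of "of_real x" "of_real y"]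
      by (auto simp: dist_norm simp flip: of_real_diff)
  qed (use x1 d \<psi> r y in \<open>auto simp: F0_def mot_def isochart_def u_def v(2)\<close>)
  \<comment> \<open>Domain and length are left free, since this is applied to each finite rectangle
    of the construction as well as to the finished half-strip.\<close>
  have axis: "F (of_real x) = g x"
    if F: "imm U W F" "\<And>z. z \<in> ball 0 (r/4) \<Longrightarrow> F z = F0 z" and L: "L > 0" "\<And>t. 0 \<le> t \<Longrightarrow> t < L \<Longrightarrow> of_real t \<in> W"
      and x: "0 \<le> x" "x < L" for F W L x
  proof -
    have "g x = F (of_real x)"
    proof (rule local_isometry_unique[of "{0..<L}" g "\<lambda>x. F (of_real x)" 0 "min d (r/4)" x])
      show "local_isometry_on {0..<L} (\<lambda>x. F (of_real x))"
        by (rule local_isometry_on_imm_axis[OF F(1)]) (use L in auto)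
      show "local_isometry_on {0..<L} g" by (rule local_isometry_on_subset[OF g]) auto
      show "\<exists>y\<in>{0..<L}. t < y \<and> y < t + \<delta>" if "t \<in> {0..<L}" "\<delta> > 0" for t \<delta>
        using that dense[of t "min L (t + \<delta>)"] by fastforce
      show "g t = F (of_real t)" if "t \<in> {0..<L}" "\<bar>t - 0\<bar> < min d (r / 4)" for t
        using that F0g[of t] F(2)[of "of_real t"] by auto
    qed (use gU L x d r in auto)
    then show ?thesis by simp
  qed
  obtain F where F: "imm U (half_strip (-r/4) (-r/4) (r/4)) F" "\<And>z. z \<in> ball 0 (r/4) \<Longrightarrow> F z = F0 z"
  proof (rule imm_extend_along_axis[OF r F0])
    show "F0 ` ball 0 r \<subseteq> U" using F0im bU by simp
    fix F n
    assume F: "imm U (rect (-r/4) (of_nat n * (r/2) + r/4) (-r/4) (r/4)) F" "\<And>z. z \<in> ball 0 (r/4) \<Longrightarrow> F z = F0 z"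
    have n: "0 \<le> of_nat n * (r/2)" using r by simp
    have "F (of_real (of_nat n * (r/2))) = g (of_nat n * (r/2))"
      by (rule axis[OF F, of "of_nat n * (r/2) + r/4"]) (use r n in \<open>auto simp: rect_def intro: add_nonneg_pos\<close>)
    then show "\<exists>\<psi>. isochart U r (F (of_real (of_nat n * (r/2)))) \<psi>" using ch[OF n] by simp
  qed blast
  have "F (of_real t) = g t" if "t \<ge> 0" for t
    by (rule axis[OF F, of "t + 1"]) (use that r in \<open>auto simp: half_strip_def\<close>)
  then show thesis using F that by blast
qed

end

section \<open>Limits of returning strips\<close>

context flat_region
begin

text \<open>Only the values of \<open>f\<close> near 0 count. This allows the germ of the ray's
  narrow strip to be continued over regions much wider than the domain on which \<open>F\<close> was
  built.\<close>

definition germ_extends :: "complex set \<Rightarrow> (complex \<Rightarrow> 'a) \<Rightarrow> bool" where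
  "germ_extends W f \<longleftrightarrow> (\<exists>\<Phi>. imm U W \<Phi> \<and> (\<exists>e>0. \<forall>z\<in>ball 0 e. \<Phi> z = f z))"

lemma germ_extendsI: "imm U W \<Phi> \<Longrightarrow> e > 0 \<Longrightarrow> (\<And>z. z \<in> ball 0 e \<Longrightarrow> \<Phi> z = f z) \<Longrightarrow> germ_extends W f"
  unfolding germ_extends_def by blast

lemma germ_extends_mono: "germ_extends W f \<Longrightarrow> open V \<Longrightarrow> V \<subseteq> W \<Longrightarrow> germ_extends V f"
  unfolding germ_extends_def using imm_subset by blast

text \<open>Any two of the sets are convex and share 0, so their continuations agree wherever both
  are defined. The union itself may have any shape star-like about 0; this yields infinite strips
  from rectangles and the whole plane from half-strips.\<close>

lemma germ_extends_UN:
  assumes "\<And>i. i \<in> I \<Longrightarrow> germ_extends (W i) f" "\<And>i. i \<in> I \<Longrightarrow> convex (W i)" "\<And>i. i \<in> I \<Longrightarrow> 0 \<in> W i" "I \<noteq> {}"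
  shows "germ_extends (\<Union>i\<in>I. W i) f"
proof -
  have "\<forall>i\<in>I. \<exists>\<Phi> e. imm U (W i) \<Phi> \<and> e > 0 \<and> (\<forall>z\<in>ball 0 e. \<Phi> z = f z)"
    using assms(1) unfolding germ_extends_def by blast
  then obtain \<Phi> e where \<Phi>: "\<And>i. i \<in> I \<Longrightarrow> imm U (W i) (\<Phi> i)" "\<And>i. i \<in> I \<Longrightarrow> e i > 0"
    "\<And>i z. i \<in> I \<Longrightarrow> z \<in> ball 0 (e i) \<Longrightarrow> \<Phi> i z = f z" by metis
  have agree: "\<Phi> i z = \<Phi> j z" if "i \<in> I" "j \<in> I" "z \<in> W i" "z \<in> W j" for i j z
    by (rule imm_agree[OF \<Phi>(1)[OF that(1)] \<Phi>(1)[OF that(2)] _ _ _ _ _ _ that(3,4), of 0 "min (e i) (e j)"])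
      (use that assms(2,3) \<Phi>(2,3) in auto)
  obtain G where G: "imm U (\<Union>i\<in>I. W i) G" "\<And>i z. i \<in> I \<Longrightarrow> z \<in> W i \<Longrightarrow> G z = \<Phi> i z"
  proof (rule imm_UN[of I U W \<Phi>])
    show "\<Phi> i z = \<Phi> j z" if "i \<in> I" "j \<in> I" "z \<in> W i" "z \<in> W j" for i j z by (rule agree[OF that])
  qed (use \<Phi>(1) in blast)+
  obtain i where i: "i \<in> I" using assms(4) by blast
  obtain e' where e': "e' > 0" "ball 0 e' \<subseteq> W i"
    using \<Phi>(1)[OF i] assms(3)[OF i] unfolding imm_def by (meson open_contains_ball)
  show ?thesis
    by (rule germ_extendsI[OF G(1), of "min e' (e i)"]) (use e' i G(2)[OF i] \<Phi>(2,3)[OF i] in auto)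
qed

lemma germ_extends_Un:
  assumes "germ_extends V f" "germ_extends W f" "convex V" "convex W" "0 \<in> V" "0 \<in> W"
  shows "germ_extends (V \<union> W) f"
proof -
  have "germ_extends (\<Union>b\<in>UNIV. if b then V else W) f"
    by (rule germ_extends_UN) (use assms in auto)
  moreover have "(\<Union>b. if b then V else W) = V \<union> W" by (auto split: if_splits)
  ultimately show ?thesis by simp
qed

text \<open>A continuation of \<open>f\<close> becomes one of \<phi> after composition with the
  inverse motion. The two are first seen to agree near \<open>d\<close>, the image of 0; uniqueness
  moves the agreement to 0, which is why 0 and its preimage must both lie in
  \<open>W\<close>.\<close>

lemma germ_extends_translate_back:
  assumes f: "e > 0" "\<And>z. z \<in> ball 0 e \<Longrightarrow> f z = \<phi> (mot False v d z)" and \<phi>: "imm U (ball 0 r) \<phi>" "d \<in> ball 0 r"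
    and v: "cmod v = 1" and W: "germ_extends W f" "convex W" "0 \<in> W" "cnj v * (0 - d) \<in> W"
  shows "germ_extends {y. cnj v * (y - d) \<in> W} \<phi>" "convex {y. cnj v * (y - d) \<in> W}"
proof -
  have vv: "v * (cnj v * z) = z" for z using v by (metis complex_norm_square mult.assoc mult_1 of_real_1 power_one)
  obtain \<Phi> e' where \<Phi>: "imm U W \<Phi>" "e' > 0" "\<And>z. z \<in> ball 0 e' \<Longrightarrow> \<Phi> z = f z"
    using W(1) unfolding germ_extends_def by blast
  define V where "V = {y. cnj v * (y - d) \<in> W}"
  have eq: "mot False (cnj v) (- cnj v * d) y = cnj v * (y - d)" for y by (simp add: mot_def algebra_simps)
  have imm: "imm U V (\<lambda>y. \<Phi> (cnj v * (y - d)))"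
    using imm_compose_mot[OF \<Phi>(1), of "cnj v" False "- cnj v * d"] v unfolding eq V_def vimage_def by simp
  have "V = (\<lambda>z. v * z + d) ` W"
    unfolding V_def image_def by (auto simp: vv) (metis diff_add_cancel vv, metis complex_cnj_cnj mult.commute vv mult.left_commute)
  then show cV: "convex {y. cnj v * (y - d) \<in> W}"
    using convex_translation[of "(*) v ` W" d] convex_linear_image[OF _ W(2), of "(*) v"] linear_times
    unfolding V_def by (simp add: image_image add.commute)
  have r0: "r > 0" using \<phi>(2) by (metis ball_eq_empty empty_iff not_le)
  have "\<Phi> (cnj v * (y - d)) = \<phi> y" if "y \<in> V" "y \<in> ball 0 r" for y
  proof (rule imm_agree[OF imm \<phi>(1) _ _ _ _ _ _ that, of d "min e e'"])
    fix z assume "z \<in> ball d (min e e')"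
    then have "cnj v * (z - d) \<in> ball 0 (min e e')"
      using v by (simp add: norm_mult dist_norm norm_minus_commute)
    then show "\<Phi> (cnj v * (z - d)) = \<phi> z" using \<Phi>(3) f(2) by (simp add: mot_def vv)
  qed (use \<phi> f \<Phi>(2) W cV in \<open>auto simp: V_def\<close>)
  moreover obtain e2 where "e2 > 0" "ball 0 e2 \<subseteq> V"
    using imm W(4) unfolding V_def imm_def by (metis (no_types, lifting) mem_Collect_eq open_contains_ball)
  ultimately show "germ_extends {y. cnj v * (y - d) \<in> W} \<phi>"
    using germ_extendsI[OF imm, of "min e2 r" \<phi>] r0 by (fastforce simp: V_def)
qed

lemma near_identity:
  assumes "cmod v = 1"
  shows "cmod (v * z + d - z) \<le> cmod (v - 1) * cmod z + cmod d"
    "cmod (cnj v * (z - d) - z) \<le> cmod (v - 1) * cmod z + cmod d"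
proof -
  have "v * z + d - z = (v - 1) * z + d" by (simp add: algebra_simps)
  then show 1: "cmod (v * z + d - z) \<le> cmod (v - 1) * cmod z + cmod d"
    by (metis norm_mult norm_triangle_ineq)
  have "cnj v * v = 1" using assms by (metis complex_norm_square mult.commute of_real_1 power_one)
  then have "cnj v * (z - d) - z = - cnj v * (v * z + d - z)"
    by (simp add: algebra_simps)
  then have "cmod (cnj v * (z - d) - z) = cmod (v * z + d - z)" using assms by (simp add: norm_mult)
  then show "cmod (cnj v * (z - d) - z) \<le> cmod (v - 1) * cmod z + cmod d" using 1 by simp
qed

end

section \<open>Widths of strips along late pieces of the ray\<close>

locale flat_half_strip = flat_region +
  fixes F :: "complex \<Rightarrow> 'a" and w B :: real and K :: "'a set" and s :: 'a
  assumes F: "imm U (half_strip (-w) (-w) w) F" and w: "w > 0"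
    and K: "compact K" "K \<subseteq> U" "t \<ge> 0 \<Longrightarrow> F (of_real t) \<in> K"
    and mid: "\<exists>m. dist x m = dist x y / 2 \<and> dist m y = dist x y / 2"
    and s: "s \<notin> U" and B: "dist x (y::'a) \<le> B"
begin

text \<open>Asking for every length and for arbitrarily late times, and not for one infinite strip,
  makes the property survive passage to a limit of returns and lets it be refuted at a finite
  length. The two sides are separate because a strip may widen on one side of the ray only.\<close>

definition achievable :: "real \<Rightarrow> real \<Rightarrow> bool" where
  "achievable a b \<longleftrightarrow> a > 0 \<and> b > 0 \<and>
     (\<forall>T>0. \<forall>t0. \<exists>t\<ge>t0. germ_extends (rect (-T) T (-a) b) (\<lambda>z. F (of_real t + z)))"

lemma achievable_width: "achievable w w"
  unfolding achievable_def
proof (intro conjI allI impI)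
  fix T t0 :: real assume T: "T > 0"
  define t where "t = max t0 T"
  have "imm U (rect (-T) T (-w) w) (\<lambda>z. F (of_real t + z))"
    by (rule imm_subset[OF imm_translate[OF F] open_strips(1)]) (use w in \<open>auto simp: rect_def half_strip_def t_def\<close>)
  then show "\<exists>t\<ge>t0. germ_extends (rect (-T) T (-w) w) (\<lambda>z. F (of_real t + z))"
    by (intro exI[of _ t]) (auto simp: t_def intro: germ_extendsI[where e = 1])
qed (use w in auto)

text \<open>A larger immersed disk would cover every point closer to its centre than its radius, in
  particular \<open>s\<close>, which lies outside the region that receives the immersion.\<close>

lemma germ_extends_ball_bound:
  assumes "germ_extends W f" "ball c R \<subseteq> W"
  shows "R \<le> B"
proof -
  obtain \<Phi> where \<Phi>: "imm U W \<Phi>" using assms by (auto simp: germ_extends_def)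
  have imm: "imm U (ball c R) \<Phi>" using imm_subset[OF \<Phi> _ assms(2)] by simp
  have "\<not> dist (\<Phi> c) s < R"
  proof
    assume "dist (\<Phi> c) s < R"
    then have "s \<in> \<Phi> ` ball c R" by (rule imm_ball_covers[OF imm mid])
    then show False using s immD(1)[OF imm] by blast
  qed
  then show ?thesis using B[of "\<Phi> c" s] by linarith
qed

lemma strip_height_bound:
  assumes "germ_extends W f" "rect (-(a+b)) (a+b) (-a) b \<subseteq> W"
  shows "a + b \<le> 2 * B"
proof -
  \<comment> \<open>The largest disk in the strip has its centre at mid-height; the rectangle is
    long enough to contain it.\<close>
  have "ball (Complex 0 ((b - a)/2)) ((a+b)/2) \<subseteq> rect (-(a+b)) (a+b) (-a) b"
  proof
    fix z assume "z \<in> ball (Complex 0 ((b - a)/2)) ((a+b)/2)"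
    then have "\<bar>Re z\<bar> < (a+b)/2" "\<bar>Im z - (b-a)/2\<bar> < (a+b)/2" using mem_ball_complexD by fastforce+
    then have "Re z < (a+b)/2" "- Re z < (a+b)/2" "Im z - (b-a)/2 < (a+b)/2" "- (Im z - (b-a)/2) < (a+b)/2"
      unfolding abs_less_iff by blast+
    then have "-(a+b) < Re z" "Re z < a+b" "-a < Im z" "Im z < b" by (simp_all add: field_simps)
    then show "z \<in> rect (-(a+b)) (a+b) (-a) b" by (simp add: rect_def)
  qed
  then have "(a+b)/2 \<le> B" using germ_extends_ball_bound[OF assms(1)] assms(2) by blast
  then show ?thesis by simp
qed

lemma achievable_bound: "achievable a b \<Longrightarrow> a + b \<le> 2 * B"
  unfolding achievable_def using strip_height_bound by (metis add_pos_pos order_refl)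

text \<open>The pairs approaching the supremum may live at different times along the ray, so
  attainment is not claimed; a slack is enough.\<close>

lemma almost_maximal_achievable:
  assumes "\<eta> > 0"
  obtains a b where "achievable a b" "\<And>a' b'. achievable a' b' \<Longrightarrow> a' + b' < a + b + \<eta>"
proof -
  define A where "A = {a + b |a b. achievable a b}"
  have ne: "A \<noteq> {}" using achievable_width by (auto simp: A_def)
  have bd: "bdd_above A" using achievable_bound by (auto simp: A_def intro!: bdd_aboveI[of _ "2 * B"])
  have "\<exists>x\<in>A. Sup A - \<eta> < x" using less_cSup_iff[OF ne bd, of "Sup A - \<eta>"] assms by simp
  then obtain a b where ab: "achievable a b" "Sup A - \<eta> < a + b" by (auto simp: A_def)
  have "a' + b' < a + b + \<eta>" if "achievable a' b'" for a' b'
  proof -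
    have "a' + b' \<le> Sup A" by (rule cSup_upper[OF _ bd]) (use that in \<open>auto simp: A_def\<close>)
    then show ?thesis using ab by simp
  qed
  then show thesis using ab that by blast
qed

text \<open>The ray returns to a small disk infinitely often; passing to a subsequence, the
  germs of \<^term>\<open>F\<close> at the return times differ from a limit germ by rigid motions tending to the identity.\<close>

lemma limit_germ:
  assumes "achievable a b"
  obtains t :: "nat \<Rightarrow> real" and \<phi> r v d where "filterlim t at_top sequentially"
    "r > 0" "imm U (ball 0 r) \<phi>" "\<And>n. cmod (v n) = 1" "v \<longlonglongrightarrow> 1" "d \<longlonglongrightarrow> 0"
    "\<And>n. d n \<in> ball 0 r" "\<And>n. t n \<ge> 0"
    "\<And>n. \<exists>e>0. \<forall>z\<in>ball 0 e. F (of_real (t n) + z) = \<phi> (mot False (v n) (d n) z)"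
    "\<And>T. \<forall>\<^sub>F n in sequentially. germ_extends (rect (-T) T (-a) b) (\<lambda>z. F (of_real (t n) + z))"
proof -
  \<comment> \<open>\<open>Suc n\<close>, because the length in \<open>achievable\<close> has to be
    positive.\<close>
  have "\<exists>t\<ge>real n. germ_extends (rect (-real (Suc n)) (Suc n) (-a) b) (\<lambda>z. F (of_real t + z))" for n
    using assms unfolding achievable_def by (metis of_nat_0_less_iff zero_less_Suc)
  then obtain t where t: "\<And>n. t n \<ge> real n"
    "\<And>n. germ_extends (rect (-real (Suc n)) (Suc n) (-a) b) (\<lambda>z. F (of_real (t n) + z))" by metis
  have t0: "t n \<ge> 0" for n using t(1)[of n] by linarith
  obtain p \<sigma> where p: "p \<in> K" "strict_mono \<sigma>" "((\<lambda>n. F (of_real (t n))) \<circ> \<sigma>) \<longlonglongrightarrow> p"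
    using K(1)[unfolded compact_def, rule_format, of "\<lambda>n. F (of_real (t n))"] K(3)[OF t0] by blast
  obtain r \<phi>0 where r: "r > 0" "isochart U r p \<phi>0" using chart_at K p by blast
  have iso: "iso_on (ball 0 r) \<phi>0" and \<phi>00: "\<phi>0 0 = p" and \<phi>U: "\<phi>0 ` ball 0 r \<subseteq> U"
    using r(2) by (auto simp: isochart_def)
  have "\<forall>\<^sub>F n in sequentially. dist (F (of_real (t (\<sigma> n)))) p < r"
    using tendstoD[OF p(3) r(1)] by simp
  then obtain N where N: "\<And>n. n \<ge> N \<Longrightarrow> dist (F (of_real (t (\<sigma> n)))) p < r"
    unfolding eventually_sequentially by blast
  \<comment> \<open>Dropping the first \<open>N\<close> terms puts every return, not just almost
    every one, inside the chart at \<open>p\<close>.\<close>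
  define \<rho> where "\<rho> n = \<sigma> (n + N)" for n
  have \<rho>: "strict_mono \<rho>" using p(2) unfolding \<rho>_def strict_mono_def by simp
  have lim: "(\<lambda>n. F (of_real (t (\<rho> n)))) \<longlonglongrightarrow> p"
    using LIMSEQ_ignore_initial_segment[OF p(3), of N] by (simp add: \<rho>_def o_def)
  have "\<exists>k u c. cmod u = 1 \<and> c \<in> ball 0 r \<and> (\<exists>e>0. \<forall>z\<in>ball 0 e. F (of_real (t (\<rho> n)) + z) = \<phi>0 (mot k u c z))" for n
  proof -
    define x where "x = t (\<rho> n)"
    have "of_real x \<in> half_strip (-w) (-w) w" using t0[of "\<rho> n"] w by (auto simp: half_strip_def x_def)
    then obtain e where e: "e > 0" "iso_on (ball (of_real x) e) F" using immD(2)[OF F] by blast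
    define e' where "e' = min e (r - dist p (F (of_real x)))"
    have e': "e' > 0" using N[of "n + N"] e by (simp add: e'_def x_def \<rho>_def dist_commute)
    have le: "dist p (F (of_real x)) + e' \<le> r" by (simp add: e'_def)
    have iF: "iso_on (ball (of_real x) e') F" by (rule iso_on_subset[OF e(2)]) (auto simp: e'_def)
    obtain k u c where m: "cmod u = 1"
      "\<And>z. z \<in> ball (of_real x) e' \<Longrightarrow> F z = \<phi>0 (mot k u c z) \<and> mot k u c z \<in> ball 0 r"
      by (rule iso_on_chart_eq_mot[OF r(2) iF e' le]) blast
    have shift: "mot k u c (of_real x + z) = mot k u (mot k u c (of_real x)) z" for z
      by (simp add: mot_def algebra_simps)
    have "F (of_real x + z) = \<phi>0 (mot k u (mot k u c (of_real x)) z)" if "z \<in> ball 0 e'" for z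
      using m(2)[of "of_real x + z"] that shift by (simp add: dist_norm)
    moreover have "mot k u c (of_real x) \<in> ball 0 r" using m(2)[of "of_real x"] e' by simp
    ultimately show ?thesis using m(1) e' unfolding x_def by blast
  qed
  then obtain k u c where m: "\<And>n. cmod (u n) = 1" "\<And>n. c n \<in> ball 0 r"
      "\<And>n. \<exists>e>0. \<forall>z\<in>ball 0 e. F (of_real (t (\<rho> n)) + z) = \<phi>0 (mot (k n) (u n) (c n) z)"
    by metis
  have c: "cmod (c n) = dist (F (of_real (t (\<rho> n)))) p" for n
  proof -
    have "F (of_real (t (\<rho> n))) = \<phi>0 (mot (k n) (u n) (c n) 0)"
      using m(3)[of n] by (metis add.right_neutral centre_in_ball)
    then have "F (of_real (t (\<rho> n))) = \<phi>0 (c n)" by (simp add: mot_def)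
    then show ?thesis using iso_onD[OF iso _ m(2), of 0] r(1) \<phi>00 by (simp add: dist_commute)
  qed
  have clim: "c \<longlonglongrightarrow> 0"
    using lim unfolding tendsto_dist_iff[of _ p] tendsto_norm_zero_iff[of c, symmetric] c .
  have "infinite {n. k n} \<or> infinite {n. \<not> k n}"
  proof -
    have "UNIV = {n. k n} \<union> {n. \<not> k n}" by auto
    then show ?thesis by (metis finite_Un infinite_UNIV_nat)
  qed
  \<comment> \<open>Two further subsequences: one orientation occurs infinitely often, and on it the
    rotation factors accumulate on the unit circle.\<close>
  then have "\<exists>k0. infinite {n. k n = k0}"
    by (elim disjE) (rule exI[of _ True], simp, rule exI[of _ False], simp)
  then obtain k0 where "infinite {n. k n = k0}" by blast
  then obtain \<alpha> :: "nat \<Rightarrow> nat" where \<alpha>: "strict_mono \<alpha>" "\<And>n. k (\<alpha> n) = k0" using infinite_enumerate[of "{n. k n = k0}"] by auto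
  have "\<exists>l\<in>sphere 0 1. \<exists>\<beta>::nat\<Rightarrow>nat. strict_mono \<beta> \<and> ((\<lambda>n. u (\<alpha> n)) \<circ> \<beta>) \<longlonglongrightarrow> l"
    using compact_sphere[of "0::complex" 1, unfolded compact_def, rule_format, of "\<lambda>n. u (\<alpha> n)"] m(1) by auto
  then obtain l and \<beta> :: "nat \<Rightarrow> nat" where l: "cmod l = 1" "strict_mono \<beta>" "(\<lambda>n. u (\<alpha> (\<beta> n))) \<longlonglongrightarrow> l"
    by (auto simp: o_def)
  define \<gamma> where "\<gamma> n = \<alpha> (\<beta> n)" for n
  have \<gamma>: "strict_mono \<gamma>" using \<alpha> l unfolding \<gamma>_def strict_mono_def by simp
  define J where "J z = (if k0 then cnj z else z)" for z
  have J: "J (x * y) = J x * J y" "J (x + y) = J x + J y" "J (J x) = x" "cmod (J x) = cmod x" for x y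
    by (auto simp: J_def)
  have Jlim: "(\<lambda>n. J (f n)) \<longlonglongrightarrow> J z" if "f \<longlonglongrightarrow> z" for f z
    using that by (auto simp: J_def intro: tendsto_intros)
  have motJ: "mot k0 x y z = x * J z + y" for x y z by (simp add: mot_def J_def)
  \<comment> \<open>The limiting rotation, possibly with a reflection, is absorbed into the chart.
    What remains between \<phi> and the returning germs preserves orientation and tends to the
    identity.\<close>
  define \<phi> where "\<phi> z = \<phi>0 (mot k0 l 0 z)" for z
  define v where "v n = J (u (\<gamma> n) / l)" for n
  define d where "d n = J (c (\<gamma> n) / l)" for n
  have l0: "l \<noteq> 0" using l by auto
  have key: "mot k0 l 0 (mot False (v n) (d n) z) = mot k0 (u (\<gamma> n)) (c (\<gamma> n)) z" for n z
    using l0 unfolding motJ by (simp add: v_def d_def mot_def J distrib_left)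
  have imb: "mot k0 l 0 ` ball 0 r = ball 0 r" using mot_image_ball[OF l(1), of k0 0 0 r] by (simp add: mot_def)
  show thesis
  proof (rule that[of "\<lambda>n. t (\<rho> (\<gamma> n))" r \<phi> v d])
    have mono: "strict_mono (\<lambda>n. \<rho> (\<gamma> n))" using \<rho> \<gamma> unfolding strict_mono_def by simp
    have tn: "t (\<rho> (\<gamma> n)) \<ge> real n" for n
      using t(1)[of "\<rho> (\<gamma> n)"] seq_suble[OF mono, of n] by linarith
    show "filterlim (\<lambda>n. t (\<rho> (\<gamma> n))) at_top sequentially"
      by (rule filterlim_at_top_mono[OF filterlim_real_sequentially]) (use tn in auto)
    show "imm U (ball 0 r) \<phi>"
    proof (rule imm_isochart_ball)
      show "iso_on (ball 0 r) \<phi>"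
        unfolding \<phi>_def by (rule iso_on_compose[OF iso_on_mot[OF l(1)] _ iso]) (simp add: imb)
      show "\<phi> ` ball 0 r \<subseteq> U" using imb \<phi>U unfolding \<phi>_def by (metis image_image)
    qed
    show "cmod (v n) = 1" for n using m(1) l(1) by (simp add: v_def J norm_divide)
    have "v \<longlonglongrightarrow> J (l / l)" unfolding v_def \<gamma>_def using l0 l(3) by (intro Jlim tendsto_intros)
    then show "v \<longlonglongrightarrow> 1" using l0 by (cases k0) (simp_all add: J_def)
    have "(\<lambda>n. c (\<gamma> n)) \<longlonglongrightarrow> 0" using LIMSEQ_subseq_LIMSEQ[OF clim \<gamma>] by (simp add: o_def)
    then have "d \<longlonglongrightarrow> J (0 / l)" unfolding d_def using l0 by (intro Jlim tendsto_intros)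
    then show "d \<longlonglongrightarrow> 0" by (cases k0) (simp_all add: J_def)
    show "d n \<in> ball 0 r" for n using m(2)[of "\<gamma> n"] l by (simp add: d_def J norm_divide)
    show "\<exists>e>0. \<forall>z\<in>ball 0 e. F (of_real (t (\<rho> (\<gamma> n))) + z) = \<phi> (mot False (v n) (d n) z)" for n
      using m(3)[of "\<gamma> n"] \<alpha>(2)[of "\<beta> n"] unfolding \<phi>_def key by (simp add: \<gamma>_def)
    show "\<forall>\<^sub>F n in sequentially. germ_extends (rect (-T) T (-a) b) (\<lambda>z. F (of_real (t (\<rho> (\<gamma> n))) + z))" for T
    proof -
      obtain n0 where n0: "T \<le> real n0" using real_arch_simple by blast
      have "germ_extends (rect (-T) T (-a) b) (\<lambda>z. F (of_real (t (\<rho> (\<gamma> n))) + z))" if "n \<ge> n0" for n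
      proof (rule germ_extends_mono[OF t(2)])
        have "real n0 \<le> real (\<rho> (\<gamma> n))" using seq_suble[OF mono, of n] that by linarith
        then show "rect (-T) T (-a) b \<subseteq> rect (- real (Suc (\<rho> (\<gamma> n)))) (Suc (\<rho> (\<gamma> n))) (-a) b"
          using n0 by (auto simp: rect_def)
      qed simp
      then show ?thesis unfolding eventually_sequentially by blast
    qed
  qed (use r t0 in auto)
qed

end

section \<open>The limit strip and the returns to it\<close>

locale return_germ = flat_half_strip +
  fixes a b r :: real and t :: "nat \<Rightarrow> real" and \<phi> :: "complex \<Rightarrow> 'a" and v d :: "nat \<Rightarrow> complex"
  assumes ach: "achievable a b"
    and almost_max: "achievable a' b' \<Longrightarrow> a' + b' < a + b + w/4"
    and t: "filterlim t at_top sequentially" "t n \<ge> 0"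
    and r: "r > 0" and \<phi>: "imm U (ball 0 r) \<phi>"
    and v: "cmod (v n) = 1" "v \<longlonglongrightarrow> 1" and d: "d \<longlonglongrightarrow> 0" "d n \<in> ball 0 r"
    and return: "\<exists>e>0. \<forall>z\<in>ball 0 e. F (of_real (t n) + z) = \<phi> (mot False (v n) (d n) z)"
    and long: "\<forall>\<^sub>F n in sequentially. germ_extends (rect (-T) T (-a) b) (\<lambda>z. F (of_real (t n) + z))"
begin

lemma ab_pos: "a > 0" "b > 0" using ach by (auto simp: achievable_def)

lemma eventually_near_identity:
  assumes "\<epsilon> > 0"
  shows "\<forall>\<^sub>F n in sequentially. \<forall>z. cmod z \<le> L \<longrightarrow>
    cmod (v n * z + d n - z) < \<epsilon> \<and> cmod (cnj (v n) * (z - d n) - z) < \<epsilon>"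
proof -
  have "(\<lambda>n. cmod (v n - 1) * L + cmod (d n)) \<longlonglongrightarrow> cmod (1 - 1) * L + cmod 0"
    using v(2) d(1) by (intro tendsto_intros)
  then have "\<forall>\<^sub>F n in sequentially. cmod (v n - 1) * L + cmod (d n) < \<epsilon>"
    using assms by (intro order_tendstoD) auto
  then show ?thesis
  proof eventually_elim
    case (elim n)
    have "cmod (v n * z + d n - z) < \<epsilon> \<and> cmod (cnj (v n) * (z - d n) - z) < \<epsilon>" if "cmod z \<le> L" for z
    proof -
      have "cmod (v n - 1) * cmod z \<le> cmod (v n - 1) * L" using that by (intro mult_left_mono) auto
      then show ?thesis using elim near_identity[OF v(1)[of n], of z "d n"] by linarith
    qed
    then show ?case by blast
  qed
qed

lemma germ_at_return:
  assumes "germ_extends W (\<lambda>z. F (of_real (t n) + z))" "convex W" "0 \<in> W" "cnj (v n) * (0 - d n) \<in> W"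
  shows "germ_extends {y. cnj (v n) * (y - d n) \<in> W} \<phi>" "convex {y. cnj (v n) * (y - d n) \<in> W}"
proof -
  obtain e where e: "e > 0" "\<forall>z\<in>ball 0 e. F (of_real (t n) + z) = \<phi> (mot False (v n) (d n) z)"
    using return by blast
  show "germ_extends {y. cnj (v n) * (y - d n) \<in> W} \<phi>" "convex {y. cnj (v n) * (y - d n) \<in> W}"
    using germ_extends_translate_back[OF e(1) _ \<phi> d(2)[of n] v(1)[of n] assms(1-4)] e(2) by blast+
qed

text \<open>A slightly trimmed rectangle is carried by a late return motion into a full rectangle
  available along the ray, so the limit germ extends over it; these rectangles exhaust the
  strip.\<close>

lemma germ_extends_strip: "germ_extends (strip (-a) b) \<phi>"
proof -
  \<comment> \<open>The margin absorbs the displacement by the return motion: at most 1 to fit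
    length \<open>j + 1\<close> into \<open>j + 2\<close>, below \<open>a\<close> and
    \<open>b\<close> so that 0 stays inside, and tending to 0 for the exhaustion.\<close>
  define \<delta> where "\<delta> j = min (min a b) 1 / (real j + 2)" for j
  have \<delta>: "\<delta> j > 0" "\<delta> j \<le> 1" "\<delta> j < a" "\<delta> j < b" for j
  proof -
    have "\<delta> j \<le> min (min a b) 1 / 2" unfolding \<delta>_def using ab_pos by (intro divide_left_mono) auto
    moreover have "\<delta> j > 0" unfolding \<delta>_def using ab_pos by auto
    ultimately show "\<delta> j > 0" "\<delta> j \<le> 1" "\<delta> j < a" "\<delta> j < b" using ab_pos by auto
  qed
  define R where "R j = rect (- (real j + 1)) (real j + 1) (-a + \<delta> j) (b - \<delta> j)" for j
  have "germ_extends (R j) \<phi>" for j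
  proof -
    have "\<forall>\<^sub>F n in sequentially. germ_extends (rect (- (real j + 2)) (real j + 2) (-a) b) (\<lambda>z. F (of_real (t n) + z)) \<and>
       (\<forall>z. cmod z \<le> real j + 1 + a + b \<longrightarrow>
         cmod (v n * z + d n - z) < \<delta> j \<and> cmod (cnj (v n) * (z - d n) - z) < \<delta> j)"
      using long eventually_near_identity[OF \<delta>(1)] by (intro eventually_conj)
    then obtain n where n: "germ_extends (rect (- (real j + 2)) (real j + 2) (-a) b) (\<lambda>z. F (of_real (t n) + z))"
       "\<And>z. cmod z \<le> real j + 1 + a + b \<Longrightarrow> cmod (cnj (v n) * (z - d n) - z) < \<delta> j"
      unfolding eventually_sequentially by blast
    have near: "cnj (v n) * (z - d n) \<in> rect (- (real j + 2)) (real j + 2) (-a) b" if "z \<in> R j" for z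
    proof -
      have z: "\<bar>Re z\<bar> < real j + 1" "-a + \<delta> j < Im z" "Im z < b - \<delta> j" using that by (auto simp: R_def rect_def)
      have "cmod z \<le> \<bar>Re z\<bar> + \<bar>Im z\<bar>" by (rule cmod_le)
      then have "cmod z \<le> real j + 1 + a + b" using z \<delta>[of j] ab_pos by linarith
      from n(2)[OF this] have "\<bar>Re (cnj (v n) * (z - d n)) - Re z\<bar> < \<delta> j" "\<bar>Im (cnj (v n) * (z - d n)) - Im z\<bar> < \<delta> j"
        using abs_Re_le_cmod[of "cnj (v n) * (z - d n) - z"] abs_Im_le_cmod[of "cnj (v n) * (z - d n) - z"]
        unfolding minus_complex.sel by linarith+
      then have "- (real j + 2) < Re (cnj (v n) * (z - d n))" "Re (cnj (v n) * (z - d n)) < real j + 2"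
        "-a < Im (cnj (v n) * (z - d n))" "Im (cnj (v n) * (z - d n)) < b"
        using z \<delta>[of j] by linarith+
      then show ?thesis unfolding rect_def by simp
    qed
    have "0 \<in> R j" using \<delta>[of j] by (auto simp: R_def rect_def)
    then have "cnj (v n) * (0 - d n) \<in> rect (- (real j + 2)) (real j + 2) (-a) b" by (rule near)
    then have "germ_extends {y. cnj (v n) * (y - d n) \<in> rect (- (real j + 2)) (real j + 2) (-a) b} \<phi>"
      by (intro germ_at_return(1)[OF n(1) convex_strips(1)]) (use ab_pos in \<open>auto simp: rect_def\<close>)
    then show ?thesis using near by (rule_tac germ_extends_mono) (auto simp: R_def)
  qed
  then have "germ_extends (\<Union>j\<in>UNIV. R j) \<phi>"
    by (rule germ_extends_UN) (use \<delta> in \<open>auto simp: R_def\<close>, use \<delta> in \<open>auto simp: rect_def\<close>)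
  moreover have "strip (-a) b \<subseteq> (\<Union>j. R j)"
  proof
    fix z assume z: "z \<in> strip (-a) b"
    have "\<delta> \<longlonglongrightarrow> 0"
      unfolding \<delta>_def by (intro real_tendsto_divide_at_top[OF tendsto_const] filterlim_tendsto_add_at_top[OF tendsto_const, THEN filterlim_compose[OF _ filterlim_real_sequentially]]
        filterlim_at_top_mono[OF filterlim_real_sequentially]) auto
    moreover have "min (Im z + a) (b - Im z) > 0" using z by (auto simp: strip_def)
    ultimately have "\<forall>\<^sub>F j in sequentially. \<delta> j < min (Im z + a) (b - Im z)"
      by (rule order_tendstoD(2))
    moreover have "\<forall>\<^sub>F j in sequentially. \<bar>Re z\<bar> < real j"
      using filterlim_real_sequentially by (simp add: filterlim_at_top_dense)
    ultimately have "\<forall>\<^sub>F j in sequentially. \<delta> j < min (Im z + a) (b - Im z) \<and> \<bar>Re z\<bar> < real j"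
      by (rule eventually_conj)
    then obtain j where "\<delta> j < min (Im z + a) (b - Im z)" "\<bar>Re z\<bar> < real j"
      unfolding eventually_sequentially by blast
    then have "z \<in> R j" by (auto simp: R_def rect_def)
    then show "z \<in> (\<Union>j. R j)" by blast
  qed
  ultimately show ?thesis using germ_extends_mono by blast
qed

text \<open>A wider rectangle at distance \<^term>\<open>X\<close> along the limit germ would reappear along the ray
  near the times \<^term>\<open>t n + X\<close>.\<close>

lemma no_wide_rect:
  fixes a' b' :: real
  assumes ab': "a \<le> a'" "b \<le> b'" "a + b + w/2 \<le> a' + b'"
  obtains T where "T > 0"
    "\<And>W X::real. germ_extends W \<phi> \<Longrightarrow> strip (-a) b \<subseteq> W \<Longrightarrow> X \<ge> 0 \<Longrightarrow> \<not> rect (X - T) (X + T) (-a') b' \<subseteq> W"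
proof -
  \<comment> \<open>Trimming both edges by \<open>w/8\<close> still leaves \<open>w/4\<close> more
    than \<open>a + b\<close>, which almost maximality forbids. The other bounds keep a disk of
    radius \<open>2 * \<delta>\<close> inside the strip and inside the domain of \<phi>.\<close>
  define \<delta> where "\<delta> = min (w/8) (min (min a b) r / 4)"
  have \<delta>: "\<delta> > 0" "\<delta> \<le> w/8" "\<delta> < w" "\<delta> < a" "\<delta> < b" "2 * \<delta> < r" "2 * \<delta> < a" "2 * \<delta> < b" using ab_pos r w by (auto simp: \<delta>_def)
  have "\<not> achievable (a' - \<delta>) (b' - \<delta>)"
    using almost_max[of "a' - \<delta>" "b' - \<delta>"] ab' \<delta> by linarith
  moreover have "a' - \<delta> > 0" "b' - \<delta> > 0" using ab' \<delta> by linarith+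
  ultimately obtain T t0 where T: "T > 0"
    "\<And>s. s \<ge> t0 \<Longrightarrow> \<not> germ_extends (rect (-T) T (-(a' - \<delta>)) (b' - \<delta>)) (\<lambda>z. F (of_real s + z))"
    unfolding achievable_def by blast
  show thesis
  proof (rule that[of "T + \<delta>"])
    show "T + \<delta> > 0" using T \<delta> by linarith
    fix W and X :: real assume W: "germ_extends W \<phi>" "strip (-a) b \<subseteq> W" and X: "X \<ge> 0"
    show "\<not> rect (X - (T + \<delta>)) (X + (T + \<delta>)) (-a') b' \<subseteq> W"
    proof
      assume sub: "rect (X - (T + \<delta>)) (X + (T + \<delta>)) (-a') b' \<subseteq> W"
      obtain \<Phi> e where \<Phi>: "imm U W \<Phi>" "e > 0" "\<And>z. z \<in> ball 0 e \<Longrightarrow> \<Phi> z = \<phi> z"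
        using W(1) unfolding germ_extends_def by blast
      \<comment> \<open>Bounds the size of all points, in the corridor up to \<open>X\<close> and in
        the trimmed rectangle around \<open>X\<close>, at which the return motion must be close to
        the identity.\<close>
      define L where "L = X + T + a' + b' + 2 * \<delta>"
      have "\<forall>\<^sub>F n in sequentially. t n \<ge> t0" using t(1) by (simp add: filterlim_at_top)
      moreover have "\<forall>\<^sub>F n in sequentially. \<forall>z. cmod z \<le> L \<longrightarrow>
          cmod (v n * z + d n - z) < \<delta> \<and> cmod (cnj (v n) * (z - d n) - z) < \<delta>"
        by (rule eventually_near_identity[OF \<delta>(1)])
      ultimately have "\<forall>\<^sub>F n in sequentially. t n \<ge> t0 \<and> (\<forall>z. cmod z \<le> L \<longrightarrow>
          cmod (v n * z + d n - z) < \<delta> \<and> cmod (cnj (v n) * (z - d n) - z) < \<delta>)"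
        by (rule eventually_conj)
      then obtain n where n: "t n \<ge> t0" "\<And>z. cmod z \<le> L \<Longrightarrow> cmod (v n * z + d n - z) < \<delta>"
        unfolding eventually_sequentially by blast
      define m where "m = mot False (v n) (d n)"
      have m: "\<bar>Re (m z) - Re z\<bar> < \<delta> \<and> \<bar>Im (m z) - Im z\<bar> < \<delta>" if "\<bar>Re z\<bar> + \<bar>Im z\<bar> \<le> L" for z
      proof -
        have "cmod (m z - z) < \<delta>" using n(2)[of z] cmod_le[of z] that by (simp add: m_def mot_def)
        then show ?thesis using abs_Re_le_cmod[of "m z - z"] abs_Im_le_cmod[of "m z - z"] by simp
      qed
      have d\<delta>: "cmod (d n) < \<delta>" using n(2)[of 0] X T \<delta> ab' by (simp add: L_def)
      have imm\<Phi>: "imm U (m -` W) (\<lambda>z. \<Phi> (m z))" unfolding m_def by (rule imm_compose_mot[OF \<Phi>(1) v(1)])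
      have immF: "imm U {z. of_real (t n) + z \<in> half_strip (-w) (-w) w} (\<lambda>z. F (of_real (t n) + z))"
        by (rule imm_translate[OF F])
      \<comment> \<open>A thin corridor along the axis from 0 to \<open>X\<close>, contained in the
        ray's own strip and, after the motion, in the limit strip. Agreement of \<open>F\<close>
        with the continuation travels along it from time \<open>t n\<close> to time
        \<open>t n + X\<close>.\<close>
      define C where "C = rect (-\<delta>) (X + \<delta>) (-\<delta>) \<delta>"
      have C1: "C \<subseteq> {z. of_real (t n) + z \<in> half_strip (-w) (-w) w}"
        using \<delta> t(2)[of n] by (auto simp: C_def rect_def half_strip_def)
      have C2: "C \<subseteq> m -` W"
      proof
        fix z assume z: "z \<in> C"
        then have "\<bar>Re z\<bar> + \<bar>Im z\<bar> \<le> L" using X T \<delta> ab' ab_pos by (auto simp: C_def rect_def L_def)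
        from m[OF this] have "m z \<in> strip (-a) b" using z \<delta> by (auto simp: C_def rect_def strip_def)
        then show "z \<in> m -` W" using W(2) by blast
      qed
      have oC: "open C" "convex C" by (auto simp: C_def)
      have bsub: "ball 0 (2 * \<delta>) \<subseteq> strip (-a) b"
      proof
        fix z :: complex assume "z \<in> ball 0 (2 * \<delta>)"
        then have "\<bar>Im z\<bar> < 2 * \<delta>" using mem_ball_complexD[of z 0] by simp
        then have "-a < Im z" "Im z < b" using \<delta>(7,8) by linarith+
        then show "z \<in> strip (-a) b" by (simp add: strip_def)
      qed
      have \<Phi>\<phi>: "\<Phi> z = \<phi> z" if "z \<in> ball 0 (2 * \<delta>)" for z
      proof (rule imm_agree[of "ball 0 (2*\<delta>)" \<Phi> "ball 0 (2*\<delta>)" \<phi> 0 e z])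
        show "imm U (ball 0 (2 * \<delta>)) \<Phi>" by (rule imm_subset[OF \<Phi>(1)]) (use bsub W(2) in auto)
        show "imm U (ball 0 (2 * \<delta>)) \<phi>" by (rule imm_subset[OF \<phi>]) (use \<delta> in auto)
      qed (use that \<delta> \<Phi> in auto)
      obtain e1 where e1: "e1 > 0" "\<And>z. z \<in> ball 0 e1 \<Longrightarrow> F (of_real (t n) + z) = \<phi> (m z)"
        using return[of n] unfolding m_def by blast
      have agree: "F (of_real (t n) + z) = \<Phi> (m z)" if "z \<in> C" for z
      proof (rule imm_agree[of C "\<lambda>z. F (of_real (t n) + z)" C "\<lambda>z. \<Phi> (m z)" 0 "min e1 \<delta>" z])
        show "imm U C (\<lambda>z. F (of_real (t n) + z))" "imm U C (\<lambda>z. \<Phi> (m z))"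
          using imm_subset[OF immF oC(1) C1] imm_subset[OF imm\<Phi> oC(1) C2] by auto
        fix z :: complex assume z: "z \<in> ball 0 (min e1 \<delta>)"
        have "cmod (m z) \<le> cmod z + cmod (d n)"
          unfolding m_def mot_def using norm_triangle_ineq[of "v n * z" "d n"] v(1) by (simp add: norm_mult)
        then have "m z \<in> ball 0 (2 * \<delta>)" using z d\<delta> by simp
        then show "F (of_real (t n) + z) = \<Phi> (m z)" using e1(2)[of z] \<Phi>\<phi> z by simp
      qed (use that oC e1(1) \<delta> X in \<open>auto simp: C_def rect_def\<close>)
      have "of_real X \<in> C" using X \<delta> by (auto simp: C_def rect_def)
      then obtain e2 where e2: "e2 > 0" "ball (of_real X) e2 \<subseteq> C" using oC(1) open_contains_ball by meson
      have "germ_extends (rect (-T) T (-(a' - \<delta>)) (b' - \<delta>)) (\<lambda>z. F (of_real (t n + X) + z))"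
      proof (rule germ_extendsI[OF _ e2(1)])
        have sub': "rect (-T) T (-(a' - \<delta>)) (b' - \<delta>) \<subseteq> {z. of_real X + z \<in> m -` W}"
        proof
          fix z assume z: "z \<in> rect (-T) T (-(a' - \<delta>)) (b' - \<delta>)"
          have "\<bar>Re (of_real X + z)\<bar> + \<bar>Im (of_real X + z)\<bar> \<le> L" 
            using z X T \<delta> ab' ab_pos by (auto simp: rect_def L_def)
          from m[OF this] have "m (of_real X + z) \<in> rect (X - (T + \<delta>)) (X + (T + \<delta>)) (-a') b'"
            using z by (auto simp: rect_def)
          then show "z \<in> {z. of_real X + z \<in> m -` W}" using sub by auto
        qed
        show "imm U (rect (-T) T (-(a' - \<delta>)) (b' - \<delta>)) (\<lambda>z. \<Phi> (m (of_real X + z)))"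
          by (rule imm_subset[OF imm_translate[OF imm\<Phi>] open_strips(1) sub'])
        fix z :: complex assume "z \<in> ball 0 e2"
        then have "of_real X + z \<in> C" using e2(2) by (auto simp: dist_norm)
        then show "\<Phi> (m (of_real X + z)) = F (of_real (t n + X) + z)" using agree by (simp add: add.assoc)
      qed
      moreover have "t n + X \<ge> t0" using n(1) X by linarith
      ultimately show False using T(2) by blast
    qed
  qed
qed

text \<open>A return with a small non-zero angle would make the strip around the ray cross the
  border of the limit strip along a rectangle as long as we like.\<close>

lemma eventually_parallel: "\<forall>\<^sub>F n in sequentially. v n = 1"
proof -
  obtain T1 where T1: "T1 > 0" "\<And>W X. germ_extends W \<phi> \<Longrightarrow> strip (-a) b \<subseteq> W \<Longrightarrow> X \<ge> 0 \<Longrightarrow>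
      \<not> rect (X - T1) (X + T1) (-a) (b + w/2) \<subseteq> W"
    using no_wide_rect[of a "b + w/2"] w by auto
  obtain T2 where T2: "T2 > 0" "\<And>W X. germ_extends W \<phi> \<Longrightarrow> strip (-a) b \<subseteq> W \<Longrightarrow> X \<ge> 0 \<Longrightarrow>
      \<not> rect (X - T2) (X + T2) (-(a + w/2)) b \<subseteq> W"
    using no_wide_rect[of "a + w/2" b] w by auto
  define T where "T = max T1 T2"
  have T: "T > 0" "T1 \<le> T" "T2 \<le> T" using T1 by (auto simp: T_def)
  \<comment> \<open>1/2 makes the cosine \<open>c\<close> at least 1/2, and \<open>w\<close> puts 0
    inside the tilted strip. The three quotients by \<open>T\<close> bound the height change over
    length \<open>T\<close> and delay the crossing of either border. The last three entries keep the
    offset \<open>d n\<close> small against the borders and against \<open>T\<close>.\<close>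
  define \<epsilon> where "\<epsilon> = Min {1/2, w, w / (2 * T), a / (8 * T), b / (8 * T), a/2, b/2, T}"
  have \<epsilon>0: "\<epsilon> > 0" unfolding \<epsilon>_def using ab_pos w T by (subst Min_gr_iff) auto
  have "\<epsilon> \<le> 1/2" "\<epsilon> \<le> w" "\<epsilon> \<le> w / (2 * T)" "\<epsilon> \<le> a / (8 * T)" "\<epsilon> \<le> b / (8 * T)"
    "\<epsilon> \<le> a/2" "\<epsilon> \<le> b/2" "\<epsilon> \<le> T"
    unfolding \<epsilon>_def by (rule Min_le; simp)+
  note \<epsilon> = \<epsilon>0 this
  have "\<forall>\<^sub>F n in sequentially. dist (v n) 1 < \<epsilon>" "\<forall>\<^sub>F n in sequentially. dist (d n) 0 < \<epsilon>"
    using tendstoD[OF v(2) \<epsilon>(1)] tendstoD[OF d(1) \<epsilon>(1)] by auto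
  then show ?thesis
  proof eventually_elim
    case (elim n)
    define c s where "c = Re (v n)" and "s = Im (v n)"
    define x0 y0 where "x0 = Re (d n)" and "y0 = Im (d n)"
    have cs: "\<bar>c - 1\<bar> < \<epsilon>" "\<bar>s\<bar> < \<epsilon>" "\<bar>x0\<bar> < \<epsilon>" "\<bar>y0\<bar> < \<epsilon>"
      using elim abs_Re_le_cmod[of "v n - 1"] abs_Im_le_cmod[of "v n - 1"] abs_Re_le_cmod[of "d n"] abs_Im_le_cmod[of "d n"]
      by (auto simp: c_def s_def x0_def y0_def dist_norm)
    have c1: "1/2 \<le> c" "c \<le> 1" using cs(1) \<epsilon>(2) abs_Re_le_cmod[of "v n"] v(1)[of n] by (auto simp: c_def)
    have sT: "\<bar>s\<bar> * T < w/2" "\<bar>s\<bar> * T < a/8" "\<bar>s\<bar> * T < b/8"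
    proof -
      have "\<bar>s\<bar> < w / (2 * T)" "\<bar>s\<bar> < a / (8 * T)" "\<bar>s\<bar> < b / (8 * T)" using cs(2) \<epsilon>(4-6) by linarith+
      then show "\<bar>s\<bar> * T < w/2" "\<bar>s\<bar> * T < a/8" "\<bar>s\<bar> * T < b/8" using T(1) by (auto simp: field_simps)
    qed
    define H where "H = half_strip (-w) (-w) w"
    \<comment> \<open>The ray's half-strip of half-width \<open>w\<close>, drawn in the coordinates
      of the limit strip: its axis starts near 0 and is tilted by the angle of
      \<open>v n\<close>.\<close>
    define V where "V = {y. cnj (v n) * (y - d n) \<in> H}"
    have Vz: "Re (cnj (v n) * (z - d n)) = c * (Re z - x0) + s * (Im z - y0)"
      "Im (cnj (v n) * (z - d n)) = c * (Im z - y0) - s * (Re z - x0)" for z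
      by (simp_all add: c_def s_def x0_def y0_def algebra_simps)
    have memV: "z \<in> V \<longleftrightarrow> - w < c * (Re z - x0) + s * (Im z - y0) \<and> \<bar>c * (Im z - y0) - s * (Re z - x0)\<bar> < w" for z
      unfolding V_def H_def half_strip_def mem_Collect_eq Vz by auto
    have 0: "cnj (v n) * (0 - d n) \<in> H"
    proof -
      have "cmod (cnj (v n) * (0 - d n)) < w" using elim v(1)[of n] \<epsilon>(3) by (simp add: norm_mult)
      then show ?thesis using abs_Re_le_cmod[of "cnj (v n) * (0 - d n)"] abs_Im_le_cmod[of "cnj (v n) * (0 - d n)"]
        unfolding H_def half_strip_def by auto
    qed
    have 00: "0 \<in> V" unfolding V_def using 0 by simp
    have gH: "germ_extends H (\<lambda>z. F (of_real (t n) + z))"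
    proof (rule germ_extendsI[where e = 1])
      show "imm U H (\<lambda>z. F (of_real (t n) + z))"
        unfolding H_def by (rule imm_subset[OF imm_translate[OF F] open_strips(2)])
          (use t(2)[of n] in \<open>auto simp: half_strip_def\<close>)
    qed auto
    have "convex H" "0 \<in> H" using w by (simp_all add: H_def) (simp add: half_strip_def)
    note V = germ_at_return[OF gH this 0, folded V_def]
    have SV: "germ_extends (strip (-a) b \<union> V) \<phi>"
      by (rule germ_extends_Un[OF germ_extends_strip V(1) convex_strips(3) V(2) _ 00]) (use ab_pos in \<open>auto simp: strip_def\<close>)
    \<comment> \<open>At abscissa \<open>X\<close> the tilted axis reaches the border height
      \<open>y1\<close>. Within \<open>T\<close> of \<open>X\<close> the tilt contributes less than
      \<open>w/2\<close> to the distance from the axis, so points less than \<open>w/2\<close>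
      beyond the border remain in the tilted strip.\<close>
    have inV: "z \<in> V" if z: "s \<noteq> 0" "\<bar>h\<bar> < w/2" "X = x0 + (y1 - y0) * c / s" "\<bar>Re z - X\<bar> < T" "Im z = y1 + h"
      "\<bar>s\<bar> * T \<le> (y1 - y0) * c * sgn s" "s * (Im z - y0) > 0" for z X h y1
    proof -
      have sX: "s * (X - x0) = (y1 - y0) * c" using z(1,3) by simp
      have "\<bar>s * (Re z - X)\<bar> < w/2"
      proof -
        have "\<bar>s\<bar> * \<bar>Re z - X\<bar> \<le> \<bar>s\<bar> * T" using z(4) by (intro mult_left_mono) auto
        then show ?thesis using sT(1) by (simp add: abs_mult)
      qed
      moreover have "\<bar>c * h\<bar> < w/2"
      proof -
        have "\<bar>c\<bar> * \<bar>h\<bar> \<le> 1 * \<bar>h\<bar>" using c1 by (intro mult_right_mono) auto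
        then show ?thesis using z(2) by (simp add: abs_mult)
      qed
      moreover have "c * (Im z - y0) - s * (Re z - x0) = c * h - s * (Re z - X)"
        using sX z(5) by (simp add: algebra_simps)
      ultimately have 1: "\<bar>c * (Im z - y0) - s * (Re z - x0)\<bar> < w" by linarith
      have "X - x0 \<ge> T"
      proof -
        have "X - x0 = (y1 - y0) * c * sgn s / \<bar>s\<bar>" using z(1,3) by (simp add: sgn_if)
        also have "\<dots> \<ge> T" using z(1,6) by (simp add: pos_le_divide_eq mult.commute)
        finally show ?thesis .
      qed
      then have "c * (Re z - x0) \<ge> 0" using z(4) c1 by (intro mult_nonneg_nonneg) linarith+
      then show ?thesis using 1 z(7) w unfolding memV by linarith
    qed
    show "v n = 1"
    proof (rule ccontr)
      assume "v n \<noteq> 1"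
      have "s \<noteq> 0"
      proof
        assume "s = 0"
        then have "c\<^sup>2 = 1" using v(1)[of n] cmod_power2[of "v n"] by (simp add: c_def s_def)
        then have "c = 1" using c1 by (auto simp: power2_eq_1_iff)
        then show False using \<open>s = 0\<close> \<open>v n \<noteq> 1\<close> by (simp add: c_def s_def complex_eq_iff)
      qed
      have Xpos: "x0 + q * c / s \<ge> 0" if "\<bar>s\<bar> * T \<le> q * c * sgn s" for q
      proof -
        have "q * c / s = q * c * sgn s / \<bar>s\<bar>" using \<open>s \<noteq> 0\<close> by (simp add: sgn_if)
        also have "\<dots> \<ge> T" using that \<open>s \<noteq> 0\<close> by (simp add: pos_le_divide_eq mult.commute)
        finally show ?thesis using cs(3) \<epsilon>(9) by linarith
      qed
      show False
      \<comment> \<open>A rising axis meets the upper border, a falling one the lower; either way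
        the crossing has a nonnegative abscissa.\<close>
      proof (cases "s > 0")
        case True
        have "b/8 \<le> (b - y0) * c"
        proof -
          have "b/4 = (b/2) * (1/2)" by simp
          also have "\<dots> \<le> (b - y0) * c" using c1 cs(4) \<epsilon>(8) ab_pos by (intro mult_mono) linarith+
          finally show ?thesis using ab_pos by linarith
        qed
        then have q: "\<bar>s\<bar> * T \<le> (b - y0) * c * sgn s" using sT(3) True by simp
        define X where "X = x0 + (b - y0) * c / s"
        have "rect (X - T1) (X + T1) (-a) (b + w/2) \<subseteq> strip (-a) b \<union> V"
        proof
          fix z assume z: "z \<in> rect (X - T1) (X + T1) (-a) (b + w/2)"
          show "z \<in> strip (-a) b \<union> V"
          proof (cases "Im z < b")
            case True
            then show ?thesis using z by (auto simp: rect_def strip_def)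
          next
            case False
            have "z \<in> V"
              by (rule inV[OF \<open>s \<noteq> 0\<close> _ X_def _ _ q, of "Im z - b"])
                (use z False T True \<open>s > 0\<close> cs(4) \<epsilon>(8) ab_pos in \<open>auto simp: rect_def intro!: mult_pos_pos\<close>)
            then show ?thesis by blast
          qed
        qed
        then show False using T1(2)[OF SV, of X] Xpos[OF q] by (auto simp: X_def)
      next
        case False
        then have s: "s < 0" using \<open>s \<noteq> 0\<close> by linarith
        have "a/8 \<le> (a + y0) * c"
        proof -
          have "a/4 = (a/2) * (1/2)" by simp
          also have "\<dots> \<le> (a + y0) * c" using c1 cs(4) \<epsilon>(7) ab_pos by (intro mult_mono) linarith+
          finally show ?thesis using ab_pos by linarith
        qed
        then have q: "\<bar>s\<bar> * T \<le> (-a - y0) * c * sgn s" using sT(2) s by (simp add: algebra_simps)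
        define X where "X = x0 + (-a - y0) * c / s"
        have "rect (X - T2) (X + T2) (-(a + w/2)) b \<subseteq> strip (-a) b \<union> V"
        proof
          fix z assume z: "z \<in> rect (X - T2) (X + T2) (-(a + w/2)) b"
          show "z \<in> strip (-a) b \<union> V"
          proof (cases "-a < Im z")
            case True
            then show ?thesis using z by (auto simp: rect_def strip_def)
          next
            case False
            have "z \<in> V"
              by (rule inV[OF \<open>s \<noteq> 0\<close> _ X_def _ _ q, of "Im z + a"])
                (use z False T s cs(4) \<epsilon>(7) ab_pos in \<open>auto simp: rect_def intro!: mult_neg_neg\<close>)
            then show ?thesis by blast
          qed
        qed
        then show False using T2(2)[OF SV, of X] Xpos[OF q] by (auto simp: X_def)
      qed
    qed
  qed
qed


text \<open>With no rotation left, the thin strip about the ray and its image run parallel to the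
  limit strip and never leave it. So agreement at time \<open>t n\<close> spreads along the entire
  ray, backwards as well as forwards.\<close>

lemma ray_in_strip:
  assumes G: "imm U (strip (-a) b') G" "e > 0" "\<And>z. z \<in> ball 0 e \<Longrightarrow> G z = \<phi> z" and b': "b \<le> b'"
    and n: "v n = 1" "cmod (d n) < \<delta>" "2 * \<delta> < a" "2 * \<delta> < b" "\<delta> < w" "2 * \<delta> < r"
    and z: "z \<in> half_strip (-w) (-w) w" "\<bar>Im z\<bar> < \<delta>"
  shows "F z = G (z - of_real (t n) + d n)"
proof -
  have \<delta>: "\<delta> > 0" using n(2) norm_ge_zero[of "d n"] by linarith
  have bsub: "ball 0 (2 * \<delta>) \<subseteq> strip (-a) b'"
  proof
    fix z :: complex assume "z \<in> ball 0 (2 * \<delta>)"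
    then have "\<bar>Im z\<bar> < 2 * \<delta>" using mem_ball_complexD[of z 0] by simp
    then have "-a < Im z" "Im z < b'" using n(3,4) b' by linarith+
    then show "z \<in> strip (-a) b'" by (simp add: strip_def)
  qed
  have G\<phi>: "G z = \<phi> z" if "z \<in> ball 0 (2 * \<delta>)" for z
  proof (rule imm_agree[of "ball 0 (2*\<delta>)" G "ball 0 (2*\<delta>)" \<phi> 0 e z])
    show "imm U (ball 0 (2 * \<delta>)) G" by (rule imm_subset[OF G(1) _ bsub]) simp
    show "imm U (ball 0 (2 * \<delta>)) \<phi>" by (rule imm_subset[OF \<phi>]) (use n(6) in auto)
  qed (use that \<delta> G in auto)
  obtain e1 where e1: "e1 > 0" "\<And>z. z \<in> ball 0 e1 \<Longrightarrow> F (of_real (t n) + z) = \<phi> (mot False (v n) (d n) z)"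
    using return[of n] by blast
  define C where "C = half_strip (-w) (-\<delta>) \<delta>"
  have C1: "C \<subseteq> half_strip (-w) (-w) w" using n(5) by (auto simp: C_def half_strip_def)
  have C2: "C \<subseteq> {z. (d n - of_real (t n)) + z \<in> strip (-a) b'}"
  proof
    fix z assume "z \<in> C"
    then have "\<bar>Im z\<bar> < \<delta>" by (auto simp: C_def half_strip_def)
    moreover have "\<bar>Im (d n)\<bar> < \<delta>" using abs_Im_le_cmod[of "d n"] n(2) by linarith
    ultimately have "-a < Im (d n) + Im z" "Im (d n) + Im z < b'" using n(3,4) b' by linarith+
    then show "z \<in> {z. (d n - of_real (t n)) + z \<in> strip (-a) b'}" by (simp add: strip_def)
  qed
  have oC: "open C" "convex C" by (auto simp: C_def)
  have "F z = G ((d n - of_real (t n)) + z)"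
  proof (rule imm_agree[of C F C "\<lambda>z. G ((d n - of_real (t n)) + z)" "of_real (t n)" "min e1 \<delta>" z])
    show "imm U C F" by (rule imm_subset[OF F oC(1) C1])
    show "imm U C (\<lambda>z. G ((d n - of_real (t n)) + z))" by (rule imm_subset[OF imm_translate[OF G(1)] oC(1) C2])
    fix z :: complex assume z: "z \<in> ball (of_real (t n)) (min e1 \<delta>)"
    define y where "y = z - of_real (t n)"
    have y: "cmod y < e1" "cmod y < \<delta>" using z by (auto simp: y_def dist_norm norm_minus_commute)
    have "cmod (y + d n) < 2 * \<delta>" using norm_triangle_ineq[of y "d n"] y n(2) by linarith
    then have "G (y + d n) = \<phi> (y + d n)" by (intro G\<phi>) simp
    moreover have "F (of_real (t n) + y) = \<phi> (y + d n)" using e1(2)[of y] y n(1) by (simp add: mot_def)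
    ultimately show "F z = G ((d n - of_real (t n)) + z)" by (simp add: y_def algebra_simps)
  qed (use oC e1(1) \<delta> z t(2)[of n] w in \<open>auto simp: C_def half_strip_def\<close>)
  then show ?thesis by (simp add: algebra_simps)
qed

text \<open>Each parallel return places the same ray in the limit strip, and the difference \<tau>
  of two placements is a symmetry of the continued germ. The set \<open>Bs\<close> fixes the lower
  edge and lets only the upper one vary; its supremum rules out drifts of any size.\<close>

lemma ray_periodic: "\<exists>P>0. \<forall>x\<ge>0. F (of_real (x + P)) = F (of_real x)"
proof -
  define \<delta> where "\<delta> = Min {a/4, b/4, w/2, r/4, 1/4}"
  have \<delta>0: "\<delta> > 0" unfolding \<delta>_def using ab_pos w r by (subst Min_gr_iff) auto
  have "\<delta> \<le> a/4" "\<delta> \<le> b/4" "\<delta> \<le> w/2" "\<delta> \<le> r/4" "\<delta> \<le> 1/4" unfolding \<delta>_def by (rule Min_le; simp)+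
  then have \<delta>: "2 * \<delta> < a" "2 * \<delta> < b" "\<delta> < w" "2 * \<delta> < r" "\<delta> \<le> 1/4" "4 * \<delta> \<le> a" "4 * \<delta> \<le> b" using ab_pos w r by linarith+
  have "\<forall>\<^sub>F n in sequentially. v n = 1 \<and> cmod (d n) < \<delta>"
    using eventually_parallel tendstoD[OF d(1) \<delta>0] by (intro eventually_conj) auto
  then obtain N where N: "\<And>n. n \<ge> N \<Longrightarrow> v n = 1" "\<And>n. n \<ge> N \<Longrightarrow> cmod (d n) < \<delta>"
    unfolding eventually_sequentially by blast
  define Bs where "Bs = {b'. b \<le> b' \<and> germ_extends (strip (-a) b') \<phi>}"
  have bBs: "b \<in> Bs" using germ_extends_strip by (simp add: Bs_def)
  have "b' \<le> 2 * B" if "b' \<in> Bs" for b'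
  proof -
    have "rect (-(a+b')) (a+b') (-a) b' \<subseteq> strip (-a) b'" by (auto simp: rect_def strip_def)
    then show ?thesis using strip_height_bound[of "strip (-a) b'" \<phi> a b'] that ab_pos by (simp add: Bs_def)
  qed
  then have bdd: "bdd_above Bs" by (rule bdd_aboveI)
  define \<tau> where "\<tau> m n = (d m - of_real (t m)) - (d n - of_real (t n))" for m n
  have sym: "G y = G (y + \<tau> m n)" if mn: "m \<ge> N" "n \<ge> N" and b': "b \<le> b'"
     and G: "imm U (strip (-a) b') G" "e > 0" "\<And>z. z \<in> ball 0 e \<Longrightarrow> G z = \<phi> z"
     and y: "y \<in> ball (d n - of_real (t n)) \<delta>" for m n b' G e and y :: complex
  proof -
    define z where "z = y - (d n - of_real (t n))"
    have z: "cmod z < \<delta>" using y by (simp add: z_def dist_norm norm_minus_commute)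
    then have z': "\<bar>Re z\<bar> < \<delta>" "\<bar>Im z\<bar> < \<delta>" using abs_Re_le_cmod[of z] abs_Im_le_cmod[of z] by linarith+
    then have zh: "z \<in> half_strip (-w) (-w) w" using \<delta>(3) by (auto simp: half_strip_def)
    have "G (z - of_real (t n) + d n) = F z" "G (z - of_real (t m) + d m) = F z"
      using ray_in_strip[OF G b' N(1,2)[OF mn(2)] \<delta>(1-4) zh z'(2)]
        ray_in_strip[OF G b' N(1,2)[OF mn(1)] \<delta>(1-4) zh z'(2)] by simp_all
    moreover have "z - of_real (t n) + d n = y" "z - of_real (t m) + d m = y + \<tau> m n"
      by (simp_all add: z_def \<tau>_def)
    ultimately show ?thesis by simp
  qed
  have Imd: "\<bar>Im (d n)\<bar> < \<delta>" if "n \<ge> N" for n using abs_Im_le_cmod[of "d n"] N(2)[OF that] by linarith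
  \<comment> \<open>Start from an upper edge within \<open>h\<close> of the supremum. The copy of
    the strip raised by the symmetry agrees with it on the overlap, and their union has its upper
    edge above the supremum. Exchanging the two returns then excludes a descent too.\<close>
  have no_rise: "\<not> Im (d m) > Im (d n)" if mn: "m \<ge> N" "n \<ge> N" for m n
  proof
    assume "Im (d m) > Im (d n)"
    define h where "h = Im (d m) - Im (d n)"
    have h: "h > 0" "h < 2 * \<delta>" using \<open>Im (d m) > Im (d n)\<close> Imd[OF mn(1)] Imd[OF mn(2)] by (auto simp: h_def)
    have "Bs \<noteq> {}" using bBs by blast
    then have "\<exists>b'\<in>Bs. Sup Bs - h < b'"
      using less_cSup_iff[OF _ bdd, of "Sup Bs - h"] h(1) by simp
    then obtain b' where b': "b' \<in> Bs" "Sup Bs - h < b'" by blast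
    then have bb': "b \<le> b'" by (simp add: Bs_def)
    obtain G e where G: "imm U (strip (-a) b') G" "e > 0" "\<And>z. z \<in> ball 0 e \<Longrightarrow> G z = \<phi> z"
      using b' unfolding Bs_def germ_extends_def by blast
    define V where "V = strip (-a + h) (b' + h)"
    have Im\<tau>: "Im (\<tau> m n) = h" by (simp add: \<tau>_def h_def)
    have V: "V = {z. - \<tau> m n + z \<in> strip (-a) b'}" using Im\<tau> by (auto simp: V_def strip_def)
    have GV: "imm U V (\<lambda>z. G (- \<tau> m n + z))" unfolding V by (rule imm_translate[OF G(1)])
    define y1 where "y1 = d m - of_real (t m)"
    have y1: "y1 \<in> V" "y1 \<in> strip (-a) b'"
      using Imd[OF mn(1)] Imd[OF mn(2)] \<delta>(1,2) h \<delta> bb' by (auto simp: V_def y1_def strip_def)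
    have agree: "G z = G (- \<tau> m n + z)" if "z \<in> strip (-a) b'" "z \<in> V" for z
    proof (rule imm_agree[OF G(1) GV _ _ y1(2,1) \<delta>0 _ that])
      fix z assume "z \<in> ball y1 \<delta>"
      then have "z - \<tau> m n \<in> ball (d n - of_real (t n)) \<delta>"
        by (simp add: y1_def \<tau>_def dist_norm algebra_simps)
      from sym[OF mn bb' G this] show "G z = G (- \<tau> m n + z)" by (simp add: add.commute)
    qed (auto simp: V_def)
    obtain H where H: "imm U (strip (-a) b' \<union> V) H" "\<And>z. z \<in> strip (-a) b' \<Longrightarrow> H z = G z"
    proof (rule imm_Un[OF G(1) GV])
      show "G z = G (- \<tau> m n + z)" if "z \<in> strip (-a) b'" "z \<in> V" for z by (rule agree[OF that])
    qed blast
    have "strip (-a) (b' + h) \<subseteq> strip (-a) b' \<union> V"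
      using h \<delta> bb' ab_pos by (auto simp: strip_def V_def)
    then have HI: "imm U (strip (-a) (b' + h)) H" using imm_subset[OF H(1)] by blast
    have "germ_extends (strip (-a) (b' + h)) \<phi>"
    proof (rule germ_extendsI[OF HI, of "min e \<delta>"])
      fix z :: complex assume z: "z \<in> ball 0 (min e \<delta>)"
      then have "\<bar>Im z\<bar> < \<delta>" using mem_ball_complexD[of z 0] by auto
      then have "z \<in> strip (-a) b'" using \<delta> bb' \<delta>0 by (auto simp: strip_def)
      then show "H z = \<phi> z" using H(2) G(3) z by simp
    qed (use G \<delta>0 in auto)
    then have "b' + h \<in> Bs" using bb' h by (simp add: Bs_def)
    then have "b' + h \<le> Sup Bs" by (rule cSup_upper[OF _ bdd])
    then show False using b'(2) by linarith
  qed
  obtain G e where G: "imm U (strip (-a) b) G" "e > 0" "\<And>z. z \<in> ball 0 e \<Longrightarrow> G z = \<phi> z"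
    using germ_extends_strip unfolding germ_extends_def by blast
  \<comment> \<open>The offsets \<open>d m\<close> and \<open>d N\<close> change the time difference
    by less than 1/2 together, so a gap above 1 leaves a positive period.\<close>
  have "\<forall>\<^sub>F n in sequentially. t n > t N + 1" using t(1) by (simp add: filterlim_at_top_dense)
  then have "\<forall>\<^sub>F n in sequentially. t n > t N + 1 \<and> n \<ge> N"
    by (intro eventually_conj eventually_ge_at_top)
  then obtain m where m: "m \<ge> N" "t m > t N + 1" unfolding eventually_sequentially by blast
  have "Im (\<tau> m N) = 0" using no_rise[OF m(1) order_refl] no_rise[OF order_refl m(1)] by (simp add: \<tau>_def)
  moreover define P where "P = - Re (\<tau> m N)"
  ultimately have \<tau>: "\<tau> m N = - of_real P" by (simp add: complex_eq_iff)
  have "P > 0"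
    using m(2) N(2)[OF m(1)] N(2)[OF order_refl] \<delta>(5) abs_Re_le_cmod[of "d m"] abs_Re_le_cmod[of "d N"]
    by (simp add: P_def \<tau>_def)
  have Imb: "-a < Im (d N)" "Im (d N) < b" using Imd[OF order_refl] \<delta>(6,7) \<delta>0 by linarith+
  have period: "G y = G (y - of_real P)" if y: "y \<in> strip (-a) b" for y
  proof -
    have S: "{z. - of_real P + z \<in> strip (-a) b} = strip (-a) b" by (simp add: strip_def)
    have GP: "imm U (strip (-a) b) (\<lambda>z. G (- of_real P + z))"
      using imm_translate[OF G(1), of "- of_real P"] unfolding S .
    have base: "d N - of_real (t N) \<in> strip (-a) b" using Imb by (simp add: strip_def)
    have "G y = G (- of_real P + y)"
    proof (rule imm_agree[OF G(1) GP convex_strips(3) convex_strips(3) base base \<delta>0 _ y y])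
      fix z assume "z \<in> ball (d N - of_real (t N)) \<delta>"
      from sym[OF m(1) order_refl order_refl G this] show "G z = G (- of_real P + z)" by (simp add: \<tau> add.commute)
    qed
    then show ?thesis by (simp add: add.commute)
  qed
  have "F (of_real (x + P)) = F (of_real x)" if "x \<ge> 0" for x
  proof -
    have *: "F (of_real y) = G (of_real y - of_real (t N) + d N)" if "y \<ge> 0" for y
      by (rule ray_in_strip[OF G order_refl N(1,2)[OF order_refl] \<delta>(1-4)]) (use that w \<delta>0 in \<open>auto simp: half_strip_def\<close>)
    have "of_real (x + P) - of_real (t N) + d N \<in> strip (-a) b"
      using Imb by (simp add: strip_def)
    from period[OF this] show ?thesis
      using *[of x] *[of "x + P"] that \<open>P > 0\<close> by (simp add: algebra_simps)
  qed
  then show ?thesis using \<open>P > 0\<close> by blast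
qed

end

lemma (in flat_half_strip) half_strip_periodic: "\<exists>P>0. \<forall>x\<ge>0. F (of_real (x + P)) = F (of_real x)"
proof -
  obtain a b where ab: "achievable a b" "\<And>a' b'. achievable a' b' \<Longrightarrow> a' + b' < a + b + w/4"
    using almost_maximal_achievable[of "w/4"] w by auto
  show ?thesis
  proof (rule limit_germ[OF ab(1)])
    fix t :: "nat \<Rightarrow> real" and \<phi> r v d
    assume *: "filterlim t at_top sequentially"
      "r > 0" "imm U (ball 0 r) \<phi>" "\<And>n. cmod (v n) = 1" "v \<longlonglongrightarrow> 1" "d \<longlonglongrightarrow> 0"
      "\<And>n. d n \<in> ball 0 r" "\<And>n. t n \<ge> 0"
      "\<And>n. \<exists>e>0. \<forall>z\<in>ball 0 e. F (of_real (t n) + z) = \<phi> (mot False (v n) (d n) z)"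
      "\<And>T. \<forall>\<^sub>F n in sequentially. germ_extends (rect (-T) T (-a) b) (\<lambda>z. F (of_real (t n) + z))"
    interpret return_germ U F w B K s a b r t \<phi> v d
      by unfold_locales (fact ab *)+
    show ?thesis by (rule ray_periodic)
  qed
qed

section \<open>Periodicity of geodesics away from the singularities\<close>

lemma (in flat_region) avoiding_ray_periodic:
  assumes cpt: "compact (UNIV :: 'a set)" and mid: "\<And>x y::'a. \<exists>m. dist x m = dist x y / 2 \<and> dist m y = dist x y / 2"
    and s: "s \<notin> U" and K: "compact K" "K \<subseteq> U"
    and g: "local_isometry_on {0..} g" "\<And>t. t \<ge> 0 \<Longrightarrow> g t \<in> K"
  obtains P where "P > 0" "\<And>t. t \<ge> 0 \<Longrightarrow> g (t + P) = g t"
proof -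
  obtain r where r: "r > 0" "\<And>p. p \<in> K \<Longrightarrow> \<exists>\<psi>. isochart U r p \<psi>"
    using uniform_isochart[OF open_U _ K] flat_U by blast
  obtain F where Fg: "imm U (half_strip (-r/4) (-r/4) (r/4)) F" "\<And>t. t \<ge> 0 \<Longrightarrow> F (of_real t) = g t"
    by (rule ray_strip[OF g(1) r(1) r(2)[OF g(2)]]) (assumption | rule that)+
  have "\<And>x y::'a. dist x y \<le> diameter (UNIV :: 'a set)"
    using diameter_bounded_bound[OF compact_imp_bounded[OF cpt]] by simp
  then interpret flat_half_strip U F "r/4" "diameter (UNIV :: 'a set)" K s
    by unfold_locales (use Fg r(1) K g(2) mid s in auto)
  obtain P where P: "P > 0" "\<And>x. x \<ge> 0 \<Longrightarrow> F (of_real (x + P)) = F (of_real x)"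
    using half_strip_periodic by blast
  have "g (t + P) = g t" if "t \<ge> 0" for t
    using P(2)[OF that] Fg(2)[of t] Fg(2)[of "t + P"] P(1) that by simp
  then show thesis using P(1) that by blast
qed

text \<open>For a geodesic on the whole line the forward half is periodic, so \<open>g\<close> and
  its shift by \<open>P\<close> are local isometries that agree near parameter 1, hence everywhere.
  Radius 1 about parameter 1 involves nonnegative times only.\<close>

lemma (in flat_region) avoiding_geodesic_periodic:
  assumes cpt: "compact (UNIV :: 'a set)" and mid: "\<And>x y::'a. \<exists>m. dist x m = dist x y / 2 \<and> dist m y = dist x y / 2"
    and s: "s \<notin> U" and K: "compact K" "K \<subseteq> U"
    and D: "D = UNIV \<or> D = {0..}" and g: "local_isometry_on D g" "\<And>t. t \<in> D \<Longrightarrow> g t \<in> K"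
  shows "periodic_on D g"
proof -
  have sub: "{0..} \<subseteq> D" using D by auto
  obtain P where P: "P > 0" "\<And>t. t \<ge> 0 \<Longrightarrow> g (t + P) = g t"
    using avoiding_ray_periodic[OF cpt mid s K local_isometry_on_subset[OF g(1) sub]] g(2) sub by auto
  have "g t = g (t + P)" if "t \<in> D" for t
  proof (rule local_isometry_unique[OF g(1), where h = "\<lambda>t. g (t + P)" and ?x0.0 = 1 and d = 1])
    show "local_isometry_on D (\<lambda>t. g (t + P))"
      unfolding local_isometry_on_def
    proof
      fix t assume "t \<in> D"
      then have "t + P \<in> D" using D P by auto
      then obtain e where e: "e > 0" "\<forall>u\<in>D. \<forall>v\<in>D. \<bar>u - (t + P)\<bar> < e \<longrightarrow> \<bar>v - (t + P)\<bar> < e \<longrightarrow> dist (g u) (g v) = \<bar>u - v\<bar>"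
        using g(1) unfolding local_isometry_on_def by blast
      have DP: "u + P \<in> D" if "u \<in> D" for u using that D P by auto
      show "\<exists>\<epsilon>>0. \<forall>u\<in>D. \<forall>v\<in>D. \<bar>u - t\<bar> < \<epsilon> \<longrightarrow> \<bar>v - t\<bar> < \<epsilon> \<longrightarrow> dist (g (u + P)) (g (v + P)) = \<bar>u - v\<bar>"
        by (rule exI[of _ e]) (use e DP in fastforce)
    qed
    show "convex D" using D by auto
    show "\<exists>y\<in>D. x < y \<and> y < x + \<delta>" if "x \<in> D" "\<delta> > 0" for x \<delta>
      using that D by (intro bexI[of _ "x + \<delta>/2"]) auto
  qed (use that g(2) K(2) P sub in auto)
  then show ?thesis using P(1) unfolding periodic_on_def by metis
qed

lemma compact_far_from_finite:
  assumes "compact (UNIV :: 'a::metric_space set)" "finite S"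
  shows "compact {p::'a. \<forall>s\<in>S. \<epsilon> \<le> dist p s}"
proof -
  have "{p. \<forall>s\<in>S. \<epsilon> \<le> dist p s} = (\<Inter>s\<in>S. {p. \<epsilon> \<le> dist p s})" by auto
  moreover have "closed {p. \<epsilon> \<le> dist p s}" for s :: 'a
    by (intro closed_Collect_le continuous_intros)
  ultimately have "closed {p. \<forall>s\<in>S. \<epsilon> \<le> dist p s}" by auto
  then show ?thesis using compact_Int_closed[OF assms(1)] by fastforce
qed

theorem avoiding_singularities_imp_periodic:
  fixes Sing :: "'a::metric_space set"
  assumes cpt: "compact (UNIV :: 'a set)" and surf: "euclidean_cone_surface Sing \<theta>" and ne: "Sing \<noteq> {}"
    and D: "D = UNIV \<or> D = {0..}" and g: "local_isometry_on D g"
    and \<epsilon>: "\<epsilon> > 0" "\<And>t s. t \<in> D \<Longrightarrow> s \<in> Sing \<Longrightarrow> \<epsilon> \<le> dist (g t) s"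
  shows "periodic_on D g"
proof -
  have fin: "finite Sing" using surf by (simp add: euclidean_cone_surface_def)
  interpret flat_region "- Sing"
    by unfold_locales (use surf finite_imp_closed in \<open>auto simp: euclidean_cone_surface_def\<close>)
  obtain s where s: "s \<notin> - Sing" using ne by auto
  define K where "K = {p. \<forall>s\<in>Sing. \<epsilon> \<le> dist p s}"
  have K: "compact K" "K \<subseteq> - Sing"
    using compact_far_from_finite[OF cpt fin] \<epsilon>(1) unfolding K_def by auto
  show ?thesis
    by (rule avoiding_geodesic_periodic[OF cpt _ s K D g])
      (use surf \<epsilon> in \<open>auto simp: K_def euclidean_cone_surface_def\<close>)
qed

section \<open>First homology of flat surfaces\<close>

text \<open>Singular simplices are extensional, hence \<open>restrict\<close>; the barycentric
  coordinate \<open>x 1\<close> plays the role of time.\<close>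

definition path_simplex :: "(real \<Rightarrow> 'b) \<Rightarrow> (nat \<Rightarrow> real) \<Rightarrow> 'b" where
  "path_simplex h = restrict (\<lambda>x. h (x 1)) (standard_simplex 1)"

definition point_simplex :: "'b \<Rightarrow> (nat \<Rightarrow> real) \<Rightarrow> 'b" where
  "point_simplex a = restrict (\<lambda>x. a) (standard_simplex 0)"

lemma standard_simplex_1D: "x \<in> standard_simplex 1 \<Longrightarrow> 0 \<le> x 1 \<and> x 1 \<le> 1 \<and> x 0 = 1 - x 1 \<and> (\<forall>i>1. x i = 0)"
  by (auto simp: standard_simplex_def)

lemma singular_simplex_path_simplex:
  fixes h :: "real \<Rightarrow> 'b::topological_space"
  assumes "continuous_on {0..1} h"
  shows "singular_simplex 1 euclidean (path_simplex h)"
proof -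
  have 1: "continuous_map (subtopology (powertop_real UNIV) (standard_simplex 1)) (top_of_set {0..1}) (\<lambda>x. x 1)"
    using standard_simplex_1D
    by (auto simp: continuous_map_in_subtopology intro!: continuous_map_from_subtopology continuous_map_product_projection)
  have 2: "continuous_map (top_of_set {0..1}) euclidean h" using assms by simp
  have "continuous_map (subtopology (powertop_real UNIV) (standard_simplex 1)) euclidean (h \<circ> (\<lambda>x. x 1))"
    by (rule continuous_map_compose[OF 1 2])
  then have "continuous_map (subtopology (powertop_real UNIV) (standard_simplex 1)) euclidean (path_simplex h)"
    by (rule continuous_map_eq) (auto simp: path_simplex_def)
  then show ?thesis by (simp add: singular_simplex_def path_simplex_def)
qed

lemma singular_simplex_1_cases:
  fixes s :: "(nat \<Rightarrow> real) \<Rightarrow> 'b::topological_space"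
  assumes "singular_simplex 1 euclidean s"
  obtains h where "continuous_on {0..1} h" "s = path_simplex h"
proof -
  define e where "e t = (\<lambda>i::nat. if i = 0 then 1 - t else if i = 1 then t else (0::real))" for t
  have e: "e t \<in> standard_simplex 1" if "t \<in> {0..1}" for t
    using that by (auto simp: standard_simplex_def e_def)
  have "continuous_map (top_of_set {0..1}) (powertop_real UNIV) e"
    unfolding continuous_map_componentwise_UNIV
  proof
    fix i
    have "continuous_on {0..1} (\<lambda>t. e t i)" unfolding e_def by (cases "i = 0"; cases "i = 1") (auto intro!: continuous_intros)
    then show "continuous_map (top_of_set {0..1}) euclideanreal (\<lambda>t. e t i)" by simp
  qed
  then have 1: "continuous_map (top_of_set {0..1}) (subtopology (powertop_real UNIV) (standard_simplex 1)) e"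
    using e by (auto simp: continuous_map_in_subtopology)
  have s: "continuous_map (subtopology (powertop_real UNIV) (standard_simplex 1)) euclidean s" "s \<in> extensional (standard_simplex 1)"
    using assms by (auto simp: singular_simplex_def)
  have "continuous_on {0..1} (s \<circ> e)" using continuous_map_compose[OF 1 s(1)] by simp
  moreover have "s = path_simplex (s \<circ> e)"
  proof
    fix x show "s x = path_simplex (s \<circ> e) x"
    proof (cases "x \<in> standard_simplex 1")
      case True
      have "e (x 1) = x" using standard_simplex_1D[OF True] by (auto simp: e_def fun_eq_iff)
      then show ?thesis using True by (simp add: path_simplex_def)
    next
      case False
      then show ?thesis using s(2) by (simp add: path_simplex_def extensional_def)
    qed
  qed
  ultimately show thesis using that by blast
qed

text \<open>Face 0 drops the vertex at time 0, so the end point carries the plus sign.\<close>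

lemma chain_boundary_path_simplex:
  "chain_boundary 1 (frag_of (path_simplex h)) = frag_of (point_simplex (h 1)) - frag_of (point_simplex (h 0))"
proof -
  have "singular_face 1 0 (path_simplex h) = point_simplex (h 1)" "singular_face 1 1 (path_simplex h) = point_simplex (h 0)"
    using simplical_face_in_standard_simplex[of 1 0] simplical_face_in_standard_simplex[of 1 1]
    by (auto simp: singular_face_def path_simplex_def point_simplex_def fun_eq_iff simplical_face_def standard_simplex_0)
  then show ?thesis by (simp add: chain_boundary_of numeral_2_eq_2)
qed

lemma simplex_map_path_simplex: "simplex_map 1 f (path_simplex h) = path_simplex (f \<circ> h)"
  by (auto simp: simplex_map_def path_simplex_def fun_eq_iff)

lemma path_simplex_cong: "(\<And>t. t \<in> {0..1} \<Longrightarrow> h t = k t) \<Longrightarrow> path_simplex h = path_simplex k"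
  using standard_simplex_1D by (fastforce simp: path_simplex_def fun_eq_iff)

text \<open>The plane is contractible, and in degree 1 reduced and ordinary homology are the
  same.\<close>

lemma complex_1_cycle_imp_boundary:
  assumes "singular_chain 1 euclidean c" "chain_boundary 1 c = 0"
  shows "singular_relboundary 1 (euclidean :: complex topology) {} c"
proof -
  have "contractible (UNIV :: complex set)" by (simp add: convex_imp_contractible)
  then have "contractible_space (euclidean :: complex topology)"
    using contractible_space_top_of_set[of "UNIV :: complex set"] by simp
  then have "trivial_group (reduced_homology_group 1 (euclidean :: complex topology))"
    by (rule trivial_reduced_homology_group_contractible_space)
  then have "trivial_group (homology_group (int 1) (euclidean :: complex topology))"
    by (simp add: un_reduced_homology_group)
  then have "carrier (homology_group (int 1) (euclidean :: complex topology)) = {singular_relboundary_set 1 euclidean {}}"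
    unfolding trivial_group_def one_relative_homology_group by (rule conjunct2)
  moreover have "homologous_rel_set 1 euclidean {} c \<in> carrier (homology_group (int 1) (euclidean :: complex topology))"
    unfolding carrier_relative_homology_group using assms by (simp add: singular_cycle)
  ultimately have "homologous_rel_set 1 euclidean {} c = singular_relboundary_set 1 euclidean {}"
    by (simp only: singleton_iff)
  then show ?thesis by (simp add: homologous_rel_set_eq_relboundary)
qed

definition segment_chain :: "complex \<Rightarrow> complex \<Rightarrow> complex chain" where
  "segment_chain z w = frag_of (path_simplex (linepath z w))"

lemma singular_chain_path: "continuous_on {0..1} h \<Longrightarrow> singular_chain 1 euclidean (frag_of (path_simplex h))"
  using singular_simplex_path_simplex by (simp only: singular_chain_of)

lemma singular_chain_segment: "singular_chain 1 euclidean (segment_chain z w)"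
  unfolding segment_chain_def by (rule singular_chain_path) (rule continuous_on_linepath)

lemma chain_boundary_segment:
  "chain_boundary 1 (segment_chain z w) = frag_of (point_simplex w) - frag_of (point_simplex z)"
  unfolding segment_chain_def chain_boundary_path_simplex by (simp add: linepath_0' linepath_1')

text \<open>Replaces explicit homotopies: a homology between projected chains follows from comparing
  boundaries in the plane.\<close>

lemma chain_map_homologous_complex:
  fixes P :: "complex \<Rightarrow> 'a::topological_space"
  assumes "continuous_on UNIV P" "singular_chain 1 euclidean c" "singular_chain 1 euclidean d"
    "chain_boundary 1 c = chain_boundary 1 d"
  shows "homologous_rel 1 euclidean {} (chain_map 1 P c) (chain_map 1 P d)"
proof -
  have "singular_relboundary 1 euclidean {} (c - d)"
    by (rule complex_1_cycle_imp_boundary) (use assms in \<open>simp_all add: singular_chain_diff chain_boundary_diff\<close>)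
  then have "singular_relboundary 1 euclidean {} (chain_map 1 P (c - d))"
    by (rule singular_relboundary_chain_map) (use assms in auto)
  then show ?thesis by (simp add: homologous_rel_def chain_map_diff)
qed

lemma mot_linepath: "mot k u c (linepath z w t) = linepath (mot k u c z) (mot k u c w) t"
  by (auto simp: mot_def linepath_def algebra_simps scaleR_conv_of_real)

text \<open>Pigeonhole: the number of coefficient vectors with entries up to \<open>N\<close> grows
  like the fourth power of \<open>N\<close>, the number of plane cells they can reach only like the
  square. Two combinations in one cell differ by less than \<open>r\<close>, so by 0.\<close>

lemma integer_relation_of_discrete:
  fixes v :: "nat \<Rightarrow> complex"
  assumes r: "r > 0"
    and discrete: "\<And>k::nat \<Rightarrow> int. cmod (\<Sum>i<4. of_int (k i) * v i) < r \<Longrightarrow> (\<Sum>i<4. of_int (k i) * v i) = 0"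
  obtains k :: "nat \<Rightarrow> int" and j where "j < 4" "k j \<noteq> 0" "(\<Sum>i<4. of_int (k i) * v i) = 0"
proof -
  define V where "V = (\<Sum>i<4. cmod (v i))"
  have V0: "V \<ge> 0" by (simp add: V_def sum_nonneg)
  obtain C :: nat where C: "2 * V / r \<le> real C" using real_arch_simple by blast
  \<comment> \<open>Each axis meets at most \<open>2 * N * C + 3\<close> cells of side
    \<open>r/2\<close>; with \<open>N = 2 * C + 4\<close> this is below the square of
    \<open>N + 1\<close>.\<close>
  define N where "N = 2 * C + 4"
  define M where "M = int (N * C + 1)"
  define T where "T = (\<Pi>\<^sub>E i\<in>{..<4::nat}. {..N})"
  define S where "S n = (\<Sum>i<4. of_nat (n i) * v i)" for n :: "nat \<Rightarrow> nat"
  define cell where "cell n = (\<lfloor>Re (S n) / (r/2)\<rfloor>, \<lfloor>Im (S n) / (r/2)\<rfloor>)" for n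
  have bound: "cmod (S n) \<le> real N * V" if "n \<in> T" for n
  proof -
    have "cmod (S n) \<le> (\<Sum>i<4. cmod (of_nat (n i) * v i))" unfolding S_def by (rule norm_sum)
    also have "\<dots> \<le> (\<Sum>i<4. real N * cmod (v i))"
    proof (rule sum_mono)
      fix i :: nat assume "i \<in> {..<4}"
      then have "n i \<le> N" using that by (auto simp: T_def PiE_iff)
      then show "cmod (of_nat (n i) * v i) \<le> real N * cmod (v i)" by (simp add: norm_mult mult_right_mono)
    qed
    finally show ?thesis by (simp add: V_def sum_distrib_left)
  qed
  have floor_bound: "\<lfloor>x / (r/2)\<rfloor> \<in> {-M..M}" if "\<bar>x\<bar> \<le> real N * V" for x
  proof -
    have "\<bar>x / (r/2)\<bar> \<le> real N * V * 2 / r" using that r by (simp add: field_simps)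
    also have "\<dots> \<le> real N * real C" using C mult_left_mono[of "2 * V / r" "real C" "real N"] by (simp add: mult_ac)
    finally have "\<bar>x / (r/2)\<bar> \<le> real (N * C)" by simp
    then have "- real (N * C) \<le> x / (r/2)" "x / (r/2) \<le> real (N * C)" by linarith+
    then show ?thesis unfolding M_def by (simp add: floor_le_iff le_floor_iff del: of_nat_mult)
  qed
  have "cell ` T \<subseteq> {-M..M} \<times> {-M..M}"
  proof (rule image_subsetI)
    fix n assume "n \<in> T"
    then have "\<bar>Re (S n)\<bar> \<le> real N * V" "\<bar>Im (S n)\<bar> \<le> real N * V"
      using bound abs_Re_le_cmod[of "S n"] abs_Im_le_cmod[of "S n"] by (meson order_trans)+
    then show "cell n \<in> {-M..M} \<times> {-M..M}" using floor_bound unfolding cell_def by blast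
  qed
  then have "card (cell ` T) \<le> card ({-M..M} \<times> {-M..M})" by (intro card_mono) auto
  also have "\<dots> = (2 * (N * C) + 3)^2"
    by (simp add: M_def card_cartesian_product power2_eq_square nat_add_distrib nat_mult_distrib algebra_simps)
  also have "\<dots> < ((N + 1)^2)^2"
  proof -
    have "2 * (N * C) + 3 < (N + 1)^2"
      by (simp add: N_def power2_eq_square algebra_simps)
    then show ?thesis by (intro power_strict_mono) auto
  qed
  also have "\<dots> = card T" unfolding T_def by (simp add: card_PiE power_mult[symmetric])
  finally have "\<not> inj_on cell T" using card_image by fastforce
  then obtain m n where mn: "m \<in> T" "n \<in> T" "m \<noteq> n" "cell m = cell n" unfolding inj_on_def by blast
  define k where "k i = int (m i) - int (n i)" for i
  have k: "(\<Sum>i<4. of_int (k i) * v i) = S m - S n"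
    by (simp add: k_def S_def left_diff_distrib sum_subtractf)
  have close: "\<bar>x - y\<bar> < r/2" if "\<lfloor>x / (r/2)\<rfloor> = \<lfloor>y / (r/2)\<rfloor>" for x y
  proof -
    have "\<bar>x / (r/2) - y / (r/2)\<bar> < 1" using that by linarith
    then have "\<bar>(x - y) / (r/2)\<bar> < 1" by (simp only: diff_divide_distrib)
    then have "(x - y) / (r/2) < 1" "-1 < (x - y) / (r/2)" by linarith+
    then have "x - y < 1 * (r/2)" "-1 * (r/2) < x - y"
      using r by (simp_all only: pos_divide_less_eq pos_less_divide_eq half_gt_zero)
    then show ?thesis by linarith
  qed
  have "cmod (S m - S n) \<le> \<bar>Re (S m - S n)\<bar> + \<bar>Im (S m - S n)\<bar>" by (rule cmod_le)
  also have "\<dots> < r" using close[of "Re (S m)" "Re (S n)"] close[of "Im (S m)" "Im (S n)"] mn(4) by (simp add: cell_def)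
  finally have "(\<Sum>i<4. of_int (k i) * v i) = 0" using discrete k by metis
  moreover obtain j where "j < 4" "k j \<noteq> 0"
  proof -
    have "\<exists>j<4. m j \<noteq> n j"
    proof (rule ccontr)
      assume "\<not> (\<exists>j<4. m j \<noteq> n j)"
      then have "m = n" using mn(1,2) unfolding T_def by (intro PiE_ext) auto
      then show False using mn(3) by simp
    qed
    then show thesis using that by (auto simp: k_def)
  qed
  ultimately show thesis using that by blast
qed

text \<open>Passing to classes is a homomorphism from the cycles, a subgroup of a free Abelian
  group, so the multiplicative powers are integer multiples of chains.\<close>

lemma homology_class_int_combination:
  fixes c :: "nat \<Rightarrow> 'a chain" and k :: "nat \<Rightarrow> int"
  assumes "\<And>i. i < 4 \<Longrightarrow> singular_relcycle 1 X {} (c i)"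
  defines "G \<equiv> homology_group 1 X" and "h \<equiv> homologous_rel_set 1 X {}"
  shows "(h (c 0) [^]\<^bsub>G\<^esub> k 0) \<otimes>\<^bsub>G\<^esub> (h (c 1) [^]\<^bsub>G\<^esub> k 1) \<otimes>\<^bsub>G\<^esub> (h (c 2) [^]\<^bsub>G\<^esub> k 2) \<otimes>\<^bsub>G\<^esub> (h (c 3) [^]\<^bsub>G\<^esub> k 3)
    = h (\<Sum>i<4. frag_cmul (k i) (c i))"
proof -
  let ?R = "relcycle_group 1 X {}"
  have G: "G = ?R Mod singular_relboundary_set 1 X {}"
    using nontrivial_relative_homology_group[of 1 X "{}"] by (simp add: G_def)
  have h: "h = (\<lambda>a. singular_relboundary_set 1 X {} #>\<^bsub>?R\<^esub> a)"
    unfolding h_def right_coset_singular_relboundary by simp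
  interpret n: normal "singular_relboundary_set 1 X {}" ?R
    by (rule normal_subgroup_singular_relboundary_relcycle)
  have hom: "h \<in> hom ?R G" unfolding G h by (rule n.r_coset_hom_Mod)
  have gG: "group G" unfolding G_def by simp
  have pow: "x [^]\<^bsub>?R\<^esub> m = frag_cmul m x" if "singular_relcycle 1 X {} x" for x and m :: int
  proof -
    have x: "x \<in> carrier ?R" using that by simp
    have "x [^]\<^bsub>?R\<^esub> m = x [^]\<^bsub>chain_group 1 X\<^esub> m"
      using group.int_pow_subgroup_generated[OF group_chain_group] x unfolding relcycle_group_def by blast
    also have "\<dots> = frag_cmul m x"
      unfolding chain_group_def using that by (intro int_pow_free_Abelian_group) (simp add: singular_cycle singular_chain_def)
    finally show ?thesis .
  qed
  have hp: "h x [^]\<^bsub>G\<^esub> m = h (frag_cmul m x)" if "singular_relcycle 1 X {} x" for x and m :: int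
    using hom_int_pow[OF hom _ n.is_group gG, of x m] that pow by simp
  have hm: "h x \<otimes>\<^bsub>G\<^esub> h y = h (x + y)" if "singular_relcycle 1 X {} x" "singular_relcycle 1 X {} y" for x y
    using hom_mult[OF hom, of x y] that by simp
  have cy: "singular_relcycle 1 X {} (frag_cmul (k i) (c i))" if "i < 4" for i
    using assms(1)[OF that] by (rule singular_relcycle_cmul)
  have "(\<Sum>i<4. frag_cmul (k i) (c i)) = frag_cmul (k 0) (c 0) + frag_cmul (k 1) (c 1) + frag_cmul (k 2) (c 2) + frag_cmul (k 3) (c 3)"
    by (simp add: eval_nat_numeral)
  then show ?thesis
    using cy[of 0] cy[of 1] cy[of 2] cy[of 3] assms(1)[of 0] assms(1)[of 1] assms(1)[of 2] assms(1)[of 3]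
    by (simp add: hp hm singular_relcycle_add)
qed

lemma frag_cmul_diff2: "frag_cmul k (a - b) = frag_cmul k a - frag_cmul k b"
  using frag_cmul_distrib2[of k "a - b" b] by (simp add: algebra_simps)

lemma frag_cmul_2: "frag_cmul 2 a = a + a"
  using frag_cmul_distrib[of 1 1 a] by simp

section \<open>The plane as a covering, and its deck motions\<close>

locale flat_covering =
  fixes P :: "complex \<Rightarrow> 'a::metric_space" and r :: real
  assumes flat: "flat_point (x::'a)" and r: "r > 0" and immP: "imm UNIV UNIV P" and surj: "surj P"
    and sheet: "iso_on (ball z r) P" "P ` ball z r = ball (P z) r"
begin

sublocale flat_region "UNIV :: 'a set"
  by unfold_locales (auto intro: flat)

lemma continuous_P: "continuous_on A P"
  using imm_continuous_on[OF immP] continuous_on_subset by blast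

text \<open>The disks in \<open>sheet\<close> all have the same radius \<open>r\<close>. Once
  \<open>[0,1]\<close> is cut so finely that \<open>h\<close> moves by less than \<open>r\<close> on
  each piece, the lift is continued through the inverse over the disk at the point reached.\<close>

lemma path_lift:
  fixes h :: "real \<Rightarrow> 'a"
  assumes h: "continuous_on {0..1} h" and z0: "P z0 = h 0"
  obtains H where "continuous_on {0..1} H" "H 0 = z0" "\<And>t. t \<in> {0..1} \<Longrightarrow> P (H t) = h t"
proof -
  have "uniformly_continuous_on {0..1} h" using compact_uniformly_continuous[OF h] by simp
  then obtain \<delta> where \<delta>: "\<delta> > 0" "\<And>s t. s \<in> {0..1} \<Longrightarrow> t \<in> {0..1} \<Longrightarrow> dist s t < \<delta> \<Longrightarrow> dist (h s) (h t) < r"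
    unfolding uniformly_continuous_on_def using r by metis
  obtain n :: nat where n: "n > 0" "1 / real n < \<delta>" using reals_Archimedean[OF \<delta>(1)] by (metis inverse_eq_divide zero_less_Suc)
  define x where "x k = real k / real n" for k
  have x: "x 0 = 0" "x n = 1" "x k \<le> x (Suc k)" "x k \<ge> 0" for k using n by (auto simp: x_def divide_right_mono)
  have "\<exists>H. continuous_on {0..x k} H \<and> H 0 = z0 \<and> (\<forall>t\<in>{0..x k}. P (H t) = h t)" if "k \<le> n" for k
    using that
  proof (induction k)
    case 0
    then show ?case using z0 x(1) by (intro exI[of _ "\<lambda>t. z0"]) auto
  next
    case (Suc k)
    then obtain H where H: "continuous_on {0..x k} H" "H 0 = z0" "\<And>t. t \<in> {0..x k} \<Longrightarrow> P (H t) = h t" by auto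
    define z where "z = H (x k)"
    have Pz: "P z = h (x k)" using H(3)[of "x k"] x(4) by (simp add: z_def)
    have x1: "x (Suc k) \<le> 1" using Suc.prems n by (simp add: x_def)
    have near: "h t \<in> ball (P z) r" if "t \<in> {x k..x (Suc k)}" for t
    proof -
      have "x (Suc k) - x k = 1 / real n" using n by (simp add: x_def add_divide_distrib)
      then have "dist (x k) t < \<delta>" using that n(2) by (simp add: dist_real_def)
      then show ?thesis using \<delta>(2)[of "x k" t] that x(4)[of k] x1 x(3)[of k] Pz by simp
    qed
    define g where "g = inv_into (ball z r) P"
    have g: "P (g y) = y" "g y \<in> ball z r" if "y \<in> ball (P z) r" for y
      using that sheet(2)[of z] unfolding g_def by (metis f_inv_into_f, metis inv_into_into)
    have isog: "iso_on (ball (P z) r) g" unfolding g_def by (rule iso_on_inv_into[OF sheet(1)]) (simp add: sheet(2))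
    have contg: "continuous_on (ball (P z) r) g"
      unfolding continuous_on_iff using isog by (metis iso_onD)
    have gz: "g (P z) = z" unfolding g_def by (rule inv_into_f_f[OF iso_on_inj[OF sheet(1)]]) (use r in simp)
    define H' where "H' t = (if t \<le> x k then H t else g (h t))" for t
    have "{0..x (Suc k)} = {0..x k} \<union> {x k..x (Suc k)}" using x(3,4)[of k] by auto
    moreover have "continuous_on ({0..x k} \<union> {x k..x (Suc k)}) H'"
      unfolding H'_def
    proof (rule continuous_on_cases)
      show "continuous_on {0..x k} H" by (rule H(1))
      have "continuous_on {x k..x (Suc k)} h" using h by (rule continuous_on_subset) (use x(4)[of k] x1 in auto)
      then show "continuous_on {x k..x (Suc k)} (\<lambda>t. g (h t))"
        by (rule continuous_on_compose2[OF contg]) (use near in blast)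
      show "\<forall>t. t \<in> {0..x k} \<and> \<not> t \<le> x k \<or> t \<in> {x k..x (Suc k)} \<and> t \<le> x k \<longrightarrow> H t = g (h t)"
      proof (intro allI impI)
        fix t assume "t \<in> {0..x k} \<and> \<not> t \<le> x k \<or> t \<in> {x k..x (Suc k)} \<and> t \<le> x k"
        then have "t = x k" by auto
        then show "H t = g (h t)" using gz Pz by (simp add: z_def)
      qed
    qed auto
    moreover have "P (H' t) = h t" if "t \<in> {0..x (Suc k)}" for t
    proof (cases "t \<le> x k")
      case True
      then show ?thesis using H(3) that by (simp add: H'_def)
    next
      case False
      then have "h t \<in> ball (P z) r" using near that by simp
      then show ?thesis using g(1) False by (simp add: H'_def)
    qed
    ultimately show ?case using H(2) x(4)[of k] by (intro exI[of _ H']) (auto simp: H'_def)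
  qed
  from this[OF order_refl] show thesis using x(2) that by auto
qed

text \<open>The sheet around \<open>w\<close> serves as a chart. Seen in it, \<open>P\<close> near
  \<open>z\<close> is a motion carrying \<open>z\<close> to \<open>w\<close>, and unique
  continuation over the plane makes the resulting invariance of \<open>P\<close> global.\<close>

lemma deck_transformation:
  assumes "P z = P w"
  obtains k u c where "cmod u = 1" "\<And>y. P (mot k u c y) = P y" "mot k u c z = w"
proof -
  have ch: "isochart UNIV r (P w) (\<lambda>y. P (w + y))" by (rule isochartI_iso[OF sheet]) simp
  have "dist (P w) (P z) + r \<le> r" using assms by simp
  then obtain k u c where m: "cmod u = 1" "\<And>y. y \<in> ball z r \<Longrightarrow> P y = P (w + mot k u c y) \<and> mot k u c y \<in> ball 0 r"
    using iso_on_chart_eq_mot[OF ch sheet(1) r, of z] by (metis (no_types, lifting))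
  have m': "w + mot k u c y = mot k u (w + c) y" for y by (simp add: mot_def)
  have "P (mot k u (w + c) y) = P y" for y
  proof (rule imm_unique[of UNIV "\<lambda>y. P (mot k u (w + c) y)" P z r])
    show "imm UNIV UNIV (\<lambda>y. P (mot k u (w + c) y))" using imm_compose_mot[OF immP m(1), of k "w + c"] by simp
  qed (use m(2) m' r immP in auto)
  moreover have "mot k u (w + c) z = w"
  proof -
    have "P (mot k u (w + c) z) = P w" "mot k u (w + c) z \<in> ball w r"
      using m(2)[of z] r assms unfolding m'[symmetric] by (simp_all add: dist_norm)
    then show ?thesis using iso_on_inj[OF sheet(1)[of w]] r by (auto dest: inj_onD)
  qed
  ultimately show thesis using m(1) that by blast
qed

text \<open>A motion fixing \<open>z\<close> preserves the disk of radius \<open>r\<close> about it;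
  \<open>P\<close> is injective there, so a deck motion must be the identity on it.\<close>

lemma deck_fixed_point:
  assumes u: "cmod u = 1" and P: "\<And>y. P (mot k u c y) = P y" and z: "mot k u c z = z"
  shows "k = False" "u = 1" "c = 0"
proof -
  have "mot k u c y = mot False 1 0 y" if "y \<in> ball z r" for y
  proof -
    have "mot k u c y \<in> ball z r" using that dist_mot[OF u, of k c z y] z by simp
    then have "mot k u c y = y" using P[of y] that iso_on_inj[OF sheet(1)[of z]] by (auto dest: inj_onD)
    then show ?thesis by (simp add: mot_def)
  qed
  from mot_eqI[OF r this u] show "k = False" "u = 1" "c = 0" by auto
qed

definition periods :: "complex set" where
  "periods = {v. \<forall>z. P (z + v) = P z}"

lemma periodsD:
  assumes "v \<in> periods" shows "P (z + v) = P z" "P (v + z) = P z"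
proof -
  show "P (z + v) = P z" using assms by (simp add: periods_def)
  then show "P (v + z) = P z" by (simp only: add.commute[of v z])
qed

lemma periods_closed: "0 \<in> periods" "v \<in> periods \<Longrightarrow> w \<in> periods \<Longrightarrow> v - w \<in> periods"
proof -
  show "0 \<in> periods" by (simp add: periods_def)
  assume "v \<in> periods" "w \<in> periods"
  then have "P (z + (v - w)) = P z" for z
    unfolding periods_def mem_Collect_eq by (metis add_diff_eq diff_add_cancel)
  then show "v - w \<in> periods" by (simp add: periods_def)
qed

lemma periods_discrete: 
  assumes "v \<in> periods" "cmod v < r" shows "v = 0"
  using iso_onD[OF sheet(1)[of 0], of v 0] periodsD(2)[OF assms(1), of 0] assms(2) r by simp

text \<open>An orientation-preserving motion with \<open>u \<noteq> 1\<close> has the fixed point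
  \<open>c / (1 - u)\<close>, impossible for a deck motion, so it is already a translation. An
  orientation-reversing one squares to a translation.\<close>

lemma deck_square_period:
  assumes u: "cmod u = 1" and P: "\<And>y. P (mot k u c y) = P y"
  shows "mot k u c (mot k u c 0) \<in> periods"
proof -
  have uu: "u * cnj u = 1" using u by (metis complex_norm_square of_real_1 power_one)
  have "mot k u c (mot k u c y) = y + mot k u c (mot k u c 0)" for y
  proof (cases k)
    case True
    have "u * (cnj u * y) = y" using uu by (simp flip: mult.assoc)
    then show ?thesis using True by (simp add: mot_def distrib_left)
  next
    case False
    have "u = 1"
    proof (rule ccontr)
      assume "u \<noteq> 1"
      then have "mot k u c (c / (1 - u)) = c / (1 - u)" using False by (simp add: mot_def field_simps)
      from deck_fixed_point(2)[OF u P this] show False using \<open>u \<noteq> 1\<close> by simp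
    qed
    then show ?thesis using False by (simp add: mot_def)
  qed
  then have "P (y + mot k u c (mot k u c 0)) = P y" for y using P by metis
  then show ?thesis by (simp add: periods_def)
qed

abbreviation homol :: "'a chain \<Rightarrow> 'a chain \<Rightarrow> bool" where
  "homol \<equiv> homologous_rel 1 euclidean {}"

definition seg :: "complex \<Rightarrow> complex \<Rightarrow> 'a chain" where
  "seg z w = chain_map 1 P (segment_chain z w)"

lemma seg_deck:
  assumes "\<And>y. P (mot k u c y) = P y"
  shows "seg (mot k u c z) (mot k u c w) = seg z w"
proof -
  have "P \<circ> linepath (mot k u c z) (mot k u c w) = P \<circ> linepath z w"
    using assms mot_linepath by (fastforce simp: fun_eq_iff simp flip: mot_linepath)
  then show ?thesis unfolding seg_def segment_chain_def chain_map_of simplex_map_path_simplex by simp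
qed

lemma seg_period:
  assumes "v \<in> periods" shows "seg (z + v) (w + v) = seg z w"
  using seg_deck[of False 1 v z w] periodsD[OF assms] by (simp add: mot_def)

text \<open>Evaluates a 0-simplex at its only point and joins 0 to a chosen preimage of the value.
  Extended linearly, it closes up every path through the base point, and its total contribution to a
  cycle is 0.\<close>

definition base_seg :: "((nat \<Rightarrow> real) \<Rightarrow> 'a) \<Rightarrow> 'a chain" where
  "base_seg s = seg 0 (inv_into UNIV P (s (\<lambda>j. if j = 0 then 1 else 0)))"

lemma base_seg_point: "base_seg (point_simplex a) = seg 0 (inv_into UNIV P a)"
  by (simp add: base_seg_def point_simplex_def standard_simplex_0)

text \<open>The square of a deck transformation is a translation, whence the factor 2.\<close>

lemma double_simplex_homologous:
  assumes "singular_simplex 1 euclidean s"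
  obtains v where "v \<in> periods"
    "homol (frag_cmul 2 (frag_of s)) (frag_cmul 2 (frag_extend base_seg (chain_boundary 1 (frag_of s))) + seg 0 v)"
proof -
  obtain h where h: "continuous_on {0..1} h" "s = path_simplex h"
    using singular_simplex_1_cases[OF assms] by blast
  have invP: "P (inv_into UNIV P q) = q" for q using surj by (rule surj_f_inv_f)
  define x where "x = inv_into UNIV P (h 0)"
  define w where "w = inv_into UNIV P (h 1)"
  obtain H where H: "continuous_on {0..1} H" "H 0 = x" "\<And>t. t \<in> {0..1} \<Longrightarrow> P (H t) = h t"
    using path_lift[OF h(1), of x] invP by (metis x_def)
  define y where "y = H 1"
  have "P w = P y" using H(3)[of 1] invP by (simp add: y_def w_def)
  then obtain k u c where m: "cmod u = 1" "\<And>y. P (mot k u c y) = P y" "mot k u c w = y"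
    using deck_transformation by blast
  \<comment> \<open>The lift started at the chosen preimage \<open>x\<close> ends at
    \<open>y\<close>, which need not be the chosen preimage \<open>w\<close> of the end point;
    \<sigma> measures the discrepancy.\<close>
  define \<sigma> where "\<sigma> = mot k u c"
  define v where "v = \<sigma> (\<sigma> 0)"
  have v: "v \<in> periods" unfolding v_def \<sigma>_def by (rule deck_square_period[OF m(1,2)])
  have seg\<sigma>: "seg (\<sigma> a) (\<sigma> b) = seg a b" for a b unfolding \<sigma>_def by (rule seg_deck[OF m(2)])
  define C where "C = frag_cmul 2 (frag_of (path_simplex H))"
  \<comment> \<open>A chain with the same boundary as the doubled lift: the route from
    \<open>x\<close> through 0 and \<open>\<sigma> 0\<close> to \<open>y\<close>, taken twice. Its
    last leg projects to the segment from 0 to \<open>w\<close>.\<close>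
  define D where "D = frag_cmul 2 (segment_chain (\<sigma> 0) y) - frag_cmul 2 (segment_chain 0 x)
      + (segment_chain 0 (\<sigma> 0) + segment_chain 0 (\<sigma> 0))"
  define E where "E = frag_cmul 2 (segment_chain (\<sigma> 0) y) - frag_cmul 2 (segment_chain 0 x)"
  have PC: "chain_map 1 P C = frag_cmul 2 (frag_of s)"
  proof -
    have "path_simplex (P \<circ> H) = path_simplex h" by (rule path_simplex_cong) (simp add: H(3))
    then show ?thesis unfolding C_def chain_map_cmul chain_map_of simplex_map_path_simplex h(2) by simp
  qed
  have sc: "singular_chain 1 euclidean C" "singular_chain 1 euclidean D"
    unfolding C_def D_def
    by (intro singular_chain_cmul singular_chain_add singular_chain_diff singular_chain_segment singular_chain_path[OF H(1)])+
  have "chain_boundary 1 C = chain_boundary 1 D"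
    unfolding C_def D_def chain_boundary_cmul chain_boundary_add chain_boundary_diff
      chain_boundary_path_simplex chain_boundary_segment H(2) y_def[symmetric]
    by (simp add: frag_cmul_distrib2 frag_cmul_diff2 frag_cmul_2)
  from chain_map_homologous_complex[OF continuous_P sc this]
  have 1: "homol (frag_cmul 2 (frag_of s)) (chain_map 1 P D)" unfolding PC .
  have D: "chain_map 1 P D = frag_cmul 2 (seg (\<sigma> 0) y) - frag_cmul 2 (seg 0 x) + (seg 0 (\<sigma> 0) + seg 0 (\<sigma> 0))"
    unfolding D_def seg_def by (simp add: chain_map_add chain_map_diff)
  have "seg (\<sigma> 0) y = seg 0 w" using seg\<sigma>[of 0 w] m(3) by (simp add: \<sigma>_def)
  moreover have "frag_extend base_seg (chain_boundary 1 (frag_of s)) = seg 0 w - seg 0 x"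
    unfolding h(2) chain_boundary_path_simplex by (simp add: frag_extend_diff base_seg_point w_def x_def)
  \<comment> \<open>One of the two copies of the segment from 0 to \<open>\<sigma> 0\<close> is
    replaced by its image under \<sigma>, so that the two join up to a path from 0 to the period
    \<open>v\<close>.\<close>
  ultimately have D': "chain_map 1 P D = frag_cmul 2 (frag_extend base_seg (chain_boundary 1 (frag_of s)))
      + (seg 0 (\<sigma> 0) + seg (\<sigma> 0) v)"
    using D seg\<sigma>[of 0 "\<sigma> 0"] by (simp add: v_def frag_cmul_diff2)
  have "homol (chain_map 1 P (segment_chain 0 (\<sigma> 0) + segment_chain (\<sigma> 0) v)) (chain_map 1 P (segment_chain 0 v))"
    by (rule chain_map_homologous_complex[OF continuous_P])
      (intro singular_chain_add singular_chain_segment, rule singular_chain_segment,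
        simp only: chain_boundary_add chain_boundary_segment, simp)
  then have "homol (seg 0 (\<sigma> 0) + seg (\<sigma> 0) v) (seg 0 v)" by (simp add: seg_def chain_map_add)
  then have "homol (chain_map 1 P D) (frag_cmul 2 (frag_extend base_seg (chain_boundary 1 (frag_of s))) + seg 0 v)"
    unfolding D' by (intro homologous_rel_add homologous_rel_refl)
  from homologous_rel_trans[OF this 1] show thesis using v that by blast
qed

text \<open>Translating by \<open>v - w\<close> moves the segment of \<open>w\<close> so that it
  ends at \<open>v\<close>; removing it from the segment of \<open>v\<close> leaves a path from 0 to
  \<open>v - w\<close>.\<close>

lemma seg_diff_period:
  assumes "v \<in> periods" "w \<in> periods"
  shows "homol (seg 0 v - seg 0 w) (seg 0 (v - w))"
proof -
  have "seg 0 w = seg (v - w) v" using seg_period[OF periods_closed(2)[OF assms], of 0 w] by simp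
  moreover have "homol (chain_map 1 P (segment_chain 0 v - segment_chain (v - w) v)) (chain_map 1 P (segment_chain 0 (v - w)))"
    by (rule chain_map_homologous_complex[OF continuous_P])
      (intro singular_chain_diff singular_chain_segment, rule singular_chain_segment,
        simp only: chain_boundary_diff chain_boundary_segment, simp)
  ultimately show ?thesis by (simp add: seg_def chain_map_diff)
qed

text \<open>Stated for all chains, because single simplices are not cycles. The boundary term is
  additive, so it can be carried through the induction and disappears for cycles.\<close>

lemma double_chain_homologous:
  assumes "singular_chain 1 euclidean c"
  shows "\<exists>v\<in>periods. homol (frag_cmul 2 c) (frag_cmul 2 (frag_extend base_seg (chain_boundary 1 c)) + seg 0 v)"
  using assms unfolding singular_chain_def
proof (induction c rule: frag_induction)
  case zero
  have "homol (seg 0 0 - seg 0 0) (seg 0 (0 - 0))" by (rule seg_diff_period) (simp_all add: periods_closed)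
  then show ?case using periods_closed(1) by (intro bexI[of _ 0]) simp_all
next
  case (one s)
  then show ?case using double_simplex_homologous by blast
next
  case (diff c d)
  then obtain v w where v: "v \<in> periods" "homol (frag_cmul 2 c) (frag_cmul 2 (frag_extend base_seg (chain_boundary 1 c)) + seg 0 v)"
    and w: "w \<in> periods" "homol (frag_cmul 2 d) (frag_cmul 2 (frag_extend base_seg (chain_boundary 1 d)) + seg 0 w)" by blast
  let ?B = "\<lambda>c. frag_cmul 2 (frag_extend base_seg (chain_boundary 1 c))"
  have "homol (frag_cmul 2 c - frag_cmul 2 d) ((?B c + seg 0 v) - (?B d + seg 0 w))"
    by (rule homologous_rel_diff[OF v(2) w(2)])
  also have "(?B c + seg 0 v) - (?B d + seg 0 w) = ?B (c - d) + (seg 0 v - seg 0 w)"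
    by (simp add: chain_boundary_diff frag_extend_diff frag_cmul_diff2)
  finally have 1: "homol (frag_cmul 2 (c - d)) (?B (c - d) + (seg 0 v - seg 0 w))"
    unfolding frag_cmul_diff2[of 2 c d] .
  have 2: "homol (?B (c - d) + (seg 0 v - seg 0 w)) (?B (c - d) + seg 0 (v - w))"
    by (intro homologous_rel_add homologous_rel_refl seg_diff_period v w)
  have "homol (frag_cmul 2 (c - d)) (?B (c - d) + seg 0 (v - w))"
    by (rule homologous_rel_trans[OF 2 1])
  then show ?case using periods_closed(2)[OF v(1) w(1)] by blast
qed

text \<open>The pairs of a period and a chain homologous to its segment are closed under differences
  and contain zero, so they are closed under integer combinations.\<close>

lemma period_class_int_combination:
  assumes "\<And>i. i < (n::nat) \<Longrightarrow> v i \<in> periods \<and> homol (c i) (seg 0 (v i))"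
  shows "(\<Sum>i<n. of_int (k i) * v i) \<in> periods \<and>
    homol (\<Sum>i<n. frag_cmul (k i) (c i)) (seg 0 (\<Sum>i<n. of_int (k i) * v i))"
proof -
  define R where "R v c \<longleftrightarrow> v \<in> periods \<and> homol c (seg 0 v)" for v c
  have R_diff: "R (v - w) (c - d)" if "R v c" "R w d" for v w c d
    using that homologous_rel_diff homologous_rel_trans[OF seg_diff_period] periods_closed(2) unfolding R_def by blast
  have seg0: "homol (0 :: 'a chain) (seg 0 0)"
    using seg_diff_period[OF periods_closed(1) periods_closed(1)] by simp
  then have R0: "R 0 0" using periods_closed(1) by (simp add: R_def)
  have R_add: "R (v + w) (c + d)" if "R v c" "R w d" for v w c d
    using R_diff[OF that(1) R_diff[OF R0 that(2)]] by simp
  have R_int: "R (of_int k * v) (frag_cmul k c)" if "R v c" for k v c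
  proof (induction k rule: int_induct[of _ 0])
    case base then show ?case using R0 by simp
  next
    case (step1 i)
    then show ?case using R_add[OF step1(2) that] by (simp add: frag_cmul_distrib distrib_right)
  next
    case (step2 i)
    then show ?case using R_diff[OF step2(2) that] by (simp add: frag_cmul_diff_distrib left_diff_distrib)
  qed
  have "R (\<Sum>i<m. of_int (k i) * v i) (\<Sum>i<m. frag_cmul (k i) (c i))" if "m \<le> n" for m
    using that
  proof (induction m)
    case (Suc m)
    then have "R (of_int (k m) * v m) (frag_cmul (k m) (c m))" using assms[of m] by (intro R_int) (simp add: R_def)
    then show ?case using Suc R_add by simp
  qed (simp add: R0)
  then show ?thesis by (simp add: R_def)
qed

text \<open>Twice each class is represented by a period. Among four periods, which lie in a discrete
  group, there is an integer relation \<open>k\<close>, and it becomes the relation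
  \<open>2 * k\<close> among the classes.\<close>

lemma no_four_independent_classes:
  fixes a :: "nat \<Rightarrow> 'a chain set"
  assumes a: "\<And>i. i < 4 \<Longrightarrow> a i \<in> carrier (homology_group 1 (euclidean :: 'a topology))"
  obtains k :: "nat \<Rightarrow> int" and j where "j < 4" "k j \<noteq> 0"
    "(a 0 [^]\<^bsub>homology_group 1 euclidean\<^esub> k 0) \<otimes>\<^bsub>homology_group 1 euclidean\<^esub>
     (a 1 [^]\<^bsub>homology_group 1 euclidean\<^esub> k 1) \<otimes>\<^bsub>homology_group 1 euclidean\<^esub>
     (a 2 [^]\<^bsub>homology_group 1 euclidean\<^esub> k 2) \<otimes>\<^bsub>homology_group 1 euclidean\<^esub>
     (a 3 [^]\<^bsub>homology_group 1 euclidean\<^esub> k 3) = \<one>\<^bsub>homology_group 1 (euclidean :: 'a topology)\<^esub>"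
proof -
  have "\<exists>c. singular_relcycle 1 euclidean {} c \<and> a i = homologous_rel_set 1 euclidean {} c" if "i < 4" for i
    using a[OF that] carrier_relative_homology_group[of 1 "euclidean :: 'a topology" "{}"] by auto
  then obtain c :: "nat \<Rightarrow> 'a chain" where c: "\<And>i. i < 4 \<Longrightarrow> singular_relcycle 1 euclidean {} (c i)"
    "\<And>i. i < 4 \<Longrightarrow> a i = homologous_rel_set 1 euclidean {} (c i)" by metis
  have "\<exists>v\<in>periods. homol (frag_cmul 2 (c i)) (seg 0 v)" if "i < 4" for i
    using double_chain_homologous[of "c i"] c(1)[OF that] by (simp add: singular_cycle)
  then obtain v :: "nat \<Rightarrow> complex" where v: "\<And>i. i < 4 \<Longrightarrow> v i \<in> periods \<and> homol (frag_cmul 2 (c i)) (seg 0 (v i))" by metis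
  note comb = period_class_int_combination[of 4 v "\<lambda>i. frag_cmul 2 (c i)", OF v]
  have disc: "(\<Sum>i<4. of_int (k i) * v i) = 0" if "cmod (\<Sum>i<4. of_int (k i) * v i) < r" for k
    using periods_discrete[OF conjunct1[OF comb] that] by simp
  obtain k :: "nat \<Rightarrow> int" and j where k: "j < 4" "k j \<noteq> 0" "(\<Sum>i<4. of_int (k i) * v i) = 0"
  proof (rule integer_relation_of_discrete[OF r, of v])
    show "(\<Sum>i<4. of_int (k i) * v i) = 0" if "cmod (\<Sum>i<4. of_int (k i) * v i) < r" for k :: "nat \<Rightarrow> int"
      using that by (rule disc)
  qed blast
  have "homol (\<Sum>i<4. frag_cmul (2 * k i) (c i)) (seg 0 0)"
    using comb[of k] k(3) by (simp add: mult.commute)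
  moreover have "homol (seg 0 0) 0"
    using seg_diff_period[OF periods_closed(1) periods_closed(1)]
    unfolding diff_self by (subst homologous_rel_sym)
  ultimately have "homol (\<Sum>i<4. frag_cmul (2 * k i) (c i)) 0" using homologous_rel_trans by blast
  then have "homologous_rel_set 1 euclidean {} (\<Sum>i<4. frag_cmul (2 * k i) (c i)) = singular_relboundary_set 1 euclidean {}"
    unfolding homologous_rel_set_eq_relboundary by (simp add: homologous_rel_def)
  then have "homologous_rel_set 1 euclidean {} (\<Sum>i<4. frag_cmul (2 * k i) (c i)) = \<one>\<^bsub>homology_group 1 (euclidean :: 'a topology)\<^esub>"
    using one_relative_homology_group[of 1 "euclidean :: 'a topology" "{}"] by simp
  then show thesis
    using homology_class_int_combination[where c = c and k = "\<lambda>i. 2 * k i", OF c(1)] c(2) k by (intro that[of j "\<lambda>i. 2 * k i"]) simp_all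
qed

end

text \<open>The exponential map of a flat surface: from one chart a half-strip is developed in every
  direction, and the half-strips, all convex and containing 0, glue to a map on the plane.\<close>

lemma flat_covering_exists:
  assumes cpt: "compact (UNIV :: 'a::metric_space set)" and flat: "\<And>x::'a. flat_point x"
    and mid: "\<And>x y::'a. \<exists>m. dist x m = dist x y / 2 \<and> dist m y = dist x y / 2"
  obtains P r where "flat_covering (P :: complex \<Rightarrow> 'a) r"
proof -
  interpret flat_region "UNIV :: 'a set" by unfold_locales (auto intro: flat)
  obtain r where r: "r > 0" "\<And>p::'a. \<exists>\<psi>. isochart UNIV r p \<psi>"
    using uniform_isochart[of "UNIV :: 'a set" UNIV] cpt flat by auto
  \<comment> \<open>\<open>undefined\<close> is simply some base point.\<close>
  obtain \<phi> where \<phi>: "isochart UNIV r (undefined :: 'a) \<phi>" using r(2) by blast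
  have iso\<phi>: "iso_on (ball 0 r) \<phi>" using \<phi> by (simp add: isochart_def)
  have imm\<phi>: "imm UNIV (ball 0 r) \<phi>" by (rule imm_isochart_ball[OF iso\<phi>]) simp
  define H where "H = half_strip (-r/4) (-r/4) (r/4)"
  have H0: "0 \<in> H" "convex H" using r(1) by (auto simp: H_def) (simp add: half_strip_def)
  have ray: "germ_extends {y. cnj u * (y - 0) \<in> H} \<phi>" "convex {y. cnj u * (y - 0) \<in> H}" if u: "cmod u = 1" for u
  proof -
    define f where "f z = \<phi> (mot False u 0 z)" for z
    have "mot False u 0 ` ball 0 r = ball 0 r" using mot_image_ball[OF u, of False 0 0 r] by (simp add: mot_def)
    then have isof: "iso_on (ball 0 r) f"
      unfolding f_def using iso_on_compose[OF iso_on_mot[OF u] _ iso\<phi>] by simp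
    obtain F where F: "imm UNIV H F" "\<And>z. z \<in> ball 0 (r/4) \<Longrightarrow> F z = f z"
      unfolding H_def by (rule imm_extend_along_axis[OF r(1) isof]) (use r(2) in auto)
    have "germ_extends H f" by (rule germ_extendsI[OF F(1), of "r/4"]) (use F(2) r(1) in auto)
    then show "germ_extends {y. cnj u * (y - 0) \<in> H} \<phi>" "convex {y. cnj u * (y - 0) \<in> H}"
      using germ_extends_translate_back[of 1 f \<phi> u 0 r H, OF _ _ imm\<phi> _ u _ H0(2,1)] r(1) H0(1) by (simp_all add: f_def)
  qed
  have "germ_extends (\<Union>u\<in>sphere 0 1. {y. cnj u * (y - 0) \<in> H}) \<phi>"
    by (rule germ_extends_UN) (use ray H0 in auto)
  moreover have "(\<Union>u\<in>sphere 0 1. {y. cnj u * (y - 0) \<in> H}) = UNIV"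
  proof -
    have "\<exists>u\<in>sphere 0 1. cnj u * (y - 0) \<in> H" for y
    proof (cases "y = 0")
      case True
      then show ?thesis using H0(1) by (intro bexI[of _ 1]) auto
    next
      case False
      \<comment> \<open>Each nonzero \<open>y\<close> lies on the axis of the half-strip in its own
        direction \<open>sgn y\<close>.\<close>
      have "cnj (sgn y) * y = of_real (cmod y)"
        using False by (simp add: sgn_div_norm scaleR_conv_of_real field_simps complex_norm_square[symmetric] power2_eq_square)
      moreover have "-r/4 < cmod y" using r(1) norm_ge_zero[of y] by linarith
      ultimately have "cnj (sgn y) * (y - 0) \<in> H" using r(1) by (simp add: H_def half_strip_def)
      then show ?thesis using False by (intro bexI[of _ "sgn y"]) (auto simp: norm_sgn)
    qed
    then show ?thesis by blast
  qed
  ultimately obtain P :: "complex \<Rightarrow> 'a" where P: "imm UNIV UNIV P" by (auto simp: germ_extends_def)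
  have sheet: "iso_on (ball z r) P \<and> P ` ball z r = ball (P z) r" for z
  proof -
    obtain e where e: "e > 0" "iso_on (ball z e) P" using immD(2)[OF P] by blast
    obtain \<psi> where "isochart UNIV r (P z) \<psi>" using r(2) by blast
    then obtain F' where F': "iso_on (ball z r) F'" "F' ` ball z r = ball (P z) r"
        "\<And>w. w \<in> ball z e \<Longrightarrow> w \<in> ball z r \<Longrightarrow> F' w = P w"
      using chart_extend[OF _ e(2,1) r(1)] by blast
    have "P w = F' w" if "w \<in> ball z r" for w
      by (rule imm_agree[OF P imm_isochart_ball[OF F'(1)], of z "min e r"]) (use e r F'(3) that in auto)
    then show ?thesis using F'(1,2) iso_on_cong[of "ball z r" P F'] by (simp add: image_def)
  qed
  have "surj P"
  proof -
    \<comment> \<open>The disk of radius one more than the distance to \<open>q\<close> must cover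
      \<open>q\<close>, since nothing obstructs the immersion of disks of any size.\<close>
    have "q \<in> P ` ball 0 (dist (P 0) q + 1)" for q
      by (rule imm_ball_covers[OF imm_subset[OF P] mid]) auto
    then show ?thesis by blast
  qed
  then have "flat_covering P r" by unfold_locales (use flat r(1) P sheet in auto)
  then show thesis by (rule that)
qed

theorem theorem3p3:
  fixes Sing :: "'a::metric_space set" and \<theta> :: "'a \<Rightarrow> real"
    and g :: "real \<Rightarrow> 'a" and D :: "real set"
  assumes "closed_orientable_genus_ge2 (euclidean :: 'a topology)"
    and "euclidean_cone_surface Sing \<theta>"
    and "\<forall>s\<in>Sing. \<theta> s > 2 * pi"
    and "D = UNIV \<or> D = {0..}"
    and "local_isometry_on D g"
    and "\<not> periodic_on D g"
  shows "\<forall>\<epsilon>>0. \<exists>t\<in>D. \<exists>s\<in>Sing. dist (g t) s < \<epsilon>"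
proof (rule ccontr)
  assume "\<not> ?thesis"
  then obtain \<epsilon> where \<epsilon>: "\<epsilon> > 0" "\<And>t s. t \<in> D \<Longrightarrow> s \<in> Sing \<Longrightarrow> \<epsilon> \<le> dist (g t) s"
    by (metis not_less)
  have cpt: "compact (UNIV :: 'a set)"
    using assms(1) unfolding closed_orientable_genus_ge2_def by (simp add: compact_space_def)
  have "Sing \<noteq> {}"
  proof
    assume "Sing = {}"
    then have flat: "flat_point x" and mid: "\<exists>m. dist x m = dist x y / 2 \<and> dist m y = dist x y / 2" for x y :: 'a
      using assms(2) by (auto simp: euclidean_cone_surface_def)
    obtain P r where "flat_covering (P :: complex \<Rightarrow> 'a) r"
      using flat_covering_exists[OF cpt flat mid] by blast
    then interpret flat_covering P r .
    obtain a :: "nat \<Rightarrow> 'a chain set" where a: "\<forall>i<4. a i \<in> carrier (homology_group 1 (euclidean :: 'a topology))"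
      and indep: "\<forall>k::nat \<Rightarrow> int.
           (a 0 [^]\<^bsub>homology_group 1 (euclidean :: 'a topology)\<^esub> k 0) \<otimes>\<^bsub>homology_group 1 (euclidean :: 'a topology)\<^esub>
           (a 1 [^]\<^bsub>homology_group 1 (euclidean :: 'a topology)\<^esub> k 1) \<otimes>\<^bsub>homology_group 1 (euclidean :: 'a topology)\<^esub>
           (a 2 [^]\<^bsub>homology_group 1 (euclidean :: 'a topology)\<^esub> k 2) \<otimes>\<^bsub>homology_group 1 (euclidean :: 'a topology)\<^esub>
           (a 3 [^]\<^bsub>homology_group 1 (euclidean :: 'a topology)\<^esub> k 3) = \<one>\<^bsub>homology_group 1 (euclidean :: 'a topology)\<^esub>
           \<longrightarrow> (\<forall>i<4. k i = 0)"
      using assms(1) unfolding closed_orientable_genus_ge2_def by (elim conjE exE) (rule that)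
    show False
      by (rule no_four_independent_classes[of a]) (use a indep in blast)+
  qed
  from avoiding_singularities_imp_periodic[OF cpt assms(2) this assms(4,5) \<epsilon>] assms(6) show False by blast
qed

end
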